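(* Let $0 < \theta \le 1$, $C_{\mathrm{mark}} \ge 1$, $\lambda > 0$, and $u_0^0 \in \mathcal{X}_0$ be arbitrary. Consider the adaptive finite element algorithm with contractive solver (described in the context) for the second-order linear elliptic boundary value problem (described in the context), run with these parameters, and the resulting index set $\mathcal{Q}$, iterates $u_\ell^k$, exact discrete solutions $u_\ell^\star$, and error estimators $\eta_\ell$. Define the quasi-error $$\mathrm{H}_\ell^k := |||u_\ell^\star - u_\ell^k||| + \eta_\ell(u_\ell^k) \quad\text{for } (\ell,k)\in\mathcal{Q}.$$ Then there exist constants $0 < q_{\mathrm{lin}} < 1$ and $C_{\mathrm{lin}} > 0$ such that $$\mathrm{H}_\ell^k \le C_{\mathrm{lin}}\, q_{\mathrm{lin}}^{|\ell,k| - |\ell',k'|}\, \mathrm{H}_{\ell'}^{k'} \quad \text{for all } (\ell',k'),(\ell,k)\in\mathcal{Q} \text{ with } |\ell',k'| \le |\ell,k|.$$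
   Context: **Model problem.** $\Omega\subset\mathbb{R}^d$, $d\ge1$, is a bounded polyhedral Lipschitz domain. Consider $-\operatorname{div}(\boldsymbol{A}\nabla u^\star)+\boldsymbol{b}\cdot\nabla u^\star+cu^\star=f-\operatorname{div}\boldsymbol{f}$ in $\Omega$, $u^\star=0$ on $\partial\Omega$, where $\boldsymbol{A},\boldsymbol{b},c\in L^\infty(\Omega)$, $f,\boldsymbol{f}\in L^2(\Omega)$, and for a.e. $x$: $\boldsymbol{A}(x)\in\mathbb{R}^{d\times d}$ is symmetric positive definite, $\boldsymbol{b}(x),\boldsymbol{f}(x)\in\mathbb{R}^d$, $c(x),f(x)\in\mathbb{R}$. Set $a(u,v):=\langle\boldsymbol{A}\nabla u,\nabla v\rangle_{L^2(\Omega)}$ and $b(u,v):=a(u,v)+\langle\boldsymbol{b}\cdot\nabla u+cu,v\rangle_{L^2(\Omega)}$; both are assumed continuous and elliptic on $H^1_0(\Omega)$. The energy norm is $|||u|||:=a(u,u)^{1/2}$. With $F(v):=\langle f,v\rangle_{L^2(\Omega)}+\langle\boldsymbol{f},\nabla v\rangle_{L^2(\Omega)}$, $u^\star\in H^1_0(\Omega)$ is the unique solution of $b(u^\star,v)=F(v)$ for all $v\in H^1_0(\Omega)$. **Meshes and spaces.** $\mathcal{T}_0$ is an initial conforming simplicial triangulation of $\Omega$. Refinement is by newest-vertex bisection (NVB): for $\mathcal{M}_H\subseteq\mathcal{T}_H$, $\mathtt{refine}(\mathcal{T}_H,\mathcal{M}_H)$ is the coarsest conforming NVB refinement of $\mathcal{T}_H$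 in which at least all elements of $\mathcal{M}_H$ have been refined. $\mathbb{T}(\mathcal{T}_H)$ is the set of meshes obtained from $\mathcal{T}_H$ by finitely many steps of NVB, and $\mathbb{T}:=\mathbb{T}(\mathcal{T}_0)$. For fixed $p\in\mathbb{N}$ and $\mathcal{T}_H\in\mathbb{T}$, $\mathcal{X}_H:=\{v_H\in H^1_0(\Omega): v_H|_T$ is a polynomial of total degree $\le p$ for all $T\in\mathcal{T}_H\}$; the Galerkin solution $u_H^\star\in\mathcal{X}_H$ solves $b(u_H^\star,v_H)=F(v_H)$ for all $v_H\in\mathcal{X}_H$. Quantities for the mesh $\mathcal{T}_\ell$ carry the index $\ell$. **Estimator.** $\boldsymbol{A}$ and $\boldsymbol{f}$ are regular enough for the following to be well-defined (e.g. $\boldsymbol{A}|_T,\boldsymbol{f}|_T\in W^{1,\infty}(T)$ for all $T\in\mathcal{T}_0$). For $T\in\mathcal{T}_H$, $v_H\in\mathcal{X}_H$, $$\eta_H(T,v_H)^2:=|T|^{2/d}\|-\operatorname{div}(\boldsymbol{A}\nabla v_H-\boldsymbol{f})+\boldsymbol{b}\cdot\nabla v_H+c\,v_H-f\|_{L^2(T)}^2+|T|^{1/d}\|[\![(\boldsymbol{A}\nabla v_H-\boldsymbol{f})\cdot n]\!]\|_{L^2(\partial T\cap\Omega)}^2,$$ where $[\![\cdot]\!]$ is the jump over $(d-1)$-dimensional faces; $\eta_H(\mathcal{U}_H,v_H):=(\sum_{T\in\mathcal{U}_H}\eta_H(T,v_H)^2)^{1/2}$ for $\mathcal{U}_H\subseteq\mathcal{T}_H$,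 and $\eta_H(v_H):=\eta_H(\mathcal{T}_H,v_H)$. **Known properties (recalled from the literature).** There are constants $C_{\mathrm{stab}},C_{\mathrm{rel}},C_{\mathrm{mon}}>0$, $q_{\mathrm{red}}=2^{-1/(2d)}$ such that for all $\mathcal{T}_H\in\mathbb{T}$, $\mathcal{T}_h\in\mathbb{T}(\mathcal{T}_H)$, $v_H\in\mathcal{X}_H$, $v_h\in\mathcal{X}_h$: (stability) $|\eta_h(\mathcal{T}_h\cap\mathcal{T}_H,v_h)-\eta_H(\mathcal{T}_h\cap\mathcal{T}_H,v_H)|\le C_{\mathrm{stab}}|||v_h-v_H|||$; (reduction) $\eta_h(\mathcal{T}_h\setminus\mathcal{T}_H,v_H)\le q_{\mathrm{red}}\,\eta_H(\mathcal{T}_H\setminus\mathcal{T}_h,v_H)$; (reliability) $|||u^\star-u_H^\star|||\le C_{\mathrm{rel}}\eta_H(u_H^\star)$; (quasi-monotonicity) $\eta_h(u_h^\star)\le C_{\mathrm{mon}}\eta_H(u_H^\star)$. Moreover (quasi-orthogonality) there are $C_{\mathrm{orth}}>0$, $0<\delta\le1$ such that for every nested sequence $\mathcal{X}_\ell\subseteq\mathcal{X}_{\ell+1}\subset H^1_0(\Omega)$ of finite-dimensional subspaces with Galerkin solutions $u_\ell^\star$: $\sum_{\ell'=\ell}^{\ell+N}|||u_{\ell'+1}^\star-u_{\ell'}^\star|||^2\le C_{\mathrm{orth}}(N+1)^{1-\delta}|||u^\star-u_\ell^\star|||^2$ for all $\ell,N\in\mathbb{N}_0$. **Contractive solver.**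 For each $\mathcal{T}_H\in\mathbb{T}$ there is an iteration map $\Psi_H:\mathcal{X}_H\to\mathcal{X}_H$, and there is $0<q_{\mathrm{alg}}<1$ independent of $\mathcal{T}_H$, with $|||u_H^\star-\Psi_H(v_H)|||\le q_{\mathrm{alg}}|||u_H^\star-v_H|||$ for all $\mathcal{T}_H\in\mathbb{T}$, $v_H\in\mathcal{X}_H$. **Algorithm (AFEM with contractive solver).** Input: $\mathcal{T}_0$, $0<\theta\le1$, $C_{\mathrm{mark}}\ge1$, $\lambda>0$, $u_0^0\in\mathcal{X}_0$. For $\ell=0,1,2,\dots$: (i) for $k=1,2,3,\dots$ compute $u_\ell^k:=\Psi_\ell(u_\ell^{k-1})$ and $\eta_\ell(T,u_\ell^k)$ for all $T\in\mathcal{T}_\ell$, until $|||u_\ell^k-u_\ell^{k-1}|||\le\lambda\,\eta_\ell(u_\ell^k)$; (ii) upon termination set $\underline{k}[\ell]:=k\in\mathbb{N}$ and write $u_\ell^{\underline{k}}:=u_\ell^{\underline{k}[\ell]}$; (iii) choose $\mathcal{M}_\ell\in\mathbb{M}_\ell:=\{\mathcal{U}_\ell\subseteq\mathcal{T}_\ell:\theta\,\eta_\ell(u_\ell^{\underline{k}})^2\le\eta_\ell(\mathcal{U}_\ell,u_\ell^{\underline{k}})^2\}$ with $\#\mathcal{M}_\ell\le C_{\mathrm{mark}}\min_{\mathcal{U}_\ell^\star\in\mathbb{M}_\ell}\#\mathcal{U}_\ell^\star$; (iv) set $\mathcal{T}_{\ell+1}:=\mathtt{refine}(\mathcal{T}_\ell,\mathcal{M}_\ell)$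 and $u_{\ell+1}^0:=u_\ell^{\underline{k}}$. If the loop in (i) does not terminate on some mesh, the algorithm stays on that mesh forever. **Index set.** $\mathcal{Q}:=\{(\ell,k)\in\mathbb{N}_0^2: u_\ell^k\in\mathcal{X}_\ell$ is defined in the algorithm$\}$, ordered lexicographically by $(\ell',k')\le(\ell,k)$ iff $u_{\ell'}^{k'}$ is defined not later than $u_\ell^k$; total step counter $|\ell,k|:=\#\{(\ell',k')\in\mathcal{Q}:(\ell',k')\le(\ell,k)\}$. *)

theory Defs
  imports "HOL-Analysis.Analysis"
begin

section \<open>Lebesgue and Sobolev spaces\<close>

text \<open>Elements of Lebesgue and Sobolev spaces are represented by functions; two representatives of
  the same element agree almost everywhere, and all notions below respect this.\<close>

definition Linf_on :: "(real^'d) set \<Rightarrow> (real^'d \<Rightarrow> 'b::euclidean_space) \<Rightarrow> bool" where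
  "Linf_on S g \<longleftrightarrow> g \<in> borel_measurable (lebesgue_on S) \<and>
     (\<exists>C. AE x in lebesgue_on S. norm (g x) \<le> C)"

definition L2_on :: "(real^'d) set \<Rightarrow> (real^'d \<Rightarrow> 'b::euclidean_space) \<Rightarrow> bool" where
  "L2_on S g \<longleftrightarrow> g \<in> borel_measurable (lebesgue_on S) \<and>
     integrable (lebesgue_on S) (\<lambda>x. (norm (g x))\<^sup>2)"

definition cgrad :: "(real^'d \<Rightarrow> real) \<Rightarrow> real^'d \<Rightarrow> real^'d" where
  "cgrad \<phi> x = (\<chi> i. frechet_derivative \<phi> (at x) (axis i 1))"

primrec Ck :: "nat \<Rightarrow> (real^'d \<Rightarrow> real) \<Rightarrow> bool" where
  "Ck 0 \<phi> \<longleftrightarrow> continuous_on UNIV \<phi>"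
| "Ck (Suc n) \<phi> \<longleftrightarrow> (\<forall>x. \<phi> differentiable (at x)) \<and> (\<forall>i. Ck n (\<lambda>x. cgrad \<phi> x $ i))"

text \<open>The space of smooth functions with compact support in the open set \<open>S\<close>.\<close>

definition test_fun :: "(real^'d) set \<Rightarrow> (real^'d \<Rightarrow> real) \<Rightarrow> bool" where
  "test_fun S \<phi> \<longleftrightarrow> (\<forall>n. Ck n \<phi>) \<and>
     compact (closure {x. \<phi> x \<noteq> 0}) \<and> closure {x. \<phi> x \<noteq> 0} \<subseteq> S"

definition weak_grad :: "(real^'d) set \<Rightarrow> (real^'d \<Rightarrow> real) \<Rightarrow> (real^'d \<Rightarrow> real^'d) \<Rightarrow> bool" where
  "weak_grad S u g \<longleftrightarrow> L2_on S u \<and> L2_on S g \<and>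
     (\<forall>\<phi>. test_fun S \<phi> \<longrightarrow>
       (LINT x|lebesgue_on S. u x *\<^sub>R cgrad \<phi> x) = - (LINT x|lebesgue_on S. \<phi> x *\<^sub>R g x))"

definition weak_div :: "(real^'d) set \<Rightarrow> (real^'d \<Rightarrow> real^'d) \<Rightarrow> (real^'d \<Rightarrow> real) \<Rightarrow> bool" where
  "weak_div S \<sigma> w \<longleftrightarrow> L2_on S \<sigma> \<and> L2_on S w \<and>
     (\<forall>\<phi>. test_fun S \<phi> \<longrightarrow>
       (LINT x|lebesgue_on S. \<sigma> x \<bullet> cgrad \<phi> x) = - (LINT x|lebesgue_on S. w x * \<phi> x))"

text \<open>Weak derivatives are unique up to null sets, so the choices below are harmless.\<close>

definition wgrad :: "(real^'d) set \<Rightarrow> (real^'d \<Rightarrow> real) \<Rightarrow> real^'d \<Rightarrow> real^'d" where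
  "wgrad S u = (SOME g. weak_grad S u g)"

definition wdiv :: "(real^'d) set \<Rightarrow> (real^'d \<Rightarrow> real^'d) \<Rightarrow> real^'d \<Rightarrow> real" where
  "wdiv S \<sigma> = (SOME w. weak_div S \<sigma> w)"

definition H1_norm :: "(real^'d) set \<Rightarrow> (real^'d \<Rightarrow> real) \<Rightarrow> real" where
  "H1_norm S u = sqrt ((LINT x|lebesgue_on S. (u x)\<^sup>2) + (LINT x|lebesgue_on S. (norm (wgrad S u x))\<^sup>2))"

text \<open>The closure of the test functions in \<open>H\<^sup>1(S)\<close>.\<close>

definition H10 :: "(real^'d) set \<Rightarrow> (real^'d \<Rightarrow> real) set" where
  "H10 S = {u. \<exists>g \<phi>. weak_grad S u g \<and> (\<forall>n. test_fun S (\<phi> n)) \<and>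
     (\<lambda>n::nat. (LINT x|lebesgue_on S. (u x - \<phi> n x)\<^sup>2)
             + (LINT x|lebesgue_on S. (norm (g x - cgrad (\<phi> n) x))\<^sup>2)) \<longlonglongrightarrow> 0}"


section \<open>The model problem\<close>

text \<open>Near each boundary point the set is the strict epigraph of a Lipschitz function of the
  coordinates orthogonal to some unit direction \<open>e\<close>.\<close>

definition lipschitz_boundary :: "(real^'d) set \<Rightarrow> bool" where
  "lipschitz_boundary S \<longleftrightarrow>
     (\<forall>x\<in>frontier S. \<exists>r>0. \<exists>e. norm e = 1 \<and> (\<exists>(\<gamma>::real^'d \<Rightarrow> real) L. L-lipschitz_on UNIV \<gamma> \<and>
        S \<inter> ball x r = {y \<in> ball x r. y \<bullet> e > \<gamma> (y - (y \<bullet> e) *\<^sub>R e)}))"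

definition polyhedral_lipschitz_domain :: "(real^'d) set \<Rightarrow> bool" where
  "polyhedral_lipschitz_domain S \<longleftrightarrow>
     open S \<and> connected S \<and> S \<noteq> {} \<and> bounded S \<and> lipschitz_boundary S \<and>
     (\<exists>F. finite F \<and> (\<forall>K\<in>F. polytope K) \<and> closure S = \<Union>F)"

text \<open>Data of \<open>- div (A \<nabla>u) + b \<cdot> \<nabla>u + c u = f - div g\<close> in the domain, with homogeneous
  Dirichlet data; \<open>vload\<close> is the vector field \<open>g\<close>.\<close>

record ('d::finite) problem =
  pdom :: "(real^'d) set"
  diffusion :: "real^'d \<Rightarrow> real^'d^'d"
  convection :: "real^'d \<Rightarrow> real^'d"
  reaction :: "real^'d \<Rightarrow> real"
  load :: "real^'d \<Rightarrow> real"
  vload :: "real^'d \<Rightarrow> real^'d"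

abbreviation pgrad :: "('d::finite) problem \<Rightarrow> (real^'d \<Rightarrow> real) \<Rightarrow> real^'d \<Rightarrow> real^'d" where
  "pgrad P \<equiv> wgrad (pdom P)"

abbreviation pH10 :: "('d::finite) problem \<Rightarrow> (real^'d \<Rightarrow> real) set" where
  "pH10 P \<equiv> H10 (pdom P)"

definition aform :: "('d::finite) problem \<Rightarrow> (real^'d \<Rightarrow> real) \<Rightarrow> (real^'d \<Rightarrow> real) \<Rightarrow> real" where
  "aform P u v = (LINT x|lebesgue_on (pdom P). (diffusion P x *v pgrad P u x) \<bullet> pgrad P v x)"

definition bform :: "('d::finite) problem \<Rightarrow> (real^'d \<Rightarrow> real) \<Rightarrow> (real^'d \<Rightarrow> real) \<Rightarrow> real" where
  "bform P u v = aform P u v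
     + (LINT x|lebesgue_on (pdom P). (convection P x \<bullet> pgrad P u x + reaction P x * u x) * v x)"

definition Fform :: "('d::finite) problem \<Rightarrow> (real^'d \<Rightarrow> real) \<Rightarrow> real" where
  "Fform P v = (LINT x|lebesgue_on (pdom P). load P x * v x)
     + (LINT x|lebesgue_on (pdom P). vload P x \<bullet> pgrad P v x)"

definition enorm :: "('d::finite) problem \<Rightarrow> (real^'d \<Rightarrow> real) \<Rightarrow> real" where
  "enorm P u = sqrt (aform P u u)"

definition continuous_form ::
  "('d::finite) problem \<Rightarrow> ((real^'d \<Rightarrow> real) \<Rightarrow> (real^'d \<Rightarrow> real) \<Rightarrow> real) \<Rightarrow> bool" where
  "continuous_form P B \<longleftrightarrow> (\<exists>C. \<forall>u\<in>pH10 P. \<forall>v\<in>pH10 P.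
     \<bar>B u v\<bar> \<le> C * H1_norm (pdom P) u * H1_norm (pdom P) v)"

definition elliptic_form ::
  "('d::finite) problem \<Rightarrow> ((real^'d \<Rightarrow> real) \<Rightarrow> (real^'d \<Rightarrow> real) \<Rightarrow> real) \<Rightarrow> bool" where
  "elliptic_form P B \<longleftrightarrow> (\<exists>\<alpha>>0. \<forall>u\<in>pH10 P. B u u \<ge> \<alpha> * (H1_norm (pdom P) u)\<^sup>2)"

definition model_problem :: "('d::finite) problem \<Rightarrow> bool" where
  "model_problem P \<longleftrightarrow>
     polyhedral_lipschitz_domain (pdom P) \<and>
     Linf_on (pdom P) (diffusion P) \<and> Linf_on (pdom P) (convection P) \<and> Linf_on (pdom P) (reaction P) \<and>
     L2_on (pdom P) (load P) \<and> L2_on (pdom P) (vload P) \<and>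
     (AE x in lebesgue_on (pdom P). transpose (diffusion P x) = diffusion P x \<and>
        (\<forall>\<xi>. \<xi> \<noteq> 0 \<longrightarrow> (diffusion P x *v \<xi>) \<bullet> \<xi> > 0)) \<and>
     continuous_form P (aform P) \<and> elliptic_form P (aform P) \<and>
     continuous_form P (bform P) \<and> elliptic_form P (bform P)"

text \<open>\<open>u \<in> V\<close> solves the variational problem on \<open>V\<close>; for \<open>V = H\<^sup>1\<^sub>0\<close> this is the weak solution,
  for a discrete space \<open>V\<close> it is the Galerkin solution.\<close>

definition solves_on ::
  "('d::finite) problem \<Rightarrow> (real^'d \<Rightarrow> real) set \<Rightarrow> (real^'d \<Rightarrow> real) \<Rightarrow> bool" where
  "solves_on P V u \<longleftrightarrow> u \<in> V \<and> (\<forall>v\<in>V. bform P u v = Fform P v)"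

definition findim_subspace :: "('d::finite) problem \<Rightarrow> (real^'d \<Rightarrow> real) set \<Rightarrow> bool" where
  "findim_subspace P V \<longleftrightarrow> V \<subseteq> pH10 P \<and>
     (\<lambda>x. 0) \<in> V \<and> (\<forall>u\<in>V. \<forall>v\<in>V. (\<lambda>x. u x + v x) \<in> V) \<and> (\<forall>s. \<forall>u\<in>V. (\<lambda>x. s * u x) \<in> V) \<and>
     (\<exists>B\<subseteq>V. finite B \<and>
        (\<forall>v\<in>V. \<exists>s. AE x in lebesgue_on (pdom P). v x = (\<Sum>b\<in>B. s b * b x)))"


section \<open>Newest-vertex bisection\<close>

text \<open>A tagged simplex is a list \<open>[z\<^sub>0, \<dots>, z\<^sub>d]\<close> of its vertices together with a type
  \<open>\<gamma> \<in> {0, \<dots>, d - 1}\<close>; its refinement edge joins \<open>z\<^sub>0\<close> and \<open>z\<^sub>d\<close>.\<close>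

type_synonym 'd tsimplex = "(real^'d) list \<times> nat"

definition elem :: "('d::finite) tsimplex \<Rightarrow> (real^'d) set" where
  "elem T = convex hull (set (fst T))"

text \<open>The rule of Maubach, Traxler and Stevenson: with \<open>m\<close> the midpoint of the refinement edge, the
  children are \<open>(z\<^sub>0, m, z\<^sub>1, \<dots>, z\<^sub>\<gamma>, z\<^bsub>\<gamma>+1\<^esub>, \<dots>, z\<^bsub>d-1\<^esub>)\<close> and
  \<open>(z\<^sub>d, m, z\<^sub>1, \<dots>, z\<^sub>\<gamma>, z\<^bsub>d-1\<^esub>, \<dots>, z\<^bsub>\<gamma>+1\<^esub>)\<close>, both of type \<open>(\<gamma> + 1) mod d\<close>.
  For \<open>d = 2\<close> this is the usual newest-vertex bisection, for \<open>d = 1\<close> halving of intervals.\<close>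

definition bisect :: "('d::finite) tsimplex \<Rightarrow> 'd tsimplex set" where
  "bisect T = (let zs = fst T; \<gamma> = snd T; m = midpoint (hd zs) (last zs);
       ys = butlast (tl zs); \<gamma>' = (\<gamma> + 1) mod CARD('d)
     in {(hd zs # m # ys, \<gamma>'), (last zs # m # take \<gamma> ys @ rev (drop \<gamma> ys), \<gamma>')})"

definition conforming_mesh :: "(real^'d) set \<Rightarrow> ('d::finite) tsimplex set \<Rightarrow> bool" where
  "conforming_mesh S \<T> \<longleftrightarrow>
     (\<forall>T\<in>\<T>. length (fst T) = CARD('d) + 1 \<and> snd T < CARD('d) \<and> int CARD('d) simplex elem T) \<and>
     inj_on elem \<T> \<and> triangulation (elem ` \<T>) \<and> \<Union>(elem ` \<T>) = closure S"

definition bisect_step :: "('d::finite) tsimplex set \<Rightarrow> 'd tsimplex set \<Rightarrow> bool" where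
  "bisect_step \<T> \<T>' \<longleftrightarrow> (\<exists>T\<in>\<T>. \<T>' = (\<T> - {T}) \<union> bisect T)"

text \<open>Single bisections may create hanging nodes; only the final mesh has to be conforming.\<close>

definition refinements :: "(real^'d) set \<Rightarrow> ('d::finite) tsimplex set \<Rightarrow> 'd tsimplex set set" where
  "refinements S \<T> = {\<T>'. bisect_step\<^sup>*\<^sup>* \<T> \<T>' \<and> conforming_mesh S \<T>'}"

text \<open>\<open>\<T>'\<close> is the coarsest conforming refinement of \<open>\<T>\<close> in which all elements of \<open>\<M>\<close> are refined.\<close>

definition is_refine ::
  "(real^'d) set \<Rightarrow> ('d::finite) tsimplex set \<Rightarrow> 'd tsimplex set \<Rightarrow> 'd tsimplex set \<Rightarrow> bool" where
  "is_refine S \<T> \<M> \<T>' \<longleftrightarrow> \<T>' \<in> refinements S \<T> \<and> \<M> \<inter> \<T>' = {} \<and>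
     (\<forall>\<T>''\<in>refinements S \<T>. \<M> \<inter> \<T>'' = {} \<longrightarrow> bisect_step\<^sup>*\<^sup>* \<T>' \<T>'')"


section \<open>Finite element spaces and error estimator\<close>

text \<open>Polynomials of total degree at most \<open>p\<close>, in multi-index notation.\<close>

definition poly_deg_le :: "nat \<Rightarrow> (real^'d \<Rightarrow> real) set" where
  "poly_deg_le p = {q. \<exists>s :: ('d \<Rightarrow> nat) \<Rightarrow> real.
     \<forall>x. q x = (\<Sum>\<alpha> | (\<Sum>i\<in>UNIV. \<alpha> i) \<le> p. s \<alpha> * (\<Prod>i\<in>UNIV. (x $ i) ^ \<alpha> i))}"

definition fe_space ::
  "('d::finite) problem \<Rightarrow> nat \<Rightarrow> 'd tsimplex set \<Rightarrow> (real^'d \<Rightarrow> real) set" where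
  "fe_space P p \<T> = {v \<in> pH10 P. \<forall>T\<in>\<T>. \<exists>q\<in>poly_deg_le p. AE x in lebesgue_on (elem T). v x = q x}"

definition flux :: "('d::finite) problem \<Rightarrow> (real^'d \<Rightarrow> real) \<Rightarrow> real^'d \<Rightarrow> real^'d" where
  "flux P v x = diffusion P x *v pgrad P v x - vload P x"

text \<open>The trace of \<open>\<sigma>|\<^sub>K\<close> at a boundary point \<open>x\<close> of \<open>K\<close> is the limit of its averages over
  \<open>ball x r \<inter> K\<close>. It does not depend on the representative; if \<open>\<sigma>|\<^sub>K\<close> is a.e. equal to a function
  that is continuous on \<open>K\<close>, it is the value of that function at \<open>x\<close>.\<close>

definition has_trace :: "(real^'d) set \<Rightarrow> (real^'d \<Rightarrow> real^'d) \<Rightarrow> real^'d \<Rightarrow> real^'d \<Rightarrow> bool" where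
  "has_trace K \<sigma> x l \<longleftrightarrow>
     ((\<lambda>r. (1 / measure lebesgue (ball x r \<inter> K)) *\<^sub>R (LINT y|lebesgue_on (ball x r \<inter> K). \<sigma> y))
        \<longlongrightarrow> l) (at_right 0)"

definition trace_of :: "(real^'d) set \<Rightarrow> (real^'d \<Rightarrow> real^'d) \<Rightarrow> real^'d \<Rightarrow> real^'d" where
  "trace_of K \<sigma> x = (THE l. has_trace K \<sigma> x l)"

text \<open>In a conforming mesh, \<open>\<partial>T \<inter> \<Omega>\<close> is, up to a \<open>(d-1)\<close>-dimensional null set, the union of the
  sets \<open>T \<inter> T' \<inter> \<Omega>\<close> over the neighbours \<open>T'\<close> of \<open>T\<close>, that is, the elements sharing a
  \<open>(d-1)\<close>-dimensional face with \<open>T\<close>.\<close>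

definition neighbours :: "('d::finite) tsimplex set \<Rightarrow> 'd tsimplex \<Rightarrow> 'd tsimplex set" where
  "neighbours \<T> T = {T'\<in>\<T>. aff_dim (elem T \<inter> elem T') = int CARD('d) - 1}"

definition face_normal :: "('d::finite) tsimplex \<Rightarrow> 'd tsimplex \<Rightarrow> real^'d" where
  "face_normal T T' =
     (SOME n. norm n = 1 \<and> (\<forall>x\<in>elem T \<inter> elem T'. \<forall>y\<in>elem T. y \<bullet> n \<le> x \<bullet> n))"

text \<open>The \<open>(d-1)\<close>-dimensional measure of a subset of a hyperplane with unit normal \<open>n\<close> is the
  Lebesgue measure of the cylinder of height 1 over it. Functions \<open>g\<close> on a face are therefore
  integrated over the cylinder after composition with the orthogonal projection onto the plane
  of the face. For \<open>d = 1\<close> faces are points and this is evaluation of \<open>g\<close>.\<close>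

definition face_cyl :: "('d::finite) problem \<Rightarrow> 'd tsimplex \<Rightarrow> 'd tsimplex \<Rightarrow> (real^'d) set" where
  "face_cyl P T T' =
     {x + t *\<^sub>R face_normal T T' | x t. x \<in> elem T \<inter> elem T' \<inter> pdom P \<and> 0 \<le> t \<and> t \<le> 1}"

definition face_proj :: "('d::finite) tsimplex \<Rightarrow> 'd tsimplex \<Rightarrow> real^'d \<Rightarrow> real^'d" where
  "face_proj T T' = closest_point (affine hull (elem T \<inter> elem T'))"

definition flux_jump ::
  "('d::finite) problem \<Rightarrow> (real^'d \<Rightarrow> real) \<Rightarrow> 'd tsimplex \<Rightarrow> 'd tsimplex \<Rightarrow> real^'d \<Rightarrow> real" where
  "flux_jump P v T T' x =
     (trace_of (elem T) (flux P v) x - trace_of (elem T') (flux P v) x) \<bullet> face_normal T T'"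

definition residual ::
  "('d::finite) problem \<Rightarrow> (real^'d \<Rightarrow> real) \<Rightarrow> 'd tsimplex \<Rightarrow> real^'d \<Rightarrow> real" where
  "residual P v T x = - wdiv (interior (elem T)) (flux P v) x
     + convection P x \<bullet> pgrad P v x + reaction P x * v x - load P x"

definition eta_loc ::
  "('d::finite) problem \<Rightarrow> 'd tsimplex set \<Rightarrow> 'd tsimplex \<Rightarrow> (real^'d \<Rightarrow> real) \<Rightarrow> real" where
  "eta_loc P \<T> T v = sqrt (
      measure lebesgue (elem T) powr (2 / CARD('d)) *
        (LINT x|lebesgue_on (interior (elem T)). (residual P v T x)\<^sup>2)
    + measure lebesgue (elem T) powr (1 / CARD('d)) *
        (\<Sum>T'\<in>neighbours \<T> T.
           LINT y|lebesgue_on (face_cyl P T T'). (flux_jump P v T T' (face_proj T T' y))\<^sup>2))"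

definition eta ::
  "('d::finite) problem \<Rightarrow> 'd tsimplex set \<Rightarrow> 'd tsimplex set \<Rightarrow> (real^'d \<Rightarrow> real) \<Rightarrow> real" where
  "eta P \<T> U v = sqrt (\<Sum>T\<in>U. (eta_loc P \<T> T v)\<^sup>2)"

text \<open>The regularity requirement on \<open>A\<close> and the vector load: all terms of the estimator make sense.
  Piecewise \<open>W\<^sup>1\<^sup>,\<^sup>\<infinity>\<close> data on the initial mesh are enough.\<close>

definition estimator_well_defined :: "('d::finite) problem \<Rightarrow> nat \<Rightarrow> 'd tsimplex set \<Rightarrow> bool" where
  "estimator_well_defined P p \<T>0 \<longleftrightarrow>
     (\<forall>\<T>\<in>refinements (pdom P) \<T>0. \<forall>v\<in>fe_space P p \<T>. \<forall>T\<in>\<T>.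
        (\<exists>w. weak_div (interior (elem T)) (flux P v) w) \<and>
        (\<forall>T'\<in>neighbours \<T> T.
           (AE y in lebesgue_on (face_cyl P T T').
              (\<exists>l. has_trace (elem T) (flux P v) (face_proj T T' y) l) \<and>
              (\<exists>l. has_trace (elem T') (flux P v) (face_proj T T' y) l)) \<and>
           L2_on (face_cyl P T T') (\<lambda>y. flux_jump P v T T' (face_proj T T' y))))"


section \<open>The adaptive algorithm\<close>

text \<open>A run is described by the meshes \<open>\<T> l\<close>, the marked sets \<open>\<M> l\<close> and the iterates \<open>u l k\<close>.
  If the solver loop does not terminate on some mesh, the values of these sequences on all
  later levels are irrelevant.\<close>

definition stops ::
  "('d::finite) problem \<Rightarrow> real \<Rightarrow> (nat \<Rightarrow> 'd tsimplex set) \<Rightarrow> (nat \<Rightarrow> nat \<Rightarrow> real^'d \<Rightarrow> real)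
    \<Rightarrow> nat \<Rightarrow> nat \<Rightarrow> bool" where
  "stops P lam \<T> u l k \<longleftrightarrow> k \<ge> 1 \<and>
     enorm P (\<lambda>x. u l k x - u l (k - 1) x) \<le> lam * eta P (\<T> l) (\<T> l) (u l k)"

definition kfin ::
  "('d::finite) problem \<Rightarrow> real \<Rightarrow> (nat \<Rightarrow> 'd tsimplex set) \<Rightarrow> (nat \<Rightarrow> nat \<Rightarrow> real^'d \<Rightarrow> real)
    \<Rightarrow> nat \<Rightarrow> nat" where
  "kfin P lam \<T> u l = (LEAST k. stops P lam \<T> u l k)"

definition index_set ::
  "('d::finite) problem \<Rightarrow> real \<Rightarrow> (nat \<Rightarrow> 'd tsimplex set) \<Rightarrow> (nat \<Rightarrow> nat \<Rightarrow> real^'d \<Rightarrow> real)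
    \<Rightarrow> (nat \<times> nat) set" where
  "index_set P lam \<T> u =
     {(l, k). (\<forall>l'<l. \<exists>k'. stops P lam \<T> u l' k') \<and> (\<forall>k'<k. \<not> stops P lam \<T> u l k')}"

definition step_count ::
  "('d::finite) problem \<Rightarrow> real \<Rightarrow> (nat \<Rightarrow> 'd tsimplex set) \<Rightarrow> (nat \<Rightarrow> nat \<Rightarrow> real^'d \<Rightarrow> real)
    \<Rightarrow> nat \<Rightarrow> nat \<Rightarrow> nat" where
  "step_count P lam \<T> u l k =
     card {(l', k') \<in> index_set P lam \<T> u. l' < l \<or> (l' = l \<and> k' \<le> k)}"

definition marking_sets ::
  "('d::finite) problem \<Rightarrow> real \<Rightarrow> 'd tsimplex set \<Rightarrow> (real^'d \<Rightarrow> real) \<Rightarrow> 'd tsimplex set set" where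
  "marking_sets P \<theta> \<T> v = {U. U \<subseteq> \<T> \<and> \<theta> * (eta P \<T> \<T> v)\<^sup>2 \<le> (eta P \<T> U v)\<^sup>2}"

definition afem_run ::
  "('d::finite) problem \<Rightarrow> ('d tsimplex set \<Rightarrow> (real^'d \<Rightarrow> real) \<Rightarrow> (real^'d \<Rightarrow> real))
    \<Rightarrow> real \<Rightarrow> real \<Rightarrow> real \<Rightarrow> 'd tsimplex set \<Rightarrow> (real^'d \<Rightarrow> real)
    \<Rightarrow> (nat \<Rightarrow> 'd tsimplex set) \<Rightarrow> (nat \<Rightarrow> 'd tsimplex set) \<Rightarrow> (nat \<Rightarrow> nat \<Rightarrow> real^'d \<Rightarrow> real) \<Rightarrow> bool" where
  "afem_run P \<Psi> \<theta> Cmark lam \<T>0 u00 \<T> \<M> u \<longleftrightarrow>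
     \<T> 0 = \<T>0 \<and> u 0 0 = u00 \<and>
     (\<forall>l k. (l, Suc k) \<in> index_set P lam \<T> u \<longrightarrow> u l (Suc k) = \<Psi> (\<T> l) (u l k)) \<and>
     (\<forall>l. (Suc l, 0) \<in> index_set P lam \<T> u \<longrightarrow>
        (let v = u l (kfin P lam \<T> u l) in
           \<M> l \<in> marking_sets P \<theta> (\<T> l) v \<and>
           real (card (\<M> l)) \<le> Cmark * real (Min (card ` marking_sets P \<theta> (\<T> l) v)) \<and>
           is_refine (pdom P) (\<T> l) (\<M> l) (\<T> (Suc l)) \<and>
           u (Suc l) 0 = v))"

text \<open>Here \<open>uG \<T>\<close> is the Galerkin solution on the mesh \<open>\<T>\<close>.\<close>

definition quasi_error ::
  "('d::finite) problem \<Rightarrow> ('d tsimplex set \<Rightarrow> real^'d \<Rightarrow> real)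
    \<Rightarrow> (nat \<Rightarrow> 'd tsimplex set) \<Rightarrow> (nat \<Rightarrow> nat \<Rightarrow> real^'d \<Rightarrow> real) \<Rightarrow> nat \<Rightarrow> nat \<Rightarrow> real" where
  "quasi_error P uG \<T> u l k =
     enorm P (\<lambda>x. uG (\<T> l) x - u l k x) + eta P (\<T> l) (\<T> l) (u l k)"

end

theory Submission
  imports Defs
begin

text \<open>
  Why the theorem holds. Write \<open>e\<close> for the energy error \<open>|||u\<^sub>l\<^sup>\<star> - u\<^sub>l\<^sup>k|||\<close> of the solver and \<open>\<eta>\<close> for
  the estimator of the iterate, so that the quasi-error is \<open>e + \<eta>\<close>.

  On a fixed mesh the solver contracts \<open>e\<close>. As long as the loop does not stop, the violated stopping
  test bounds \<open>\<eta>\<close> by a multiple of \<open>e\<close>, and the last step of the loop can increase \<open>\<eta>\<close> only by a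
  multiple of \<open>e\<close>, by stability. Hence the quasi-error decays geometrically on every mesh, for every
  stopping parameter (\<open>quasi_level\<close>).

  From one mesh to the next, Doerfler marking and reduction contract the estimator of a fixed function
  (\<open>marked_estimator_reduction\<close>). With a small weight \<open>\<gamma>\<close> on the estimator, the final value
  \<open>a = e + \<gamma> \<eta>\<close> on each mesh satisfies \<open>a\<^bsub>l+1\<^esub> \<le> q a\<^sub>l + b\<^sub>l\<close> with a perturbation
  \<open>b\<^sub>l = |||u\<^bsub>l+1\<^esub>\<^sup>\<star> - u\<^sub>l\<^sup>\<star>|||\<close>. The perturbations need not be small, but quasi-orthogonality
  makes the sum of \<open>N + 1\<close> of their squares grow sublinearly in \<open>N\<close>. Summing the perturbed contraction
  shows that partial sums of \<open>a\<^sup>2\<close> grow sublinearly as well, relative to their first term; since \<open>a\<close> is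
  quasi-monotone, its values over a long enough window must then be halved
  (\<open>r_linear_by_sublinear_sums\<close>, \<open>perturbed_contraction_r_linear\<close>).

  Geometric decay within the meshes and over the meshes makes the sum of all quasi-errors from any
  step on comparable to the quasi-error at that step (\<open>segment_sums\<close>). The same halving argument, now
  for the sequence of all quasi-errors in the order of computation, gives the theorem
  (\<open>r_linear_along_run\<close>).

  Two facts about function spaces enter. The triangle inequality for the energy norm needs that the
  weak gradient, which is a choice of some representative, is linear almost everywhere. This is
  uniqueness of weak gradients, hence the fundamental lemma of the calculus of variations, which in
  turn needs enough smooth functions with compact support. And to apply quasi-orthogonality, the
  finite element spaces have to be nested finite-dimensional spaces; if the run stays on one mesh
  forever, the sequence of spaces is continued constantly.
\<close>

section \<open>Smooth functions with compact support\<close>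

lemma cgrad_eqI:
  assumes "(\<phi> has_derivative (\<lambda>h. \<Sum>i\<in>UNIV. h $ i * D i)) (at x)"
  shows "cgrad \<phi> x $ i = D i"
proof -
  have "frechet_derivative \<phi> (at x) = (\<lambda>h. \<Sum>i\<in>UNIV. h $ i * D i)"
    using assms by (rule frechet_derivative_at[symmetric])
  thus ?thesis
    by (simp add: cgrad_def axis_def if_distrib[of "\<lambda>t. t * _"] cong: if_cong)
qed

lemma has_derivative_cgrad:
  assumes "\<phi> differentiable (at x)"
  shows "(\<phi> has_derivative (\<lambda>h. \<Sum>i\<in>UNIV. h $ i * cgrad \<phi> x $ i)) (at x)"
proof -
  let ?F = "frechet_derivative \<phi> (at x)"
  have d: "(\<phi> has_derivative ?F) (at x)"
    using assms by (simp add: frechet_derivative_works)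
  then interpret linear ?F by (rule has_derivative_linear)
  have "?F h = (\<Sum>i\<in>UNIV. h $ i * cgrad \<phi> x $ i)" for h
  proof -
    have "?F h = ?F (\<Sum>i\<in>UNIV. h $ i *\<^sub>R axis i 1)"
      by (simp add: basis_expansion scalar_mult_eq_scaleR[symmetric])
    also have "\<dots> = (\<Sum>i\<in>UNIV. h $ i * cgrad \<phi> x $ i)"
      by (simp add: sum scale cgrad_def)
    finally show ?thesis .
  qed
  hence "?F = (\<lambda>h. \<Sum>i\<in>UNIV. h $ i * cgrad \<phi> x $ i)" by (rule ext)
  with d show ?thesis by simp
qed

lemma cgrad_add:
  assumes "\<phi> differentiable (at x)" "\<psi> differentiable (at x)"
  shows "cgrad (\<lambda>x. \<phi> x + \<psi> x) x = cgrad \<phi> x + cgrad \<psi> x"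
proof -
  have "((\<lambda>x. \<phi> x + \<psi> x) has_derivative
         (\<lambda>h. \<Sum>i\<in>UNIV. h $ i * (cgrad \<phi> x $ i + cgrad \<psi> x $ i))) (at x)"
    using has_derivative_add[OF has_derivative_cgrad has_derivative_cgrad, OF assms]
    by (simp add: sum.distrib algebra_simps)
  from cgrad_eqI[OF this] show ?thesis by (simp add: vec_eq_iff)
qed

lemma cgrad_mult:
  assumes "\<phi> differentiable (at x)" "\<psi> differentiable (at x)"
  shows "cgrad (\<lambda>x. \<phi> x * \<psi> x) x $ i = \<phi> x * cgrad \<psi> x $ i + cgrad \<phi> x $ i * \<psi> x"
proof -
  have "((\<lambda>x. \<phi> x * \<psi> x) has_derivative
         (\<lambda>h. \<Sum>i\<in>UNIV. h $ i * (\<phi> x * cgrad \<psi> x $ i + cgrad \<phi> x $ i * \<psi> x))) (at x)"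
    using has_derivative_mult[OF has_derivative_cgrad has_derivative_cgrad, OF assms]
    by (simp add: sum.distrib algebra_simps sum_distrib_left)
  from cgrad_eqI[OF this] show ?thesis .
qed

lemma cgrad_const [simp]: "cgrad (\<lambda>x. r) x = 0"
proof -
  have "((\<lambda>x::real^'a. r) has_derivative (\<lambda>h. \<Sum>i\<in>UNIV. h $ i * 0)) (at x)" by simp
  from cgrad_eqI[OF this] show ?thesis by (simp add: vec_eq_iff)
qed

lemma Ck_Suc_imp: "Ck (Suc n) \<phi> \<Longrightarrow> Ck n \<phi>"
proof (induction n arbitrary: \<phi>)
  case 0
  thus ?case
    by (simp add: differentiable_imp_continuous_within continuous_on_eq_continuous_within)
next
  case (Suc n)
  thus ?case by (metis Ck.simps(2))
qed

lemma Ck_const: "Ck n (\<lambda>x. r)"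
  by (induction n arbitrary: r) (auto simp: continuous_on_const)

lemma Ck_add: "Ck n \<phi> \<Longrightarrow> Ck n \<psi> \<Longrightarrow> Ck n (\<lambda>x. \<phi> x + \<psi> x)"
  by (induction n arbitrary: \<phi> \<psi>) (auto intro: continuous_on_add simp: cgrad_add)

lemma Ck_mult: "Ck n \<phi> \<Longrightarrow> Ck n \<psi> \<Longrightarrow> Ck n (\<lambda>x. \<phi> x * \<psi> x)"
proof (induction n arbitrary: \<phi> \<psi>)
  case 0
  thus ?case by (auto intro: continuous_on_mult)
next
  case (Suc n)
  have "Ck n \<phi>" "Ck n \<psi>" using Suc.prems by (blast intro: Ck_Suc_imp)+
  with Suc show ?case by (auto simp: cgrad_mult intro!: Ck_add)
qed

lemma Ck_scale: "Ck n \<phi> \<Longrightarrow> Ck n (\<lambda>x. s * \<phi> x)"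
  by (intro Ck_mult Ck_const)

lemma Ck_prod: "finite I \<Longrightarrow> (\<And>i. i \<in> I \<Longrightarrow> Ck n (f i)) \<Longrightarrow> Ck n (\<lambda>x. \<Prod>i\<in>I. f i x)"
  by (induction I rule: finite_induct) (auto intro: Ck_const Ck_mult)

text \<open>For \<open>k = 0\<close> this is the standard smooth function that vanishes on the negative axis. Dividing by
  powers of \<open>t\<close> gives a family whose derivatives are linear combinations of members of the family, so
  that smoothness follows by induction over all \<open>k\<close> at once.\<close>

definition flat_exp :: "nat \<Rightarrow> real \<Rightarrow> real \<Rightarrow> real" where
  "flat_exp k c t = (if t > 0 then exp (- c / t) / t ^ k else 0)"

lemma flat_exp_tendsto_0:
  assumes "c > 0"
  shows "(flat_exp k c \<longlongrightarrow> 0) (at 0)"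
proof -
  have "((\<lambda>t. exp (- c / t) / t ^ k) \<longlongrightarrow> 0) (at_right 0)"
    unfolding filterlim_at_right_to_top
  proof -
    have "((\<lambda>y. (1 / c ^ k) * ((c * y) ^ k / exp (c * y))) \<longlongrightarrow> (1 / c ^ k) * 0) at_top"
      by (intro tendsto_intros filterlim_compose[OF tendsto_power_div_exp_0]
            filterlim_tendsto_pos_mult_at_top[OF tendsto_const assms] filterlim_ident)
    moreover have "\<forall>\<^sub>F y in at_top. (1 / c ^ k) * ((c * y) ^ k / exp (c * y))
        = exp (- c / inverse y) / inverse y ^ k"
      using assms
      by (simp add: exp_minus power_mult_distrib power_inverse divide_inverse)
    ultimately show "((\<lambda>y. exp (- c / inverse y) / inverse y ^ k) \<longlongrightarrow> 0) at_top"
      by (simp add: tendsto_cong)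
  qed
  moreover have "\<forall>\<^sub>F t in at_right 0. flat_exp k c t = exp (- c / t) / t ^ k"
    by (simp add: eventually_at_filter flat_exp_def)
  ultimately have r: "(flat_exp k c \<longlongrightarrow> 0) (at_right 0)"
    by (simp add: tendsto_cong)
  have "\<forall>\<^sub>F t in at_left 0. flat_exp k c t = 0"
    by (simp add: eventually_at_filter flat_exp_def)
  hence "(flat_exp k c \<longlongrightarrow> 0) (at_left 0)" by (rule tendsto_eventually)
  with r show ?thesis by (simp add: filterlim_split_at)
qed

text \<open>At \<open>0\<close> the difference quotient of the \<open>k\<close>-th function is the \<open>(k+1)\<close>-st function, which tends
  to \<open>0\<close>.\<close>

lemma flat_exp_deriv:
  assumes "c > 0"
  shows "(flat_exp k c has_real_derivative
      c * flat_exp (Suc (Suc k)) c t - real k * flat_exp (Suc k) c t) (at t)"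
proof -
  consider "t > 0" | "t < 0" | "t = 0" by linarith
  thus ?thesis
  proof cases
    case 1
    have "((\<lambda>t. exp (- c / t) / t ^ k) has_real_derivative
      (exp (- c / t) * (c / (t * t)) * t ^ k - exp (- c / t) * (real k * t ^ (k - 1))) / (t ^ k * t ^ k)) (at t)"
      by (rule derivative_eq_intros refl | use 1 in simp)+
    moreover have "(exp (- c / t) * (c / (t * t)) * t ^ k - exp (- c / t) * (real k * t ^ (k - 1))) / (t ^ k * t ^ k)
       = c * flat_exp (Suc (Suc k)) c t - real k * flat_exp (Suc k) c t"
      using 1 by (cases k) (simp_all add: flat_exp_def field_simps)
    ultimately have "((\<lambda>t. exp (- c / t) / t ^ k) has_real_derivative
      c * flat_exp (Suc (Suc k)) c t - real k * flat_exp (Suc k) c t) (at t)" by simp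
    moreover have "\<forall>\<^sub>F s in nhds t. flat_exp k c s = exp (- c / s) / s ^ k"
      using eventually_nhds_in_open[of "{0<..}" t] 1
      by (auto simp: flat_exp_def elim: eventually_mono)
    ultimately show ?thesis by (simp add: DERIV_cong_ev)
  next
    case 2
    moreover have "\<forall>\<^sub>F s in nhds t. flat_exp k c s = 0"
      using eventually_nhds_in_open[of "{..<0}" t] 2
      by (auto simp: flat_exp_def elim: eventually_mono)
    ultimately show ?thesis by (simp add: DERIV_cong_ev flat_exp_def)
  next
    case 3
    have "((\<lambda>h. (flat_exp k c (0 + h) - flat_exp k c 0) / h) \<longlongrightarrow> 0) (at 0)"
      by (rule Lim_transform_eventually[OF flat_exp_tendsto_0[OF assms, of "Suc k"]])
         (auto simp: eventually_at_filter flat_exp_def)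
    thus ?thesis using 3 by (simp add: DERIV_def flat_exp_def)
  qed
qed

lemma Ck_flat_exp:
  fixes i :: "'d::finite"
  assumes "c > 0"
  shows "Ck n (\<lambda>x::real^'d. flat_exp k c (s * x $ i + a))"
proof -
  let ?g = "\<lambda>k x. flat_exp k c (s * x $ i + a)"
  let ?D = "\<lambda>k x. s * (c * ?g (Suc (Suc k)) x + (- real k) * ?g (Suc k) x)"
  have d: "(?g k has_derivative (\<lambda>h. \<Sum>j\<in>UNIV. h $ j * (if j = i then ?D k x else 0))) (at x)"
    for k and x :: "real^'d"
  proof -
    have l: "((\<lambda>x::real^'d. s * x $ i + a) has_derivative (\<lambda>h. s * h $ i)) (at x)"
      by (auto intro!: derivative_eq_intros bounded_linear.has_derivative[OF bounded_linear_vec_nth])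
    show ?thesis
      using has_derivative_compose[OF l flat_exp_deriv[OF assms, of k "s * x $ i + a",
            unfolded has_field_derivative_def]]
      by (simp add: if_distrib[of "\<lambda>t. _ * t"] algebra_simps cong: if_cong)
  qed
  show ?thesis
  proof (induction n arbitrary: k)
    case 0
    have "continuous (at x) (?g k)" for x by (rule has_derivative_continuous[OF d])
    thus ?case by (simp add: continuous_on_eq_continuous_within)
  next
    case (Suc n)
    have "(\<lambda>x. cgrad (?g k) x $ j) = (if j = i then ?D k else (\<lambda>x. 0))" for j
      by (intro ext) (simp add: cgrad_eqI[OF d])
    moreover have "Ck n (?D k)" by (intro Ck_scale Ck_add Suc.IH)
    ultimately show ?case
      using d by (auto simp: Ck_const differentiable_def)
  qed
qed

text \<open>As \<open>c\<close> decreases to \<open>0\<close>, these functions increase to the indicator function of the open box.\<close>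

definition box_bump :: "real \<Rightarrow> real^'d \<Rightarrow> real^'d \<Rightarrow> real^'d \<Rightarrow> real" where
  "box_bump c a b x = (\<Prod>i\<in>UNIV. flat_exp 0 c (x $ i - a $ i) * flat_exp 0 c (b $ i - x $ i))"

lemma flat_exp_0_bounds: "c > 0 \<Longrightarrow> 0 \<le> flat_exp 0 c t" "c > 0 \<Longrightarrow> flat_exp 0 c t \<le> 1"
  by (auto simp: flat_exp_def)

lemma box_bump_bounds:
  assumes "c > 0" shows "0 \<le> box_bump c a b x" "box_bump c a b x \<le> 1"
  unfolding box_bump_def
  by (intro prod_nonneg prod_le_1 ballI conjI mult_nonneg_nonneg mult_le_one
      flat_exp_0_bounds[OF assms])+

lemma box_bump_eq_0: "x \<notin> box a b \<Longrightarrow> box_bump c a b x = 0"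
  unfolding box_bump_def mem_box_cart prod_zero_iff[OF finite] flat_exp_def
  by (auto simp: not_less) (metis not_less)

lemma box_bump_tendsto_1:
  assumes "x \<in> box a b"
  shows "(\<lambda>n. box_bump (1 / real (Suc n)) a b x) \<longlonglongrightarrow> 1"
proof -
  have 1: "(\<lambda>n. flat_exp 0 (1 / real (Suc n)) t) \<longlonglongrightarrow> 1" if "t > 0" for t
  proof -
    have "(\<lambda>n. exp (- (1 / real (Suc n)) / t)) \<longlonglongrightarrow> exp (- 0 / t)"
      by (intro tendsto_intros LIMSEQ_inverse_real_of_nat[unfolded inverse_eq_divide]) (use that in auto)
    thus ?thesis using that by (simp add: flat_exp_def)
  qed
  have "(\<lambda>n. box_bump (1 / real (Suc n)) a b x) \<longlonglongrightarrow> (\<Prod>i\<in>(UNIV::'a set). 1 * 1)"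
    unfolding box_bump_def
    by (intro tendsto_prod tendsto_mult 1) (use assms in \<open>auto simp: mem_box_cart\<close>)
  thus ?thesis by simp
qed

lemma test_fun_alt:
  "test_fun S \<phi> \<longleftrightarrow> (\<forall>n. Ck n \<phi>) \<and> bounded {x. \<phi> x \<noteq> 0} \<and> closure {x. \<phi> x \<noteq> 0} \<subseteq> S"
  by (simp add: test_fun_def compact_closure)

lemma test_fun_box_bump:
  assumes "c > 0" "cbox a b \<subseteq> S"
  shows "test_fun S (box_bump c a b)"
proof -
  have "Ck n (box_bump c a b)" for n
    unfolding box_bump_def
    using Ck_flat_exp[OF assms(1), of n 0 1 _ "- a $ _"] Ck_flat_exp[OF assms(1), of n 0 "-1" _ "b $ _"]
    by (intro Ck_prod Ck_mult) (auto simp: algebra_simps)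
  moreover have "closure {x. box_bump c a b x \<noteq> 0} \<subseteq> cbox a b"
    by (rule closure_minimal) (use box_bump_eq_0 box_subset_cbox in blast)+
  ultimately show ?thesis
    using assms(2) unfolding test_fun_alt
    by (meson bounded_cbox bounded_subset closure_subset order_trans)
qed

lemma test_fun_add:
  assumes "test_fun S \<phi>" "test_fun S \<psi>"
  shows "test_fun S (\<lambda>x. \<phi> x + \<psi> x)"
proof -
  have sub: "{x. \<phi> x + \<psi> x \<noteq> 0} \<subseteq> {x. \<phi> x \<noteq> 0} \<union> {x. \<psi> x \<noteq> 0}" by auto
  have "Ck n (\<lambda>x. \<phi> x + \<psi> x)" for n using assms by (intro Ck_add) (auto simp: test_fun_def)
  moreover have "bounded {x. \<phi> x + \<psi> x \<noteq> 0}"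
    using assms by (intro bounded_subset[OF _ sub]) (auto simp: test_fun_alt)
  moreover have "closure {x. \<phi> x + \<psi> x \<noteq> 0} \<subseteq> S"
    using closure_mono[OF sub] assms by (auto simp: test_fun_def)
  ultimately show ?thesis by (simp add: test_fun_alt)
qed

lemma test_fun_mult:
  assumes "\<And>n. Ck n \<phi>" "test_fun S \<psi>"
  shows "test_fun S (\<lambda>x. \<phi> x * \<psi> x)"
proof -
  have sub: "{x. \<phi> x * \<psi> x \<noteq> 0} \<subseteq> {x. \<psi> x \<noteq> 0}" by auto
  have "Ck n (\<lambda>x. \<phi> x * \<psi> x)" for n using assms by (intro Ck_mult) (auto simp: test_fun_def)
  moreover have "bounded {x. \<phi> x * \<psi> x \<noteq> 0}"
    using assms by (intro bounded_subset[OF _ sub]) (auto simp: test_fun_alt)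
  moreover have "closure {x. \<phi> x * \<psi> x \<noteq> 0} \<subseteq> S"
    using closure_mono[OF sub] assms by (auto simp: test_fun_def)
  ultimately show ?thesis by (simp add: test_fun_alt)
qed

lemma test_fun_zero: "test_fun S (\<lambda>x. 0)"
  by (simp add: test_fun_def Ck_const)

text \<open>An open set is a countable union of boxes whose closures it contains. With bump functions \<open>\<phi>\<^sub>i\<close> of
  the first \<open>n\<close> boxes, \<open>1 - (1 - \<phi>\<^sub>0) \<cdots> (1 - \<phi>\<^bsub>n-1\<^esub>)\<close> is a smooth substitute for the maximum of the \<open>\<phi>\<^sub>i\<close>;
  it keeps values in \<open>[0, 1]\<close> and support in the set.\<close>

lemma indicator_limit_of_test_functions:
  fixes S U :: "(real^'d) set"
  assumes "open U" "U \<subseteq> S"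
  shows "\<exists>w. (\<forall>n::nat. test_fun S (w n)) \<and> (\<forall>n x. 0 \<le> w n x \<and> w n x \<le> 1) \<and>
             (\<forall>x. (\<lambda>n. w n x) \<longlonglongrightarrow> indicator U x)"
proof (cases "U = {}")
  case True
  thus ?thesis by (intro exI[of _ "\<lambda>n x. 0"]) (simp add: test_fun_zero)
next
  case False
  define F where "F = {box a b | a b. cbox a b \<subseteq> U}"
  have FU: "\<Union>F = U"
  proof
    show "\<Union>F \<subseteq> U" using box_subset_cbox unfolding F_def by blast
    show "U \<subseteq> \<Union>F"
    proof
      fix x assume "x \<in> U"
      then obtain a b where "cbox a b \<subseteq> U" "x \<in> box a b"
        using open_contains_cbox[OF assms(1)] by metis
      thus "x \<in> \<Union>F" unfolding F_def by blast
    qed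
  qed
  obtain G where G: "G \<subseteq> F" "countable G" "\<Union>G = U"
  proof (rule Lindelof)
    show "open X" if "X \<in> F" for X using that by (auto simp: F_def)
  qed (use FU in auto)
  have ne: "G \<noteq> {}" using G False by auto
  have "\<exists>a b. from_nat_into G i = box a b \<and> cbox a b \<subseteq> U" for i :: nat
    using from_nat_into[OF ne, of i] G(1) unfolding F_def by blast
  then obtain a b where ab: "from_nat_into G i = box (a i) (b i)" "cbox (a i) (b i) \<subseteq> U" for i
    by metis
  define \<phi> where "\<phi> n i = box_bump (1 / real (Suc n)) (a i) (b i)" for n i
  define w where "w n x = 1 - (\<Prod>i<n. 1 - \<phi> n i x)" for n x
  have b: "0 \<le> \<phi> n i x" "\<phi> n i x \<le> 1" for n i x by (simp_all add: \<phi>_def box_bump_bounds)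
  have t: "test_fun S (\<phi> n i)" for n i
    unfolding \<phi>_def by (rule test_fun_box_bump) (use ab(2)[of i] assms(2) in auto)
  have tw: "test_fun S (\<lambda>x. 1 - (\<Prod>i<m. 1 - \<phi> n i x))" for n m
  proof (induction m)
    case 0 show ?case by (simp add: test_fun_zero)
  next
    case (Suc m)
    have "Ck k (\<lambda>x. \<Prod>i<m. 1 - \<phi> n i x)" for k
    proof (rule Ck_prod)
      fix i
      have "Ck k (\<lambda>x. 1 + (-1) * \<phi> n i x)"
        using t[of n i] by (intro Ck_add Ck_scale Ck_const) (simp add: test_fun_def)
      thus "Ck k (\<lambda>x. 1 - \<phi> n i x)" by simp
    qed simp
    from test_fun_add[OF Suc test_fun_mult[OF this t[of n m]]]
    show ?case by (simp add: algebra_simps)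
  qed
  have bw: "0 \<le> w n x \<and> w n x \<le> 1" for n x
    unfolding w_def by (auto intro!: prod_nonneg prod_le_1 simp: b)
  have lw: "(\<lambda>n. w n x) \<longlonglongrightarrow> indicator U x" for x
  proof (cases "x \<in> U")
    case True
    then obtain X where "X \<in> G" "x \<in> X" using G(3) by auto
    then obtain i where i: "x \<in> box (a i) (b i)"
      using from_nat_into_surj[OF G(2)] ab(1) by metis
    have l: "(\<lambda>n. \<phi> n i x) \<longlonglongrightarrow> 1" unfolding \<phi>_def by (rule box_bump_tendsto_1[OF i])
    have le: "\<phi> n i x \<le> w n x" if "n > i" for n
    proof -
      have "(\<Prod>j<n. 1 - \<phi> n j x) = (1 - \<phi> n i x) * (\<Prod>j\<in>{..<n} - {i}. 1 - \<phi> n j x)"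
        using that by (simp add: prod.remove)
      also have "\<dots> \<le> (1 - \<phi> n i x) * 1"
        by (intro mult_left_mono prod_le_1) (auto simp: b)
      finally show ?thesis by (simp add: w_def)
    qed
    have "(\<lambda>n. w n x) \<longlonglongrightarrow> 1"
    proof (rule tendsto_sandwich[OF _ _ l tendsto_const])
      show "\<forall>\<^sub>F n in sequentially. \<phi> n i x \<le> w n x"
        using eventually_gt_at_top[of i] by eventually_elim (rule le)
    qed (simp add: bw)
    thus ?thesis using True by simp
  next
    case False
    have "x \<notin> box (a i) (b i)" for i using ab(2)[of i] box_subset_cbox False by blast
    hence "w n x = 0" for n by (simp add: w_def \<phi>_def box_bump_eq_0)
    thus ?thesis using False by simp
  qed
  have "test_fun S (w n)" for n using tw unfolding w_def .
  with bw lw show ?thesis by blast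
qed

section \<open>Square integrable functions and the fundamental lemma\<close>

lemma Ck_continuous: "Ck n \<phi> \<Longrightarrow> continuous_on UNIV \<phi>"
proof (induction n)
  case (Suc n)
  thus ?case using Ck_Suc_imp by blast
qed simp

lemma test_fun_continuous: "test_fun S \<phi> \<Longrightarrow> continuous_on UNIV \<phi>"
  by (auto simp: test_fun_def intro: Ck_continuous)

lemma test_fun_differentiable: "test_fun S \<phi> \<Longrightarrow> \<phi> differentiable (at x)"
  unfolding test_fun_def by (metis Ck.simps(2))

lemma test_fun_cgrad_continuous:
  assumes "test_fun S \<phi>" shows "continuous_on UNIV (cgrad \<phi>)"
proof -
  have "Ck (Suc 0) \<phi>" using assms by (simp add: test_fun_def)
  hence "continuous_on UNIV (\<lambda>x. \<chi> i. cgrad \<phi> x $ i)"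
    by (intro continuous_on_vec_lambda) simp
  thus ?thesis by simp
qed

text \<open>By dominated convergence along the approximations of indicator functions, the integral of \<open>h\<close>
  over every open subset of \<open>S\<close> vanishes. The sets with vanishing integral form a Dynkin system, so
  they comprise all Borel sets and then all Lebesgue measurable sets, and \<open>h\<close> is zero almost
  everywhere.\<close>

lemma fundamental_lemma_of_calculus_of_variations:
  fixes S :: "(real^'d) set" and h :: "real^'d \<Rightarrow> real"
  assumes S: "open S" and h: "integrable (lebesgue_on S) h"
    and 0: "\<And>\<phi>. test_fun S \<phi> \<Longrightarrow> (LINT x|lebesgue_on S. \<phi> x * h x) = 0"
  shows "AE x in lebesgue_on S. h x = 0"
proof -
  \<comment> \<open>Extension by zero allows to use the open sets of the whole space as generator.\<close>
  define F where "F x = indicator S x *\<^sub>R h x" for x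
  have Sm: "S \<in> sets lebesgue" using S by simp
  have F: "integrable lebesgue F"
    using h Sm unfolding F_def by (simp add: integrable_restrict_space)
  have op: "(LINT x:U|lebesgue. F x) = 0" if U: "open U" for U
  proof -
    have "open (U \<inter> S)" "U \<inter> S \<subseteq> S" using U S by auto
    then obtain w where w: "\<And>n::nat. test_fun S (w n)" "\<And>n x. 0 \<le> w n x \<and> w n x \<le> 1"
      "\<And>x. (\<lambda>n. w n x) \<longlonglongrightarrow> indicator (U \<inter> S) x"
      using indicator_limit_of_test_functions by metis
    have hm: "h \<in> borel_measurable (lebesgue_on S)" using h by (rule borel_measurable_integrable)
    have wm: "w n \<in> borel_measurable (lebesgue_on S)" for n
      using test_fun_continuous[OF w(1)] continuous_on_subset
      by (intro continuous_imp_measurable_on_sets_lebesgue[OF _ Sm]) blast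
    have "(\<lambda>n. LINT x|lebesgue_on S. w n x * h x)
        \<longlonglongrightarrow> (LINT x|lebesgue_on S. indicator (U \<inter> S) x * h x)"
    proof (rule integral_dominated_convergence[where w = "\<lambda>x. \<bar>h x\<bar>"])
      show "(\<lambda>x. indicator (U \<inter> S) x * h x) \<in> borel_measurable (lebesgue_on S)"
        by (rule borel_measurable_LIMSEQ_real[where u = "\<lambda>n x. w n x * h x"])
           (auto intro!: tendsto_mult w(3) borel_measurable_times wm hm)
      show "integrable (lebesgue_on S) (\<lambda>x. \<bar>h x\<bar>)" using h by simp
      show "AE x in lebesgue_on S. (\<lambda>n. w n x * h x) \<longlonglongrightarrow> indicator (U \<inter> S) x * h x"
        by (auto intro!: tendsto_mult w(3))
      show "AE x in lebesgue_on S. norm (w n x * h x) \<le> \<bar>h x\<bar>" for n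
        using w(2)[of n] by (auto simp: abs_mult intro!: mult_left_le_one_le)
    qed (auto intro!: borel_measurable_times wm hm)
    hence "(LINT x|lebesgue_on S. indicator (U \<inter> S) x * h x) = 0"
      using 0[OF w(1)] LIMSEQ_unique[OF _ tendsto_const] by (simp add: LIMSEQ_const_iff)
    moreover have "(LINT x|lebesgue_on S. indicator (U \<inter> S) x * h x) = (LINT x:U|lebesgue. F x)"
      using Sm by (simp add: integral_restrict_space set_lebesgue_integral_def F_def)
         (auto intro!: Bochner_Integration.integral_cong simp: indicator_def)
    ultimately show ?thesis by simp
  qed
  have si: "set_integrable lebesgue A F" if "A \<in> sets lebesgue" for A
    using F that unfolding set_integrable_def by (rule integrable_mult_indicator[rotated])
  have bor: "(LINT x:A|lebesgue. F x) = 0" if A: "A \<in> sets borel" for A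
  proof -
    have ist: "Int_stable {U::(real^'d) set. open U}" by (auto simp: Int_stable_def)
    have sub: "{U::(real^'d) set. open U} \<subseteq> Pow UNIV" by simp
    have "A \<in> sigma_sets UNIV {U::(real^'d) set. open U}" using A by (simp add: sets_borel)
    with ist sub show ?thesis
    proof (induction rule: sigma_sets_induct_disjoint)
      case (basic A) thus ?case using op by simp
    next
      case empty show ?case by (simp add: set_lebesgue_integral_def)
    next
      case (compl A)
      have Am: "A \<in> sets lebesgue" using compl(1)
        by (metis sets_borel sets_completionI_sets sets_lborel)
      have "(LINT x:(UNIV - A) \<union> A|lebesgue. F x) = (LINT x:UNIV - A|lebesgue. F x) + (LINT x:A|lebesgue. F x)"
        using Am by (intro set_integral_Un si) auto
      moreover have "(UNIV - A) \<union> A = UNIV" by auto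
      ultimately show ?case using compl(2) op[of UNIV] by simp
    next
      case (union A)
      have Am: "A i \<in> sets lebesgue" for i using union(2)
        by (metis sets_borel sets_completionI_sets sets_lborel rangeI subsetD)
      have "(LINT x:(\<Union>i. A i)|lebesgue. F x) = (\<Sum>i. LINT x:A i|lebesgue. F x)"
        using Am union(1) by (intro lebesgue_integral_countable_add si) (auto simp: disjoint_family_on_def)
      thus ?case using union(3) by simp
    qed
  qed
  have leb: "(LINT x:A|lebesgue. F x) = 0" if A: "A \<in> sets lebesgue" for A
  proof -
    obtain B N N' where N: "A = B \<union> N" "N \<subseteq> N'" "N' \<in> null_sets lborel" "B \<in> sets lborel"
      using A by (rule sets_completionE)
    have "AE x in lebesgue. x \<notin> N'"
      using N(3) by (intro AE_not_in) (simp add: null_sets_completionI)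
    hence "AE x in lebesgue. x \<in> A \<longleftrightarrow> x \<in> B" by eventually_elim (use N in auto)
    moreover have "set_borel_measurable lebesgue C F" if "C \<in> sets lebesgue" for C
      using si[OF that] unfolding set_integrable_def set_borel_measurable_def
      by (rule borel_measurable_integrable)
    ultimately have "(LINT x:A|lebesgue. F x) = (LINT x:B|lebesgue. F x)"
      using A N(4) by (intro set_integral_cong_set) auto
    with bor N(4) show ?thesis by simp
  qed
  have "AE x in lebesgue. F x = 0"
    by (rule density_unique_real[OF F]) (simp_all add: leb)
  thus ?thesis
    using Sm by (simp add: AE_restrict_space_iff F_def) (auto elim!: eventually_mono split: split_indicator_asm)
qed

lemma L2_on_add:
  assumes "L2_on S f" "L2_on S g"
  shows "L2_on S (\<lambda>x. f x + g x)"
  unfolding L2_on_def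
proof
  show m: "(\<lambda>x. f x + g x) \<in> borel_measurable (lebesgue_on S)"
    using assms by (auto simp: L2_on_def intro!: borel_measurable_add)
  have "(norm (f x + g x))\<^sup>2 \<le> 2 * (norm (f x))\<^sup>2 + 2 * (norm (g x))\<^sup>2" for x
  proof -
    have "(norm (f x + g x))\<^sup>2 \<le> (norm (f x) + norm (g x))\<^sup>2"
      by (intro power_mono norm_triangle_ineq norm_ge_zero)
    thus ?thesis using sum_squares_bound[of "norm (f x)" "norm (g x)"]
      by (simp add: power2_sum)
  qed
  hence a: "AE x in lebesgue_on S. norm ((norm (f x + g x))\<^sup>2) \<le> norm (2 * (norm (f x))\<^sup>2 + 2 * (norm (g x))\<^sup>2)"
    by simp
  have i: "integrable (lebesgue_on S) (\<lambda>x. 2 * (norm (f x))\<^sup>2 + 2 * (norm (g x))\<^sup>2)"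
    using assms by (simp add: L2_on_def)
  have b: "(\<lambda>x. (norm (f x + g x))\<^sup>2) \<in> borel_measurable (lebesgue_on S)"
    using m by measurable
  show "integrable (lebesgue_on S) (\<lambda>x. (norm (f x + g x))\<^sup>2)"
    by (rule Bochner_Integration.integrable_bound[OF i b a])
qed

lemma L2_on_scaleR: "L2_on S f \<Longrightarrow> L2_on S (\<lambda>x. s *\<^sub>R f x)"
  by (auto simp: L2_on_def power_mult_distrib)

lemma L2_on_diff: "L2_on S f \<Longrightarrow> L2_on S g \<Longrightarrow> L2_on S (\<lambda>x. f x - g x)"
  using L2_on_add[of S f "\<lambda>x. (-1) *\<^sub>R g x"] L2_on_scaleR[of S g "-1"] by simp

lemma integrable_product_of_L2:
  assumes B: "bounded_bilinear B" and f: "L2_on S f" and g: "L2_on S g"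
  shows "integrable (lebesgue_on S) (\<lambda>x. B (f x) (g x) :: 'c::euclidean_space)"
proof -
  interpret bounded_bilinear B by fact
  obtain K where K: "K \<ge> 0" "\<And>a b. norm (B a b) \<le> norm a * norm b * K"
    using nonneg_bounded by blast
  have "norm (B (f x) (g x)) \<le> K * ((norm (f x))\<^sup>2 + (norm (g x))\<^sup>2)" for x
  proof -
    have "norm (f x) * norm (g x) \<le> (norm (f x))\<^sup>2 + (norm (g x))\<^sup>2"
      using sum_squares_bound[of "norm (f x)" "norm (g x)"]
        mult_nonneg_nonneg[OF norm_ge_zero[of "f x"] norm_ge_zero[of "g x"]] by linarith
    from mult_right_mono[OF this K(1)] K(2)[of "f x" "g x"] show ?thesis
      by (simp add: mult.commute)
  qed
  hence a: "AE x in lebesgue_on S. norm (B (f x) (g x)) \<le> norm (K * ((norm (f x))\<^sup>2 + (norm (g x))\<^sup>2))"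
    using K(1) by simp
  have i: "integrable (lebesgue_on S) (\<lambda>x. K * ((norm (f x))\<^sup>2 + (norm (g x))\<^sup>2))"
    using f g by (simp add: L2_on_def)
  have c: "continuous_on UNIV (\<lambda>x. B (fst x) (snd x))"
    by (intro continuous_on continuous_intros)
  have b: "(\<lambda>x. B (f x) (g x)) \<in> borel_measurable (lebesgue_on S)"
    by (rule borel_measurable_continuous_Pair[OF _ _ c]) (use f g in \<open>simp_all add: L2_on_def\<close>)
  show ?thesis
    by (rule Bochner_Integration.integrable_bound[OF i b a])
qed

text \<open>Continuity is required on the whole space, hence on the compact closure of \<open>S\<close>, where it gives
  boundedness.\<close>

lemma L2_on_continuous:
  fixes f :: "real^'d \<Rightarrow> 'b::euclidean_space"
  assumes "continuous_on UNIV f" "bounded S" "S \<in> sets lebesgue"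
  shows "L2_on S f"
  unfolding L2_on_def
proof
  show m: "f \<in> borel_measurable (lebesgue_on S)"
    using continuous_on_subset[OF assms(1)]
    by (intro continuous_imp_measurable_on_sets_lebesgue assms) blast
  have "compact (f ` closure S)"
    using continuous_on_subset[OF assms(1)] assms(2)
    by (intro compact_continuous_image) (auto simp: compact_closure)
  then obtain C where C: "\<And>x. x \<in> closure S \<Longrightarrow> norm (f x) \<le> C"
    using compact_imp_bounded bounded_iff by (metis imageI)
  have "S \<in> lmeasurable" using assms bounded_set_imp_lmeasurable by blast
  then interpret finite_measure "lebesgue_on S"
    by (intro finite_measureI) (auto simp: emeasure_restrict_space fmeasurable_def)
  show "integrable (lebesgue_on S) (\<lambda>x. (norm (f x))\<^sup>2)"
  proof (rule integrable_const_bound[where B = "C\<^sup>2"])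
    show "AE x in lebesgue_on S. norm ((norm (f x))\<^sup>2) \<le> C\<^sup>2"
    proof (rule AE_I2)
      fix x assume "x \<in> space (lebesgue_on S)"
      hence "norm (f x) \<le> C" using C closure_subset[of S] by auto
      thus "norm ((norm (f x))\<^sup>2) \<le> C\<^sup>2" by (simp add: power_mono)
    qed
  qed (use m in measurable)
qed

section \<open>Weak gradients and the energy norm\<close>

lemma test_fun_L2:
  assumes "open S" "bounded S" "test_fun S \<phi>"
  shows "L2_on S \<phi>" "L2_on S (cgrad \<phi>)"
  using assms by (auto intro!: L2_on_continuous test_fun_continuous test_fun_cgrad_continuous)

lemma test_fun_lincomb:
  assumes "test_fun S \<phi>" "test_fun S \<psi>"
  shows "test_fun S (\<lambda>x. s * \<phi> x + t * \<psi> x)"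
  using assms by (intro test_fun_add test_fun_mult Ck_const)

lemma cgrad_lincomb:
  assumes "test_fun S \<phi>" "test_fun S \<psi>"
  shows "cgrad (\<lambda>x. s * \<phi> x + t * \<psi> x) x = s *\<^sub>R cgrad \<phi> x + t *\<^sub>R cgrad \<psi> x"
proof -
  note d = test_fun_differentiable[OF assms(1)] test_fun_differentiable[OF assms(2)]
  have "cgrad (\<lambda>x. s * \<phi> x + t * \<psi> x) x = cgrad (\<lambda>x. s * \<phi> x) x + cgrad (\<lambda>x. t * \<psi> x) x"
    by (rule cgrad_add) (auto intro!: differentiable_mult d)
  thus ?thesis by (simp add: vec_eq_iff cgrad_mult d)
qed

lemma integrable_scaleR_L2:
  fixes f :: "real^'d \<Rightarrow> real" and g :: "real^'d \<Rightarrow> 'b::euclidean_space"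
  assumes "L2_on S f" "L2_on S g"
  shows "integrable (lebesgue_on S) (\<lambda>x. f x *\<^sub>R g x)"
  by (rule integrable_product_of_L2[OF bounded_bilinear_scaleR assms])

text \<open>Boundedness of the domain makes the square integrable difference of two weak gradients integrable,
  as the fundamental lemma requires.\<close>

lemma weak_grad_unique:
  fixes S :: "(real^'d) set"
  assumes S: "open S" "bounded S" and g: "weak_grad S u g" and h: "weak_grad S u h"
  shows "AE x in lebesgue_on S. g x = h x"
proof -
  have L2: "L2_on S g" "L2_on S h" "L2_on S (\<lambda>x. g x - h x)"
    using g h by (auto simp: weak_grad_def intro: L2_on_diff)
  have "AE x in lebesgue_on S. (g x - h x) $ i = 0" for i
  proof (rule fundamental_lemma_of_calculus_of_variations[OF S(1)])
    have "L2_on S (\<lambda>x. 1::real)" using S by (intro L2_on_continuous) auto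
    from integrable_scaleR_L2[OF this L2(3)]
    have "integrable (lebesgue_on S) (\<lambda>x. g x - h x)" by simp
    thus "integrable (lebesgue_on S) (\<lambda>x. (g x - h x) $ i)"
      by (rule integrable_bounded_linear[OF bounded_linear_vec_nth])
    fix \<phi> assume \<phi>: "test_fun S \<phi>"
    note \<phi>L = test_fun_L2(1)[OF S \<phi>]
    have "(LINT x|lebesgue_on S. \<phi> x *\<^sub>R g x) = (LINT x|lebesgue_on S. \<phi> x *\<^sub>R h x)"
    proof -
      have "- (LINT x|lebesgue_on S. \<phi> x *\<^sub>R g x) = - (LINT x|lebesgue_on S. \<phi> x *\<^sub>R h x)"
        using g h \<phi> unfolding weak_grad_def by simp
      thus ?thesis by simp
    qed
    hence "(LINT x|lebesgue_on S. \<phi> x *\<^sub>R (g x - h x)) = 0"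
      by (simp add: scaleR_diff_right integrable_scaleR_L2 \<phi>L L2)
    hence "(LINT x|lebesgue_on S. (\<phi> x *\<^sub>R (g x - h x)) $ i) = 0"
      using integral_bounded_linear[OF bounded_linear_vec_nth integrable_scaleR_L2[OF \<phi>L L2(3)], of i]
      by simp
    thus "(LINT x|lebesgue_on S. \<phi> x * (g x - h x) $ i) = 0" by simp
  qed
  hence "AE x in lebesgue_on S. \<forall>i. (g x - h x) $ i = 0"
    by (rule eventually_all_finite)
  thus ?thesis by eventually_elim (simp add: vec_eq_iff)
qed

lemma weak_grad_lincomb:
  assumes S: "open S" "bounded S" and u: "weak_grad S u g" and v: "weak_grad S v h"
  shows "weak_grad S (\<lambda>x. s * u x + t * v x) (\<lambda>x. s *\<^sub>R g x + t *\<^sub>R h x)"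
proof -
  have L: "L2_on S u" "L2_on S v" "L2_on S g" "L2_on S h"
    using u v by (auto simp: weak_grad_def)
  have "(LINT x|lebesgue_on S. (s * u x + t * v x) *\<^sub>R cgrad \<phi> x)
      = - (LINT x|lebesgue_on S. \<phi> x *\<^sub>R (s *\<^sub>R g x + t *\<^sub>R h x))" if \<phi>: "test_fun S \<phi>" for \<phi>
  proof -
    note T = test_fun_L2[OF S \<phi>]
    note I = integrable_scaleR_L2[OF L(1) T(2)] integrable_scaleR_L2[OF L(2) T(2)]
      integrable_scaleR_L2[OF T(1) L(3)] integrable_scaleR_L2[OF T(1) L(4)]
    have "(LINT x|lebesgue_on S. (s * u x + t * v x) *\<^sub>R cgrad \<phi> x)
        = (LINT x|lebesgue_on S. s *\<^sub>R (u x *\<^sub>R cgrad \<phi> x) + t *\<^sub>R (v x *\<^sub>R cgrad \<phi> x))"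
      by (simp add: scaleR_add_left)
    also have "\<dots> = s *\<^sub>R (LINT x|lebesgue_on S. u x *\<^sub>R cgrad \<phi> x) + t *\<^sub>R (LINT x|lebesgue_on S. v x *\<^sub>R cgrad \<phi> x)"
      using I by (simp del: scaleR_scaleR)
    also have "\<dots> = - (s *\<^sub>R (LINT x|lebesgue_on S. \<phi> x *\<^sub>R g x) + t *\<^sub>R (LINT x|lebesgue_on S. \<phi> x *\<^sub>R h x))"
      using u v \<phi> by (simp add: weak_grad_def)
    also have "s *\<^sub>R (LINT x|lebesgue_on S. \<phi> x *\<^sub>R g x) + t *\<^sub>R (LINT x|lebesgue_on S. \<phi> x *\<^sub>R h x)
        = (LINT x|lebesgue_on S. s *\<^sub>R (\<phi> x *\<^sub>R g x) + t *\<^sub>R (\<phi> x *\<^sub>R h x))"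
      using I by (simp del: scaleR_scaleR)
    also have "\<dots> = (LINT x|lebesgue_on S. \<phi> x *\<^sub>R (s *\<^sub>R g x + t *\<^sub>R h x))"
      by (simp add: scaleR_add_right mult.commute)
    finally show ?thesis .
  qed
  moreover have "L2_on S (\<lambda>x. s * u x + t * v x)"
    using L2_on_add[OF L2_on_scaleR[OF L(1)] L2_on_scaleR[OF L(2)]] by simp
  moreover have "L2_on S (\<lambda>x. s *\<^sub>R g x + t *\<^sub>R h x)"
    by (intro L2_on_add L2_on_scaleR L)
  ultimately show ?thesis by (simp add: weak_grad_def)
qed

lemma L2_norm_lincomb_bound:
  assumes f: "L2_on S f" and g: "L2_on S g"
  shows "(LINT x|lebesgue_on S. (norm (s *\<^sub>R f x + t *\<^sub>R g x))\<^sup>2)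
    \<le> 2 * s\<^sup>2 * (LINT x|lebesgue_on S. (norm (f x))\<^sup>2) + 2 * t\<^sup>2 * (LINT x|lebesgue_on S. (norm (g x))\<^sup>2)"
proof -
  have itf: "integrable (lebesgue_on S) (\<lambda>x. (norm (f x))\<^sup>2)"
    and itg: "integrable (lebesgue_on S) (\<lambda>x. (norm (g x))\<^sup>2)"
    and ic: "integrable (lebesgue_on S) (\<lambda>x. (norm (s *\<^sub>R f x + t *\<^sub>R g x))\<^sup>2)"
    using f g L2_on_add[OF L2_on_scaleR[OF f] L2_on_scaleR[OF g]] by (auto simp: L2_on_def)
  have le: "(norm (s *\<^sub>R f x + t *\<^sub>R g x))\<^sup>2 \<le> 2 * s\<^sup>2 * (norm (f x))\<^sup>2 + 2 * t\<^sup>2 * (norm (g x))\<^sup>2" for x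
  proof -
    have "(norm (s *\<^sub>R f x + t *\<^sub>R g x))\<^sup>2 \<le> (\<bar>s\<bar> * norm (f x) + \<bar>t\<bar> * norm (g x))\<^sup>2"
      using norm_triangle_ineq[of "s *\<^sub>R f x" "t *\<^sub>R g x"] by (intro power_mono) auto
    thus ?thesis using sum_squares_bound[of "\<bar>s\<bar> * norm (f x)" "\<bar>t\<bar> * norm (g x)"]
      by (simp add: power2_sum power_mult_distrib)
  qed
  have "(LINT x|lebesgue_on S. (norm (s *\<^sub>R f x + t *\<^sub>R g x))\<^sup>2)
      \<le> (LINT x|lebesgue_on S. 2 * s\<^sup>2 * (norm (f x))\<^sup>2 + 2 * t\<^sup>2 * (norm (g x))\<^sup>2)"
    by (rule integral_mono[OF ic _ le]) (simp add: itf itg)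
  thus ?thesis using itf itg by simp
qed

text \<open>The same linear combinations of the approximating test functions converge, because squared
  norms of sums are bounded by twice the sum of the squared norms.\<close>

lemma H10_lincomb:
  assumes S: "open S" "bounded S" and "u \<in> H10 S" "v \<in> H10 S"
  shows "(\<lambda>x. s * u x + t * v x) \<in> H10 S"
proof -
  obtain g \<phi> where u: "weak_grad S u g" "\<And>n. test_fun S (\<phi> n)"
    "(\<lambda>n::nat. (LINT x|lebesgue_on S. (u x - \<phi> n x)\<^sup>2)
       + (LINT x|lebesgue_on S. (norm (g x - cgrad (\<phi> n) x))\<^sup>2)) \<longlonglongrightarrow> 0" (is "?U \<longlonglongrightarrow> 0")
    using assms(3) unfolding H10_def by blast
  obtain h \<psi> where v: "weak_grad S v h" "\<And>n. test_fun S (\<psi> n)"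
    "(\<lambda>n::nat. (LINT x|lebesgue_on S. (v x - \<psi> n x)\<^sup>2)
       + (LINT x|lebesgue_on S. (norm (h x - cgrad (\<psi> n) x))\<^sup>2)) \<longlonglongrightarrow> 0" (is "?V \<longlonglongrightarrow> 0")
    using assms(4) unfolding H10_def by blast
  define W where "W n = (LINT x|lebesgue_on S. (s * u x + t * v x - (s * \<phi> n x + t * \<psi> n x))\<^sup>2)
     + (LINT x|lebesgue_on S. (norm (s *\<^sub>R g x + t *\<^sub>R h x - cgrad (\<lambda>x. s * \<phi> n x + t * \<psi> n x) x))\<^sup>2)" for n
  have bound: "W n \<le> 2 * s\<^sup>2 * ?U n + 2 * t\<^sup>2 * ?V n" for n
  proof -
    note T = test_fun_L2[OF S u(2)[of n]] test_fun_L2[OF S v(2)[of n]]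
    have L: "L2_on S u" "L2_on S v" "L2_on S g" "L2_on S h"
      using u v by (auto simp: weak_grad_def)
    have eq1: "s * u x + t * v x - (s * \<phi> n x + t * \<psi> n x) = s * (u x - \<phi> n x) + t * (v x - \<psi> n x)" for x
      by (simp add: algebra_simps)
    have eq2: "s *\<^sub>R g x + t *\<^sub>R h x - cgrad (\<lambda>x. s * \<phi> n x + t * \<psi> n x) x
       = s *\<^sub>R (g x - cgrad (\<phi> n) x) + t *\<^sub>R (h x - cgrad (\<psi> n) x)" for x
      unfolding cgrad_lincomb[OF u(2) v(2)] by (simp add: algebra_simps)
    have "(LINT x|lebesgue_on S. (s * (u x - \<phi> n x) + t * (v x - \<psi> n x))\<^sup>2)
      \<le> 2 * s\<^sup>2 * (LINT x|lebesgue_on S. (u x - \<phi> n x)\<^sup>2) + 2 * t\<^sup>2 * (LINT x|lebesgue_on S. (v x - \<psi> n x)\<^sup>2)"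
      using L2_norm_lincomb_bound[OF L2_on_diff[OF L(1) T(1)] L2_on_diff[OF L(2) T(3)], of s t] by simp
    moreover note L2_norm_lincomb_bound[OF L2_on_diff[OF L(3) T(2)] L2_on_diff[OF L(4) T(4)], of s t]
    ultimately show ?thesis unfolding W_def eq1 eq2 by (simp add: algebra_simps)
  qed
  have "(\<lambda>n. 2 * s\<^sup>2 * ?U n + 2 * t\<^sup>2 * ?V n) \<longlonglongrightarrow> 2 * s\<^sup>2 * 0 + 2 * t\<^sup>2 * 0"
    by (intro tendsto_intros u v)
  moreover have "0 \<le> W n" for n unfolding W_def by simp
  ultimately have "W \<longlonglongrightarrow> 0"
    using bound by (intro tendsto_sandwich[OF _ _ tendsto_const[of 0], of W]) simp_all
  moreover have "\<forall>n. test_fun S (\<lambda>x. s * \<phi> n x + t * \<psi> n x)"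
    using test_fun_lincomb[OF u(2) v(2)] by blast
  ultimately show ?thesis
    unfolding H10_def W_def mem_Collect_eq using weak_grad_lincomb[OF S u(1) v(1), of s t]
    by (intro exI[of _ "\<lambda>x. s *\<^sub>R g x + t *\<^sub>R h x"] exI[of _ "\<lambda>n x. s * \<phi> n x + t * \<psi> n x"] conjI)
qed

lemma H10_weak_grad: "u \<in> H10 S \<Longrightarrow> weak_grad S u (wgrad S u)"
  unfolding wgrad_def H10_def by (auto intro: someI[of "weak_grad S u"])

text \<open>The gradient operator selects an arbitrary weak gradient, so it is linear only almost everywhere,
  by uniqueness.\<close>

lemma wgrad_lincomb:
  assumes S: "open S" "bounded S" and "u \<in> H10 S" "v \<in> H10 S"
  shows "AE x in lebesgue_on S.
    wgrad S (\<lambda>x. s * u x + t * v x) x = s *\<^sub>R wgrad S u x + t *\<^sub>R wgrad S v x"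
  by (rule weak_grad_unique[OF S H10_weak_grad[OF H10_lincomb[OF assms]]
        weak_grad_lincomb[OF S H10_weak_grad[OF assms(3)] H10_weak_grad[OF assms(4)]]])

lemma bounded_bilinear_matrix_vector:
  "bounded_bilinear ((*v) :: real^'n^'m \<Rightarrow> real^'n \<Rightarrow> real^'m)"
  unfolding bilinear_conv_bounded_bilinear[symmetric] bilinear_def linear_iff
  by (auto simp: matrix_vector_mult_add_rdistrib matrix_vector_right_distrib
      scaleR_matrix_vector_assoc matrix_vector_mult_scaleR)

lemma L2_on_matrix_vector:
  fixes A :: "real^'d \<Rightarrow> real^'d^'d"
  assumes A: "Linf_on S A" and g: "L2_on S g"
  shows "L2_on S (\<lambda>x. A x *v g x)"
proof -
  obtain C where C: "AE x in lebesgue_on S. norm (A x) \<le> C" and Am: "A \<in> borel_measurable (lebesgue_on S)"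
    using A by (auto simp: Linf_on_def)
  obtain K where K: "\<And>(M::real^'d^'d) x. norm (M *v x) \<le> norm M * norm x * K" "K \<ge> 0"
    using bounded_bilinear.nonneg_bounded[OF bounded_bilinear_matrix_vector] by blast
  have c: "continuous_on UNIV (\<lambda>p::(real^'d^'d) \<times> (real^'d). fst p *v snd p)"
    by (intro bounded_bilinear.continuous_on[OF bounded_bilinear_matrix_vector] continuous_intros)
  have m: "(\<lambda>x. A x *v g x) \<in> borel_measurable (lebesgue_on S)"
    by (rule borel_measurable_continuous_Pair[OF Am _ c]) (use g in \<open>simp add: L2_on_def\<close>)
  have m2: "(\<lambda>x. (norm (A x *v g x))\<^sup>2) \<in> borel_measurable (lebesgue_on S)"
    using m by measurable
  have i: "integrable (lebesgue_on S) (\<lambda>x. (C * K)\<^sup>2 * (norm (g x))\<^sup>2)"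
    using g by (simp add: L2_on_def)
  have b: "AE x in lebesgue_on S. norm ((norm (A x *v g x))\<^sup>2) \<le> norm ((C * K)\<^sup>2 * (norm (g x))\<^sup>2)"
    using C
  proof eventually_elim
    case (elim x)
    have "norm (A x *v g x) \<le> norm (A x) * (norm (g x) * K)" using K(1) by (simp add: mult.assoc)
    also have "\<dots> \<le> C * (norm (g x) * K)" using elim K(2) by (intro mult_right_mono) auto
    finally have "(norm (A x *v g x))\<^sup>2 \<le> (C * (norm (g x) * K))\<^sup>2" by (intro power_mono) auto
    thus ?case by (simp add: power_mult_distrib mult_ac)
  qed
  show ?thesis
    unfolding L2_on_def using m Bochner_Integration.integrable_bound[OF i m2 b] by blast
qed

text \<open>The discriminant argument behind the Cauchy-Schwarz inequality for a possibly degenerate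
  quadratic form.\<close>

lemma sqrt_quadratic_form_bound:
  fixes a b c :: real
  assumes "\<And>s. a + 2 * s * b + s\<^sup>2 * c \<ge> 0" "a \<ge> 0" "c \<ge> 0"
  shows "b \<le> sqrt a * sqrt c"
proof (cases "c = 0")
  case True
  have "b = 0"
  proof (rule ccontr)
    assume "b \<noteq> 0"
    hence "2 * (- (a + 1) / (2 * b)) * b = - (a + 1)" by (simp add: field_simps)
    thus False using assms(1)[of "- (a + 1) / (2 * b)"] True by simp
  qed
  thus ?thesis using True by simp
next
  case False
  have "a + 2 * (- b / c) * b + (- b / c)\<^sup>2 * c = a - b\<^sup>2 / c"
    using False by (simp add: field_simps power2_eq_square)
  hence "b\<^sup>2 / c \<le> a" using assms(1)[of "- b / c"] by linarith
  hence "b\<^sup>2 \<le> a * c" using assms(3) False by (simp add: pos_divide_le_eq)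
  hence "b \<le> sqrt (a * c)" by (rule real_le_rsqrt)
  thus ?thesis by (simp add: real_sqrt_mult)
qed

text \<open>The energy norm is a seminorm on \<open>H\<^sup>1\<^sub>0\<close>: the diffusion form is symmetric and positive semidefinite,
  as the diffusion matrix is almost everywhere, and it is bilinear since the weak gradient is linear
  almost everywhere.\<close>

context
  fixes P :: "('d::finite) problem"
  assumes P: "model_problem P"
begin

lemma domain_open_bounded: "open (pdom P)" "bounded (pdom P)"
  using P by (auto simp: model_problem_def polyhedral_lipschitz_domain_def)

lemma aform_integrable:
  assumes "u \<in> pH10 P" "v \<in> pH10 P"
  shows "integrable (lebesgue_on (pdom P)) (\<lambda>x. (diffusion P x *v pgrad P u x) \<bullet> pgrad P v x)"
  using assms P
  by (intro integrable_product_of_L2[OF bounded_bilinear_inner] L2_on_matrix_vector)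
     (auto simp: model_problem_def dest!: H10_weak_grad simp: weak_grad_def)

lemma aform_lincomb:
  assumes "u \<in> pH10 P" "v \<in> pH10 P" "w \<in> pH10 P"
  shows "aform P (\<lambda>x. s * u x + t * v x) w = s * aform P u w + t * aform P v w"
proof -
  let ?L = "lebesgue_on (pdom P)"
  note i = aform_integrable[OF assms(1,3)] aform_integrable[OF assms(2,3)]
  have "AE x in ?L. (diffusion P x *v pgrad P (\<lambda>x. s * u x + t * v x) x) \<bullet> pgrad P w x
    = s * ((diffusion P x *v pgrad P u x) \<bullet> pgrad P w x) + t * ((diffusion P x *v pgrad P v x) \<bullet> pgrad P w x)"
    using wgrad_lincomb[OF domain_open_bounded assms(1,2), of s t]
    by eventually_elim
       (simp add: matrix_vector_right_distrib matrix_vector_mult_scaleR inner_add_left)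
  hence "aform P (\<lambda>x. s * u x + t * v x) w
     = (LINT x|?L. s * ((diffusion P x *v pgrad P u x) \<bullet> pgrad P w x) + t * ((diffusion P x *v pgrad P v x) \<bullet> pgrad P w x))"
    unfolding aform_def using i aform_integrable[OF H10_lincomb[OF domain_open_bounded assms(1,2)] assms(3)]
    by (intro integral_cong_AE borel_measurable_integrable) auto
  also have "\<dots> = s * aform P u w + t * aform P v w"
    unfolding aform_def using i by simp
  finally show ?thesis .
qed

lemma aform_commute:
  assumes "u \<in> pH10 P" "v \<in> pH10 P"
  shows "aform P u v = aform P v u"
  unfolding aform_def
proof (rule integral_cong_AE)
  have "AE x in lebesgue_on (pdom P). transpose (diffusion P x) = diffusion P x"
    using P by (auto simp: model_problem_def elim: eventually_mono)
  thus "AE x in lebesgue_on (pdom P). (diffusion P x *v pgrad P u x) \<bullet> pgrad P v x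
      = (diffusion P x *v pgrad P v x) \<bullet> pgrad P u x"
    by eventually_elim (metis dot_lmul_matrix inner_commute transpose_matrix_vector)
qed (use assms in \<open>auto intro!: borel_measurable_integrable aform_integrable\<close>)

lemma aform_nonneg: "aform P u u \<ge> 0"
  unfolding aform_def
proof (rule integral_nonneg_AE)
  have "AE x in lebesgue_on (pdom P). \<forall>\<xi>. \<xi> \<noteq> 0 \<longrightarrow> (diffusion P x *v \<xi>) \<bullet> \<xi> > 0"
    using P by (auto simp: model_problem_def elim: eventually_mono)
  thus "AE x in lebesgue_on (pdom P). 0 \<le> (diffusion P x *v pgrad P u x) \<bullet> pgrad P u x"
    by eventually_elim (metis inner_zero_right less_imp_le order_refl)
qed

lemma aform_square:
  assumes "u \<in> pH10 P" "v \<in> pH10 P"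
  shows "aform P (\<lambda>x. r * u x + s * v x) (\<lambda>x. r * u x + s * v x)
    = r\<^sup>2 * aform P u u + 2 * r * s * aform P u v + s\<^sup>2 * aform P v v"
proof -
  let ?w = "\<lambda>x. r * u x + s * v x"
  have w: "?w \<in> pH10 P" by (rule H10_lincomb[OF domain_open_bounded assms])
  have "aform P ?w ?w = r * aform P ?w u + s * aform P ?w v"
    using aform_lincomb[OF assms w] aform_commute[OF w] assms by simp
  also have "\<dots> = r\<^sup>2 * aform P u u + 2 * r * s * aform P u v + s\<^sup>2 * aform P v v"
    using aform_lincomb[OF assms] assms aform_commute[OF assms]
    by (simp add: algebra_simps power2_eq_square)
  finally show ?thesis .
qed

lemma enorm_nonneg: "enorm P u \<ge> 0"
  by (simp add: enorm_def aform_nonneg)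

lemma enorm_add:
  assumes "u \<in> pH10 P" "v \<in> pH10 P"
  shows "enorm P (\<lambda>x. u x + v x) \<le> enorm P u + enorm P v"
proof -
  have cs: "aform P u v \<le> sqrt (aform P u u) * sqrt (aform P v v)"
    using aform_nonneg[of "\<lambda>x. 1 * u x + s * v x" for s] aform_square[OF assms, of 1]
    by (intro sqrt_quadratic_form_bound aform_nonneg) simp
  have "aform P (\<lambda>x. u x + v x) (\<lambda>x. u x + v x) = aform P u u + 2 * aform P u v + aform P v v"
    using aform_square[OF assms, of 1 1] by simp
  also have "\<dots> \<le> (sqrt (aform P u u) + sqrt (aform P v v))\<^sup>2"
    using cs by (simp add: power2_sum aform_nonneg)
  finally show ?thesis
    unfolding enorm_def by (intro real_le_lsqrt add_nonneg_nonneg) (simp_all add: aform_nonneg)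
qed

lemma enorm_scale:
  assumes "u \<in> pH10 P"
  shows "enorm P (\<lambda>x. s * u x) = \<bar>s\<bar> * enorm P u"
  using aform_square[OF assms assms, of s 0] by (simp add: enorm_def real_sqrt_mult)

lemma pH10_diff: "u \<in> pH10 P \<Longrightarrow> v \<in> pH10 P \<Longrightarrow> (\<lambda>x. u x - v x) \<in> pH10 P"
  using H10_lincomb[OF domain_open_bounded, of u v 1 "-1"] by simp

lemma enorm_diff_commute:
  assumes "u \<in> pH10 P" "v \<in> pH10 P"
  shows "enorm P (\<lambda>x. u x - v x) = enorm P (\<lambda>x. v x - u x)"
  using enorm_scale[OF pH10_diff[OF assms], of "-1"] by simp

lemma enorm_diff_self:
  assumes "u \<in> pH10 P"
  shows "enorm P (\<lambda>x. u x - u x) = 0"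
  using enorm_scale[OF assms, of 0] by simp

lemma enorm_diff_triangle:
  assumes "u \<in> pH10 P" "v \<in> pH10 P" "w \<in> pH10 P"
  shows "enorm P (\<lambda>x. u x - w x) \<le> enorm P (\<lambda>x. u x - v x) + enorm P (\<lambda>x. v x - w x)"
  using enorm_add[OF pH10_diff[OF assms(1,2)] pH10_diff[OF assms(2,3)]] by simp

end

section \<open>Finite element spaces\<close>

text \<open>Gaussian elimination, one coordinate at a time: a vector with nonzero \<open>j\<close>-th entry is used to
  eliminate this entry from all others.\<close>

lemma finite_spanning_set_of_coefficient_space:
  fixes C :: "('i \<Rightarrow> real) set"
  assumes "finite I" "\<And>c c' s t. c \<in> C \<Longrightarrow> c' \<in> C \<Longrightarrow> (\<lambda>i. s * c i + t * c' i) \<in> C"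
  shows "\<exists>B\<subseteq>C. finite B \<and> (\<forall>c\<in>C. \<exists>s. \<forall>i\<in>I. c i = (\<Sum>b\<in>B. s b * b i))"
  using assms
proof (induction I arbitrary: C rule: finite_induct)
  case empty
  show ?case by (intro exI[of _ "{}"]) auto
next
  case (insert j I)
  define C0 where "C0 = {c \<in> C. c j = 0}"
  have "(\<lambda>i. s * c i + t * c' i) \<in> C0" if "c \<in> C0" "c' \<in> C0" for c c' s t
    using that insert.prems unfolding C0_def by simp
  from insert.IH[OF this] obtain B where B: "B \<subseteq> C0" "finite B"
    "\<And>c. c \<in> C0 \<Longrightarrow> \<exists>s. \<forall>i\<in>I. c i = (\<Sum>b\<in>B. s b * b i)" by blast
  have "b j = 0" if "b \<in> B" for b using B(1) that by (auto simp: C0_def)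
  hence B0: "(\<Sum>b\<in>B. s b * b j) = 0" "e \<in> B \<Longrightarrow> e j = 0" for s e
    by (auto intro!: sum.neutral)
  show ?case
  proof (cases "C = C0")
    case True
    have "\<exists>s. \<forall>i\<in>insert j I. c i = (\<Sum>b\<in>B. s b * b i)" if "c \<in> C" for c
    proof -
      have c0: "c \<in> C0" using that True by simp
      from B(3)[OF this] obtain s where "\<forall>i\<in>I. c i = (\<Sum>b\<in>B. s b * b i)" by blast
      moreover have "c j = 0" using c0 by (simp add: C0_def)
      ultimately show ?thesis using B0(1)[of s] by (intro exI[of _ s]) simp
    qed
    thus ?thesis using B True by blast
  next
    case False
    then obtain e where e: "e \<in> C" "e j \<noteq> 0" by (auto simp: C0_def)
    have eB: "e \<notin> B" using B0(2) e(2) by blast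
    have "\<exists>s. \<forall>i\<in>insert j I. c i = (\<Sum>b\<in>insert e B. s b * b i)" if c: "c \<in> C" for c
    proof -
      define r where "r = c j / e j"
      have "(\<lambda>i. 1 * c i + (- r) * e i) \<in> C0"
        using insert.prems[OF c e(1), of 1 "- r"] e(2) by (auto simp: C0_def r_def)
      from B(3)[OF this] obtain s where s: "\<And>i. i \<in> I \<Longrightarrow> c i = r * e i + (\<Sum>b\<in>B. s b * b i)"
        by (auto simp: algebra_simps)
      have "c i = (\<Sum>b\<in>insert e B. (s(e := r)) b * b i)" if "i \<in> insert j I" for i
      proof -
        have "(\<Sum>b\<in>insert e B. (s(e := r)) b * b i) = r * e i + (\<Sum>b\<in>B. (s(e := r)) b * b i)"
          using B(2) eB by simp
        also have "(\<Sum>b\<in>B. (s(e := r)) b * b i) = (\<Sum>b\<in>B. s b * b i)"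
          using eB by (intro sum.cong) auto
        finally have "(\<Sum>b\<in>insert e B. (s(e := r)) b * b i) = r * e i + (\<Sum>b\<in>B. s b * b i)" .
        moreover have "c j = r * e j + (\<Sum>b\<in>B. s b * b j)"
          using e(2) B0(1)[of s] by (simp add: r_def)
        ultimately show ?thesis using that s[of i] by auto
      qed
      thus ?thesis by blast
    qed
    moreover have "insert e B \<subseteq> C" "finite (insert e B)" using e B by (auto simp: C0_def)
    ultimately show ?thesis by blast
  qed
qed

definition monomial :: "('d \<Rightarrow> nat) \<Rightarrow> real^'d \<Rightarrow> real" where
  "monomial \<alpha> x = (\<Prod>i\<in>UNIV. (x $ i) ^ \<alpha> i)"

definition degree_le :: "nat \<Rightarrow> ('d::finite \<Rightarrow> nat) set" where
  "degree_le p = {\<alpha>. (\<Sum>i\<in>UNIV. \<alpha> i) \<le> p}"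

lemma poly_deg_le_iff:
  "q \<in> poly_deg_le p \<longleftrightarrow> (\<exists>s. \<forall>x. q x = (\<Sum>\<alpha>\<in>degree_le p. s \<alpha> * monomial \<alpha> x))"
  by (simp add: poly_deg_le_def monomial_def degree_le_def)

lemma finite_degree_le: "finite (degree_le p :: ('d::finite \<Rightarrow> nat) set)"
proof (rule finite_subset)
  show "degree_le p \<subseteq> PiE (UNIV :: 'd set) (\<lambda>_. {..p})"
  proof
    fix \<alpha> :: "'d \<Rightarrow> nat" assume a: "\<alpha> \<in> degree_le p"
    have "\<alpha> i \<le> p" for i
      using member_le_sum[of i UNIV \<alpha>] a by (simp add: degree_le_def)
    thus "\<alpha> \<in> PiE UNIV (\<lambda>_. {..p})" by (auto simp: PiE_UNIV_domain)
  qed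
qed (intro finite_PiE; simp)

lemma poly_deg_le_lincomb:
  assumes "q \<in> poly_deg_le p" "r \<in> poly_deg_le p"
  shows "(\<lambda>x. s * q x + t * r x) \<in> poly_deg_le p"
proof -
  obtain a b where "\<And>x. q x = (\<Sum>\<alpha>\<in>degree_le p. a \<alpha> * monomial \<alpha> x)"
    "\<And>x. r x = (\<Sum>\<alpha>\<in>degree_le p. b \<alpha> * monomial \<alpha> x)"
    using assms unfolding poly_deg_le_iff by metis
  hence "s * q x + t * r x = (\<Sum>\<alpha>\<in>degree_le p. (s * a \<alpha> + t * b \<alpha>) * monomial \<alpha> x)" for x
    by (simp add: sum_distrib_left sum.distrib algebra_simps)
  thus ?thesis unfolding poly_deg_le_iff by (intro exI[of _ "\<lambda>\<alpha>. s * a \<alpha> + t * b \<alpha>"]) blast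
qed

lemma fe_space_subset: "fe_space P p \<T> \<subseteq> pH10 P"
  by (auto simp: fe_space_def)

lemma fe_space_lincomb:
  assumes P: "model_problem P" and "u \<in> fe_space P p \<T>" "v \<in> fe_space P p \<T>"
  shows "(\<lambda>x. s * u x + t * v x) \<in> fe_space P p \<T>"
proof -
  have "\<exists>q\<in>poly_deg_le p. AE x in lebesgue_on (elem T). s * u x + t * v x = q x" if T: "T \<in> \<T>" for T
  proof -
    obtain q where q: "q \<in> poly_deg_le p" "AE x in lebesgue_on (elem T). u x = q x"
      using assms(2) T by (auto simp: fe_space_def)
    obtain r where r: "r \<in> poly_deg_le p" "AE x in lebesgue_on (elem T). v x = r x"
      using assms(3) T by (auto simp: fe_space_def)
    have "AE x in lebesgue_on (elem T). s * u x + t * v x = s * q x + t * r x"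
      using q(2) r(2) by eventually_elim simp
    with poly_deg_le_lincomb[OF q(1) r(1), of s t] show ?thesis by (intro bexI)
  qed
  moreover have "u \<in> pH10 P" "v \<in> pH10 P" using assms fe_space_subset by blast+
  ultimately show ?thesis
    using H10_lincomb[OF domain_open_bounded[OF P]] by (auto simp: fe_space_def)
qed

lemma elem_sets_lebesgue: "elem T \<in> sets lebesgue"
proof -
  have "compact (elem T)" unfolding elem_def by (intro finite_imp_compact_convex_hull) simp
  thus ?thesis by (intro lmeasurable_compact fmeasurableD)
qed

lemma conforming_mesh_finite: "conforming_mesh S \<T> \<Longrightarrow> finite \<T>"
  using finite_imageD[of elem \<T>] by (simp add: conforming_mesh_def triangulation_def)

lemma conforming_mesh_covers: "conforming_mesh S \<T> \<Longrightarrow> S \<subseteq> \<Union>(elem ` \<T>)"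
  using closure_subset[of S] by (simp add: conforming_mesh_def)

text \<open>A finite element function is determined almost everywhere by the coefficients of its polynomials
  on the elements. Elimination takes place in the space of coefficients, whose finite spanning set is
  then lifted to functions of the finite element space itself.\<close>

lemma fe_space_finite_spanning_set:
  fixes P :: "('d::finite) problem"
  assumes P: "model_problem P" and mesh: "conforming_mesh (pdom P) \<T>"
  shows "\<exists>B\<subseteq>fe_space P p \<T>. finite B \<and> (\<forall>v\<in>fe_space P p \<T>. \<exists>s.
           AE x in lebesgue_on (pdom P). v x = (\<Sum>b\<in>B. s b * b x))"
proof -
  let ?V = "fe_space P p \<T>"
  define I where "I = \<T> \<times> (degree_le p :: ('d \<Rightarrow> nat) set)"
  have fin: "finite \<T>" using mesh by (rule conforming_mesh_finite)
  have finI: "finite I" unfolding I_def using fin finite_degree_le by blast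
  define coeffs where "coeffs v c \<longleftrightarrow> (\<forall>T\<in>\<T>. AE x in lebesgue_on (elem T).
      v x = (\<Sum>\<alpha>\<in>degree_le p. c (T, \<alpha>) * monomial \<alpha> x))" for v :: "real^'d \<Rightarrow> real" and c
  have ex: "\<exists>c. coeffs v c" if v: "v \<in> ?V" for v
  proof -
    have "\<forall>T\<in>\<T>. \<exists>s. AE x in lebesgue_on (elem T). v x = (\<Sum>\<alpha>\<in>degree_le p. s \<alpha> * monomial \<alpha> x)"
    proof
      fix T assume "T \<in> \<T>"
      then obtain q where q: "q \<in> poly_deg_le p" "AE x in lebesgue_on (elem T). v x = q x"
        using v by (auto simp: fe_space_def)
      then obtain s where "\<And>x. q x = (\<Sum>\<alpha>\<in>degree_le p. s \<alpha> * monomial \<alpha> x)"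
        by (auto simp: poly_deg_le_iff)
      with q(2) show "\<exists>s. AE x in lebesgue_on (elem T). v x = (\<Sum>\<alpha>\<in>degree_le p. s \<alpha> * monomial \<alpha> x)"
        by auto
    qed
    then obtain s where "\<forall>T\<in>\<T>. AE x in lebesgue_on (elem T). v x = (\<Sum>\<alpha>\<in>degree_le p. s T \<alpha> * monomial \<alpha> x)"
      by (rule bchoice[THEN exE])
    thus ?thesis unfolding coeffs_def by (intro exI[of _ "\<lambda>(T, \<alpha>). s T \<alpha>"]) simp
  qed
  define C where "C = {c. \<exists>v\<in>?V. coeffs v c}"
  \<comment> \<open>The relation \<open>coeffs\<close> is linear, although coefficients of a function are not chosen linearly.\<close>
  have "(\<lambda>i. s * c i + t * c' i) \<in> C" if cc: "c \<in> C" "c' \<in> C" for c c' s t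
  proof -
    obtain v v' where v: "v \<in> ?V" "coeffs v c" and v': "v' \<in> ?V" "coeffs v' c'"
      using cc unfolding C_def by blast
    have "coeffs (\<lambda>x. s * v x + t * v' x) (\<lambda>i. s * c i + t * c' i)"
      unfolding coeffs_def
    proof
      fix T assume T: "T \<in> \<T>"
      have "AE x in lebesgue_on (elem T). v x = (\<Sum>\<alpha>\<in>degree_le p. c (T, \<alpha>) * monomial \<alpha> x)"
        "AE x in lebesgue_on (elem T). v' x = (\<Sum>\<alpha>\<in>degree_le p. c' (T, \<alpha>) * monomial \<alpha> x)"
        using v(2) v'(2) T by (auto simp: coeffs_def)
      thus "AE x in lebesgue_on (elem T). s * v x + t * v' x
          = (\<Sum>\<alpha>\<in>degree_le p. (s * c (T, \<alpha>) + t * c' (T, \<alpha>)) * monomial \<alpha> x)"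
        by eventually_elim (simp add: sum_distrib_left sum.distrib algebra_simps)
    qed
    with fe_space_lincomb[OF P v(1) v'(1)] show ?thesis unfolding C_def by blast
  qed
  from finite_spanning_set_of_coefficient_space[OF finI this]
  obtain B where B: "B \<subseteq> C" "finite B"
    "\<And>c. c \<in> C \<Longrightarrow> \<exists>s. \<forall>i\<in>I. c i = (\<Sum>b\<in>B. s b * b i)" by blast
  have "\<forall>b\<in>B. \<exists>v. v \<in> ?V \<and> coeffs v b" using B(1) unfolding C_def by blast
  then obtain f where "\<forall>b\<in>B. f b \<in> ?V \<and> coeffs (f b) b" by (rule bchoice[THEN exE])
  hence f: "\<And>b. b \<in> B \<Longrightarrow> f b \<in> ?V" "\<And>b. b \<in> B \<Longrightarrow> coeffs (f b) b" by blast+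
  have "\<exists>s. AE x in lebesgue_on (pdom P). v x = (\<Sum>b\<in>f ` B. s b * b x)" if v: "v \<in> ?V" for v
  proof -
    obtain c where c: "coeffs v c" using ex[OF v] by blast
    then obtain s where s: "\<And>i. i \<in> I \<Longrightarrow> c i = (\<Sum>b\<in>B. s b * b i)"
      using B(3)[of c] v by (auto simp: C_def)
    have eq: "AE x in lebesgue_on (elem T). v x = (\<Sum>b\<in>B. s b * f b x)" if T: "T \<in> \<T>" for T
    proof -
      have "AE x in lebesgue_on (elem T). \<forall>b\<in>B. f b x = (\<Sum>\<alpha>\<in>degree_le p. b (T, \<alpha>) * monomial \<alpha> x)"
        using f(2) T B(2) by (intro AE_finite_allI) (auto simp: coeffs_def)
      moreover have "AE x in lebesgue_on (elem T). v x = (\<Sum>\<alpha>\<in>degree_le p. c (T, \<alpha>) * monomial \<alpha> x)"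
        using c T by (auto simp: coeffs_def)
      ultimately show ?thesis
      proof eventually_elim
        case (elim x)
        have "v x = (\<Sum>\<alpha>\<in>degree_le p. (\<Sum>b\<in>B. s b * b (T, \<alpha>)) * monomial \<alpha> x)"
          using elim(2) s T by (simp add: I_def)
        also have "\<dots> = (\<Sum>\<alpha>\<in>degree_le p. \<Sum>b\<in>B. s b * (b (T, \<alpha>) * monomial \<alpha> x))"
          by (simp add: sum_distrib_right mult.assoc)
        also have "\<dots> = (\<Sum>b\<in>B. s b * (\<Sum>\<alpha>\<in>degree_le p. b (T, \<alpha>) * monomial \<alpha> x))"
          by (subst sum.swap) (simp add: sum_distrib_left)
        also have "\<dots> = (\<Sum>b\<in>B. s b * f b x)" using elim(1) by simp
        finally show ?case .
      qed
    qed
    have "AE x in lebesgue. \<forall>T\<in>\<T>. x \<in> elem T \<longrightarrow> v x = (\<Sum>b\<in>B. s b * f b x)"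
    proof (rule AE_finite_allI[OF fin])
      fix T assume "T \<in> \<T>"
      from eq[OF this] show "AE x in lebesgue. x \<in> elem T \<longrightarrow> v x = (\<Sum>b\<in>B. s b * f b x)"
        by (simp add: AE_restrict_space_iff elem_sets_lebesgue)
    qed
    hence "AE x in lebesgue. x \<in> pdom P \<longrightarrow> v x = (\<Sum>b\<in>B. s b * f b x)"
      by eventually_elim (use conforming_mesh_covers[OF mesh] in blast)
    hence "AE x in lebesgue_on (pdom P). v x = (\<Sum>b\<in>B. s b * f b x)"
      using domain_open_bounded(1)[OF P] by (simp add: AE_restrict_space_iff)
    \<comment> \<open>Different coefficient vectors may have been lifted to the same function.\<close>
    moreover have "(\<Sum>b\<in>B. s b * f b x) = (\<Sum>w\<in>f ` B. (\<Sum>b | b \<in> B \<and> f b = w. s b) * w x)" for x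
      using sum.image_gen[OF B(2), of "\<lambda>b. s b * f b x" f] by (simp add: sum_distrib_right)
    ultimately have "AE x in lebesgue_on (pdom P). v x = (\<Sum>w\<in>f ` B. (\<Sum>b | b \<in> B \<and> f b = w. s b) * w x)"
      by simp
    thus ?thesis by (intro exI[of _ "\<lambda>w. \<Sum>b | b \<in> B \<and> f b = w. s b"])
  qed
  moreover have "f ` B \<subseteq> ?V" "finite (f ` B)" using f(1) B(2) by auto
  ultimately show ?thesis by blast
qed

lemma fe_space_findim:
  assumes P: "model_problem P" and mesh: "conforming_mesh (pdom P) \<T>"
    and w: "w \<in> fe_space P p \<T>"
  shows "findim_subspace P (fe_space P p \<T>)"
proof -
  note L = fe_space_lincomb[OF P]
  have "(\<lambda>x. 0) \<in> fe_space P p \<T>" using L[OF w w, of 0 0] by simp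
  moreover have "(\<lambda>x. u x + v x) \<in> fe_space P p \<T>" if "u \<in> fe_space P p \<T>" "v \<in> fe_space P p \<T>" for u v
    using L[OF that, of 1 1] by simp
  moreover have "(\<lambda>x. s * u x) \<in> fe_space P p \<T>" if "u \<in> fe_space P p \<T>" for u s
    using L[OF that that, of s 0] by simp
  ultimately show ?thesis
    unfolding findim_subspace_def
    using fe_space_subset fe_space_finite_spanning_set[OF P mesh, of p] by blast
qed

lemma bisect_child:
  fixes T :: "('d::finite) tsimplex"
  assumes T': "T' \<in> bisect T" and len: "length (fst T) = CARD('d) + 1"
  shows "length (fst T') = CARD('d) + 1" "elem T' \<subseteq> elem T"
proof -
  define zs where "zs = fst T"
  have l2: "length zs \<ge> 2" "length zs = CARD('d) + 1" using len by (auto simp: zs_def Suc_leI)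
  have ne: "zs \<noteq> []" using l2 by auto
  define l where "l = butlast (tl zs)"
  have ll: "length l = length zs - 2" by (simp add: l_def)
  have perm: "length (take n l @ rev (drop n l)) = length l" "set (take n l @ rev (drop n l)) = set l" for n
  proof -
    show "length (take n l @ rev (drop n l)) = length l" by auto
    have "set (take n l @ rev (drop n l)) = set (take n l @ drop n l)"
      unfolding set_append set_rev ..
    thus "set (take n l @ rev (drop n l)) = set l" unfolding append_take_drop_id .
  qed
  obtain a ys where f: "fst T' = a # midpoint (hd zs) (last zs) # ys" "a \<in> {hd zs, last zs}"
    "length ys = length zs - 2" "set ys = set l"
  proof -
    consider "fst T' = hd zs # midpoint (hd zs) (last zs) # l"
      | "fst T' = last zs # midpoint (hd zs) (last zs) # take (snd T) l @ rev (drop (snd T) l)"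
      using T' unfolding bisect_def Let_def zs_def l_def by auto
    thus thesis
      by cases (rule that[OF _ _ _ refl], assumption, simp, simp add: ll,
                rule that[OF _ _ _ perm(2)], assumption, simp, simp only: perm(1) ll)
  qed
  show "length (fst T') = CARD('d) + 1" using f l2 by simp
  have ab: "hd zs \<in> set zs" "last zs \<in> set zs" using ne by auto
  have "set ys \<subseteq> set zs"
    using f(4) list.set_sel(2)[OF ne] unfolding l_def by (auto dest: in_set_butlastD)
  hence "set (fst T') \<subseteq> convex hull (set zs)"
    using f(1,2) ab hull_subset[of "set zs" convex]
      midpoints_in_convex_hull[OF hull_inc[OF ab(1)] hull_inc[OF ab(2)]]
    by auto
  thus "elem T' \<subseteq> elem T" unfolding elem_def zs_def by (intro hull_minimal) auto
qed

text \<open>The number of vertices is carried along because bisection is meaningful only for vertex lists of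
  full length.\<close>

lemma bisect_steps_elem_subset:
  fixes \<T> :: "('d::finite) tsimplex set"
  assumes "bisect_step\<^sup>*\<^sup>* \<T> \<T>'" "\<And>T. T \<in> \<T> \<Longrightarrow> length (fst T) = CARD('d) + 1"
  shows "\<forall>T'\<in>\<T>'. length (fst T') = CARD('d) + 1 \<and> (\<exists>T\<in>\<T>. elem T' \<subseteq> elem T)"
  using assms(1)
proof (induction rule: rtranclp_induct)
  case base
  thus ?case using assms(2) by blast
next
  case (step \<T>1 \<T>2)
  obtain T where T: "T \<in> \<T>1" "\<T>2 = (\<T>1 - {T}) \<union> bisect T"
    using step(2) by (auto simp: bisect_step_def)
  show ?case
  proof
    fix T' assume "T' \<in> \<T>2"
    with T consider "T' \<in> \<T>1" | "T' \<in> bisect T" by blast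
    thus "length (fst T') = CARD('d) + 1 \<and> (\<exists>T\<in>\<T>. elem T' \<subseteq> elem T)"
    proof cases
      case 1 thus ?thesis using step.IH by blast
    next
      case 2
      have lenT: "length (fst T) = CARD('d) + 1" using step.IH T(1) by blast
      from bisect_child[OF 2 lenT] step.IH T(1) show ?thesis by (meson order_trans)
    qed
  qed
qed

text \<open>Every element of the refined mesh lies in an element of the coarse mesh and inherits its
  polynomial.\<close>

lemma fe_space_nested:
  assumes "conforming_mesh (pdom P) \<T>" "bisect_step\<^sup>*\<^sup>* \<T> \<T>'"
  shows "fe_space P p \<T> \<subseteq> fe_space P p \<T>'"
proof
  fix v assume v: "v \<in> fe_space P p \<T>"
  have "\<exists>q\<in>poly_deg_le p. AE x in lebesgue_on (elem T'). v x = q x" if T': "T' \<in> \<T>'" for T'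
  proof -
    obtain T where T: "T \<in> \<T>" "elem T' \<subseteq> elem T"
      using bisect_steps_elem_subset[OF assms(2)] assms(1) T' unfolding conforming_mesh_def by metis
    then obtain q where q: "q \<in> poly_deg_le p" "AE x in lebesgue_on (elem T). v x = q x"
      using v by (auto simp: fe_space_def)
    have "AE x in lebesgue. x \<in> elem T \<longrightarrow> v x = q x"
      using q(2) by (simp add: AE_restrict_space_iff elem_sets_lebesgue)
    hence "AE x in lebesgue. x \<in> elem T' \<longrightarrow> v x = q x" by eventually_elim (use T(2) in blast)
    hence "AE x in lebesgue_on (elem T'). v x = q x"
      by (simp add: AE_restrict_space_iff elem_sets_lebesgue)
    with q(1) show ?thesis by blast
  qed
  thus "v \<in> fe_space P p \<T>'" using v by (simp add: fe_space_def)
qed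

lemma refinements_trans:
  "\<T>' \<in> refinements S \<T> \<Longrightarrow> \<T>'' \<in> refinements S \<T>' \<Longrightarrow> \<T>'' \<in> refinements S \<T>"
  unfolding refinements_def by (auto intro: rtranclp_trans)

lemma refinements_refl: "conforming_mesh S \<T> \<Longrightarrow> \<T> \<in> refinements S \<T>"
  by (simp add: refinements_def)

section \<open>Estimators over sets of elements\<close>

lemma eta_square: "finite U \<Longrightarrow> (eta P \<T> U v)\<^sup>2 = (\<Sum>T\<in>U. (eta_loc P \<T> T v)\<^sup>2)"
  by (simp add: eta_def sum_nonneg)

lemma eta_nonneg: "eta P \<T> U v \<ge> 0"
  by (simp add: eta_def sum_nonneg)

lemma eta_square_split:
  assumes "finite \<U>" "\<U>' \<subseteq> \<U>"
  shows "(eta P \<T> \<U> v)\<^sup>2 = (eta P \<T> \<U>' v)\<^sup>2 + (eta P \<T> (\<U> - \<U>') v)\<^sup>2"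
  using assms by (simp add: eta_square finite_subset sum.subset_diff add.commute)

lemma eta_mono: "finite \<U> \<Longrightarrow> \<U>' \<subseteq> \<U> \<Longrightarrow> eta P \<T> \<U>' v \<le> eta P \<T> \<U> v"
  unfolding eta_def by (intro real_sqrt_le_mono sum_mono2) auto

section \<open>R-linear convergence of sequences\<close>

definition r_linear :: "(nat \<Rightarrow> real) \<Rightarrow> bool" where
  "r_linear h \<longleftrightarrow> (\<exists>q C. 0 < q \<and> q < 1 \<and> C > 0 \<and> (\<forall>n m. n \<le> m \<longrightarrow> h m \<le> C * q ^ (m - n) * h n))"

lemma r_linear_by_halving:
  fixes h :: "nat \<Rightarrow> real"
  assumes nn: "\<And>n. 0 \<le> h n" and C: "C > 0" "\<And>n m. n \<le> m \<Longrightarrow> h m \<le> C * h n"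
    and N: "N \<ge> 1" "\<And>n. h (n + N) \<le> h n / 2"
  shows "r_linear h"
proof -
  define q where "q = (1 / 2 :: real) powr (1 / N)"
  have q: "0 < q" "q < 1" "q ^ N = 1 / 2"
  proof -
    show "0 < q" by (simp add: q_def)
    have "(1 / 2 :: real) powr (1 / N) < (1 / 2) powr 0"
      using N(1) by (intro powr_less_mono') auto
    thus "q < 1" by (simp add: q_def)
    show "q ^ N = 1 / 2" using N(1) by (simp add: q_def powr_realpow[symmetric] powr_powr)
  qed
  have iter: "h (n + i * N) \<le> (1 / 2) ^ i * h n" for n i
  proof (induction i)
    case (Suc i)
    have "h (n + Suc i * N) \<le> h (n + i * N) / 2" using N(2)[of "n + i * N"] by (simp add: algebra_simps)
    also have "\<dots> \<le> ((1 / 2) ^ i * h n) / 2" using Suc by (intro divide_right_mono) auto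
    finally show ?case by simp
  qed simp
  have "h m \<le> (2 * C) * q ^ (m - n) * h n" if "n \<le> m" for n m
  proof -
    define i r where "i = (m - n) div N" and "r = (m - n) mod N"
    have m: "m - n = i * N + r" "r < N" using N(1) by (auto simp: i_def r_def)
    have "h m \<le> C * h (n + i * N)" using m that by (intro C) auto
    also have "\<dots> \<le> C * ((1 / 2) ^ i * h n)" using iter C(1) by simp
    finally have 1: "h m \<le> C * (1 / 2) ^ i * h n" by (simp add: mult.assoc)
    have "q ^ N \<le> q ^ r" using q m(2) by (intro power_decreasing) auto
    hence "1 \<le> 2 * q ^ r" using q(3) by simp
    hence "C * (1 / 2) ^ i * h n * 1 \<le> C * (1 / 2) ^ i * h n * (2 * q ^ r)"
      using C(1) nn by (intro mult_left_mono) auto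
    also have "\<dots> = 2 * C * q ^ (m - n) * h n"
      by (simp add: m(1) power_add power_mult[symmetric] mult.commute[of i] power_mult q(3))
    finally show ?thesis using 1 by simp
  qed
  thus ?thesis unfolding r_linear_def using q C(1)
    by (intro exI[of _ q] exI[of _ "2 * C"]) auto
qed

text \<open>By quasi-monotonicity, \<open>(N + 1) h\<^bsub>n+N\<^esub>\<close> is at most a multiple of the sum of \<open>h\<^sub>n, \<dots>, h\<^bsub>n+N\<^esub>\<close>, hence
  of \<open>(N + 1)\<^bsup>1-\<delta>\<^esup> h\<^sub>n\<close>. So \<open>h\<^bsub>n+N\<^esub> \<le> C (N + 1)\<^bsup>-\<delta>\<^esup> h\<^sub>n\<close>, and for one fixed large \<open>N\<close> the factor is below one
  half, uniformly in \<open>n\<close>. For \<open>\<delta> = 1\<close> this is the criterion of uniformly bounded tail sums.\<close>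

lemma r_linear_by_sublinear_sums:
  fixes h :: "nat \<Rightarrow> real"
  assumes nn: "\<And>n. 0 \<le> h n" and C: "C > 0" "\<And>n m. n \<le> m \<Longrightarrow> h m \<le> C * h n"
    and K: "K > 0" "\<And>n N. (\<Sum>j=n..n+N. h j) \<le> K * real (N + 1) powr (1 - \<delta>) * h n"
    and \<delta>: "\<delta> > 0"
  shows "r_linear h"
proof -
  have decay: "h (n + N) \<le> C * K * real (N + 1) powr (- \<delta>) * h n" for n N
  proof -
    have "real (N + 1) * h (n + N) = (\<Sum>j=n..n+N. h (n + N))" by simp
    also have "\<dots> \<le> (\<Sum>j=n..n+N. C * h j)" by (intro sum_mono C) auto
    also have "\<dots> = C * (\<Sum>j=n..n+N. h j)" by (simp add: sum_distrib_left)
    also have "\<dots> \<le> C * (K * real (N + 1) powr (1 - \<delta>) * h n)"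
      using C(1) K(2) by (intro mult_left_mono) auto
    also have "real (N + 1) powr (1 - \<delta>) = real (N + 1) * real (N + 1) powr (- \<delta>)"
      using powr_add[of "real (N + 1)" 1 "- \<delta>"] by simp
    finally have "real (N + 1) * h (n + N) \<le> real (N + 1) * (C * K * real (N + 1) powr (- \<delta>) * h n)"
      by (simp only: mult_ac)
    thus ?thesis by (rule mult_left_le_imp_le) simp
  qed
  have "(\<lambda>N. C * K * real (N + 1) powr (- \<delta>)) \<longlonglongrightarrow> C * K * 0"
    using \<delta> filterlim_compose[OF filterlim_real_sequentially filterlim_Suc]
    by (intro tendsto_mult tendsto_const tendsto_neg_powr) auto
  hence "\<forall>\<^sub>F N in sequentially. C * K * real (N + 1) powr (- \<delta>) < 1 / 2"
    by (rule order_tendstoD) simp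
  then obtain N where N: "N \<ge> 1" "C * K * real (N + 1) powr (- \<delta>) < 1 / 2"
    using eventually_conj[OF _ eventually_ge_at_top[of "1::nat"]] eventually_happens by fastforce
  show ?thesis
  proof (rule r_linear_by_halving[OF nn C N(1)])
    fix n
    have "C * K * real (N + 1) powr (- \<delta>) * h n \<le> 1 / 2 * h n"
      using N(2) nn by (intro mult_right_mono) auto
    thus "h (n + N) \<le> h n / 2" using decay[of n N] by simp
  qed
qed

lemma geometric_partial_sum_le:
  assumes "0 \<le> (q::real)" "q < 1"
  shows "(\<Sum>k<n. q ^ k) \<le> 1 / (1 - q)"
proof -
  have "(\<Sum>k<n. q ^ k) = (1 - q ^ n) / (1 - q)" using assms by (simp add: sum_gp_strict)
  also have "\<dots> \<le> 1 / (1 - q)" using assms by (intro divide_right_mono) auto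
  finally show ?thesis .
qed

lemma r_linear_sum_le:
  fixes h :: "nat \<Rightarrow> real"
  assumes "r_linear h" "\<And>n. 0 \<le> h n"
  shows "\<exists>K>0. \<forall>n m. (\<Sum>j=n..m. h j) \<le> K * h n"
proof -
  obtain q C where q: "0 < q" "q < 1" "C > 0" "\<And>n m. n \<le> m \<Longrightarrow> h m \<le> C * q ^ (m - n) * h n"
    using assms(1) unfolding r_linear_def by blast
  have "(\<Sum>j=n..m. h j) \<le> C / (1 - q) * h n" for n m
  proof -
    have "(\<Sum>j=n..m. h j) \<le> (\<Sum>j=n..m. C * h n * q ^ (j - n))"
      using q(4) by (intro sum_mono) (auto simp: mult_ac)
    also have "\<dots> = C * h n * (\<Sum>j=n..m. q ^ (j - n))" by (simp add: sum_distrib_left)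
    also have "(\<Sum>j=n..m. q ^ (j - n)) = (\<Sum>k<Suc m - n. q ^ k)"
      by (rule sum.reindex_bij_witness[of _ "\<lambda>k. k + n" "\<lambda>j. j - n"]) auto
    also have "C * h n * \<dots> \<le> C * h n * (1 / (1 - q))"
      using q assms(2) by (intro mult_left_mono geometric_partial_sum_le) auto
    finally show ?thesis by simp
  qed
  moreover have "C / (1 - q) > 0" using q by simp
  ultimately show ?thesis by blast
qed

text \<open>The bound on single perturbations makes \<open>a\<close> quasi-monotone. Convexity turns the contraction into
  one for squares, and summation moves \<open>q\<close> times the sum of the \<open>a\<^sub>j\<^sup>2\<close> to the left-hand side, so the sums of
  \<open>a\<^sub>j\<^sup>2\<close> inherit the sublinear growth of the sums of \<open>b\<^sub>j\<^sup>2\<close>.\<close>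

lemma perturbed_contraction_r_linear:
  fixes a b :: "nat \<Rightarrow> real"
  assumes nn: "\<And>n. 0 \<le> a n" "\<And>n. 0 \<le> b n"
    and q: "0 < q" "q < 1" and step: "\<And>n. a (Suc n) \<le> q * a n + b n"
    and B: "B > 0" "\<And>n m. n \<le> m \<Longrightarrow> b m \<le> B * a n"
    and D: "D > 0" "\<And>n N. (\<Sum>j=n..n+N. (b j)\<^sup>2) \<le> D * real (N + 1) powr (1 - \<delta>) * (a n)\<^sup>2"
    and \<delta>: "0 < \<delta>" "\<delta> \<le> 1"
  shows "r_linear a"
proof -
  \<comment> \<open>The bound \<open>a m \<le> C a n\<close> propagates from \<open>m\<close> to \<open>m + 1\<close> because \<open>q C + B \<le> C\<close>.\<close>
  define C where "C = 1 + B / (1 - q)"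
  have C: "C \<ge> 1" "q * C + B = q + B / (1 - q)" "q + B / (1 - q) \<le> C"
  proof -
    show "C \<ge> 1" using q B(1) by (simp add: C_def)
    define W where "W = B / (1 - q)"
    have "B = (1 - q) * W" using q by (simp add: W_def)
    hence "q * (1 + W) + B = q + W" by (simp only: algebra_simps)
    thus "q * C + B = q + B / (1 - q)" by (simp add: C_def W_def)
    show "q + B / (1 - q) \<le> C" using q by (simp add: C_def)
  qed
  have mono: "a m \<le> C * a n" if "n \<le> m" for n m
    using that
  proof (induction m rule: dec_induct)
    case base
    show ?case using mult_right_mono[OF C(1) nn(1)[of n]] by simp
  next
    case (step m)
    have "a (Suc m) \<le> q * (C * a n) + B * a n"
      using assms(5)[of m] mult_left_mono[OF step.IH, of q] B(2)[OF step(1)] q by linarith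
    also have "\<dots> = (q * C + B) * a n" by (simp add: algebra_simps)
    also have "\<dots> \<le> C * a n" using C nn(1) by (intro mult_right_mono) auto
    finally show ?case .
  qed
  have convex: "(a (Suc n))\<^sup>2 \<le> q * (a n)\<^sup>2 + (b n)\<^sup>2 / (1 - q)" for n
  proof -
    define y where "y = b n / (1 - q)"
    have y: "b n = (1 - q) * y" using q by (simp add: y_def)
    have "(a (Suc n))\<^sup>2 \<le> (q * a n + b n)\<^sup>2" using step nn by (intro power_mono) auto
    also have "\<dots> = q * (a n)\<^sup>2 + (1 - q) * y\<^sup>2 - q * (1 - q) * (a n - y)\<^sup>2"
      by (simp add: y algebra_simps power2_eq_square)
    also have "\<dots> \<le> q * (a n)\<^sup>2 + (1 - q) * y\<^sup>2" using q by simp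
    also have "(1 - q) * y\<^sup>2 = (b n)\<^sup>2 / (1 - q)"
      using q by (simp add: y power_mult_distrib power2_eq_square)
    finally show ?thesis .
  qed
  define K where "K = (1 + D / (1 - q)) / (1 - q)"
  have "r_linear (\<lambda>n. (a n)\<^sup>2)"
  proof (rule r_linear_by_sublinear_sums[where C = "C\<^sup>2" and K = K and \<delta> = \<delta>])
    show "(a m)\<^sup>2 \<le> C\<^sup>2 * (a n)\<^sup>2" if "n \<le> m" for n m
      using power_mono[OF mono[OF that] nn(1), of 2] by (simp add: power_mult_distrib)
    show "(\<Sum>j=n..n+N. (a j)\<^sup>2) \<le> K * real (N + 1) powr (1 - \<delta>) * (a n)\<^sup>2" for n N
    proof -
      define S where "S = (\<Sum>j=n..n+N. (a j)\<^sup>2)"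
      have ge1: "1 \<le> real (N + 1) powr (1 - \<delta>)" using \<delta> by (intro ge_one_powr_ge_zero) auto
      have "S = (a n)\<^sup>2 + (\<Sum>j=Suc n..n+N. (a j)\<^sup>2)"
        unfolding S_def by (subst sum.atLeast_Suc_atMost) auto
      also have "(\<Sum>j=Suc n..n+N. (a j)\<^sup>2) \<le> (\<Sum>j=Suc n..Suc (n+N). (a j)\<^sup>2)"
        by (intro sum_mono2) auto
      also have "\<dots> = (\<Sum>j=n..n+N. (a (Suc j))\<^sup>2)" by (rule sum.shift_bounds_cl_Suc_ivl)
      also have "\<dots> \<le> (\<Sum>j=n..n+N. q * (a j)\<^sup>2 + (b j)\<^sup>2 / (1 - q))" by (intro sum_mono convex)
      also have "\<dots> = q * S + (\<Sum>j=n..n+N. (b j)\<^sup>2) / (1 - q)"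
        by (simp add: sum.distrib sum_distrib_left sum_divide_distrib S_def)
      also have "\<dots> \<le> q * S + D * real (N + 1) powr (1 - \<delta>) * (a n)\<^sup>2 / (1 - q)"
        using D(2) q by (intro add_left_mono divide_right_mono) auto
      finally have "(1 - q) * S \<le> 1 * (a n)\<^sup>2 + D * real (N + 1) powr (1 - \<delta>) * (a n)\<^sup>2 / (1 - q)"
        by (simp add: algebra_simps)
      also have "\<dots> \<le> real (N + 1) powr (1 - \<delta>) * (a n)\<^sup>2 + D * real (N + 1) powr (1 - \<delta>) * (a n)\<^sup>2 / (1 - q)"
        using ge1 by (intro add_right_mono mult_right_mono) auto
      also have "\<dots> = (1 - q) * (K * real (N + 1) powr (1 - \<delta>) * (a n)\<^sup>2)"
      proof -
        have "(1 - q) * K = 1 + D / (1 - q)" using q by (simp add: K_def)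
        thus ?thesis by (simp add: mult.assoc[symmetric]) (simp add: distrib_right)
      qed
      finally show ?thesis unfolding S_def[symmetric] using q by simp
    qed
    show "C\<^sup>2 > 0" "K > 0" using C(1) D(1) q by (auto simp: K_def intro!: divide_pos_pos add_pos_pos)
  qed (use \<delta> in auto)
  then obtain r E where r: "0 < r" "r < 1" "E > 0" "\<And>n m. n \<le> m \<Longrightarrow> (a m)\<^sup>2 \<le> E * r ^ (m - n) * (a n)\<^sup>2"
    unfolding r_linear_def by blast
  have "a m \<le> sqrt E * sqrt r ^ (m - n) * a n" if "n \<le> m" for n m
    using real_sqrt_le_mono[OF r(4)[OF that]] nn(1)
    by (simp add: real_sqrt_mult real_sqrt_power)
  thus ?thesis
    unfolding r_linear_def using r by (intro exI[of _ "sqrt r"] exI[of _ "sqrt E"]) auto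
qed

section \<open>The order of computation\<close>

text \<open>The order in which iterates are computed depends only on the predicate \<open>st\<close>, where \<open>st l k\<close> says
  that the solver loop on level \<open>l\<close> stops with iterate \<open>k\<close>.\<close>

definition reached :: "(nat \<Rightarrow> nat \<Rightarrow> bool) \<Rightarrow> nat \<Rightarrow> bool" where
  "reached st l \<longleftrightarrow> (\<forall>l'<l. \<exists>k. st l' k)"

definition run_index :: "(nat \<Rightarrow> nat \<Rightarrow> bool) \<Rightarrow> (nat \<times> nat) set" where
  "run_index st = {(l, k). reached st l \<and> (\<forall>k'<k. \<not> st l k')}"

definition final_index :: "(nat \<Rightarrow> nat \<Rightarrow> bool) \<Rightarrow> nat \<Rightarrow> nat" where
  "final_index st l = (LEAST k. st l k)"

definition before :: "nat \<times> nat \<Rightarrow> nat \<times> nat \<Rightarrow> bool" where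
  "before x y \<longleftrightarrow> fst x < fst y \<or> (fst x = fst y \<and> snd x \<le> snd y)"

definition counter :: "(nat \<Rightarrow> nat \<Rightarrow> bool) \<Rightarrow> nat \<times> nat \<Rightarrow> nat" where
  "counter st y = card {x \<in> run_index st. before x y}"

lemma before_refl: "before x x" by (simp add: before_def)
lemma before_linear: "before x y \<or> before y x" by (auto simp: before_def)
lemma before_antisym: "before x y \<Longrightarrow> before y x \<Longrightarrow> x = y" by (auto simp: before_def prod_eq_iff)
lemma before_trans: "before x y \<Longrightarrow> before y z \<Longrightarrow> before x z" by (auto simp: before_def)

lemma reached_mono: "reached st l \<Longrightarrow> l' \<le> l \<Longrightarrow> reached st l'"
  by (simp add: reached_def)

lemma reached_Suc: "reached st (Suc l) \<longleftrightarrow> reached st l \<and> (\<exists>k. st l k)"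
  by (auto simp: reached_def less_Suc_eq)

lemma run_index_mono: "(l, k) \<in> run_index st \<Longrightarrow> k' \<le> k \<Longrightarrow> (l, k') \<in> run_index st"
  by (auto simp: run_index_def)

lemma run_index_0: "(l, 0) \<in> run_index st \<longleftrightarrow> reached st l"
  by (simp add: run_index_def)

lemma run_index_reached: "(l, k) \<in> run_index st \<Longrightarrow> reached st l"
  by (simp add: run_index_def)

lemma final_index_props:
  assumes "reached st (Suc l)"
  shows "st l (final_index st l)" "(l, final_index st l) \<in> run_index st"
proof -
  obtain k where "st l k" using assms by (auto simp: reached_Suc)
  thus "st l (final_index st l)" unfolding final_index_def by (rule LeastI)
  show "(l, final_index st l) \<in> run_index st"
    using assms unfolding run_index_def final_index_def
    by (auto simp: reached_Suc dest: not_less_Least)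
qed

lemma run_index_le_final:
  assumes "(l, k) \<in> run_index st" "reached st (Suc l)"
  shows "k \<le> final_index st l"
  using final_index_props(1)[OF assms(2)] assms(1) by (auto simp: run_index_def not_less[symmetric])

lemma finite_run_index_before:
  assumes "y \<in> run_index st"
  shows "finite {x \<in> run_index st. before x y}"
proof -
  obtain l k where y: "y = (l, k)" by (cases y)
  have l: "reached st l" using assms y by (simp add: run_index_reached)
  have "{x \<in> run_index st. before x y} \<subseteq> (SIGMA i:{..l}. {..max k (final_index st i)})"
  proof
    fix x assume x: "x \<in> {x \<in> run_index st. before x y}"
    obtain i j where ij: "x = (i, j)" by (cases x)
    show "x \<in> (SIGMA i:{..l}. {..max k (final_index st i)})"
    proof (cases "i < l")
      case True
      hence "reached st (Suc i)" using l by (auto intro: reached_mono)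
      from run_index_le_final[OF _ this] x ij True show ?thesis by fastforce
    next
      case False
      thus ?thesis using x ij y by (auto simp: before_def)
    qed
  qed
  thus ?thesis by (rule finite_subset) auto
qed

lemma counter_le_iff:
  assumes x: "x \<in> run_index st" and y: "y \<in> run_index st"
  shows "counter st x \<le> counter st y \<longleftrightarrow> before x y"
proof
  assume "before x y"
  thus "counter st x \<le> counter st y"
    unfolding counter_def
    by (intro card_mono finite_run_index_before[OF y]) (auto intro: before_trans)
next
  assume le: "counter st x \<le> counter st y"
  show "before x y"
  proof (rule ccontr)
    assume nb: "\<not> before x y"
    hence "before y x" using before_linear by blast
    hence "{z \<in> run_index st. before z y} \<subset> {z \<in> run_index st. before z x}"
      using nb x by (auto intro: before_trans before_refl)
    hence "counter st y < counter st x"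
      unfolding counter_def by (intro psubset_card_mono finite_run_index_before[OF x])
    with le show False by simp
  qed
qed

lemma counter_inj: "inj_on (counter st) (run_index st)"
  using counter_le_iff before_antisym by (intro inj_onI) (metis order_refl)

text \<open>The counter is injective on the predecessors of \<open>y\<close>, and there are exactly \<open>counter st y\<close> of them,
  so it leaves no gaps.\<close>

lemma counter_image:
  assumes "y \<in> run_index st"
  shows "counter st ` {x \<in> run_index st. before x y} = {1..counter st y}"
proof (rule card_subset_eq)
  let ?D = "{x \<in> run_index st. before x y}"
  show "counter st ` ?D \<subseteq> {1..counter st y}"
  proof
    fix n assume "n \<in> counter st ` ?D"
    then obtain x where x: "x \<in> run_index st" "before x y" "n = counter st x" by auto
    have "x \<in> {z \<in> run_index st. before z x}" using x before_refl by simp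
    hence "{z \<in> run_index st. before z x} \<noteq> {}" by blast
    hence "counter st x > 0"
      unfolding counter_def card_gt_0_iff using finite_run_index_before[OF x(1)] by blast
    thus "n \<in> {1..counter st y}" using x counter_le_iff[OF x(1) assms] by auto
  qed
  have "inj_on (counter st) ?D" using counter_inj by (rule inj_on_subset) auto
  thus "card (counter st ` ?D) = card {1..counter st y}"
    by (simp add: card_image) (simp add: counter_def)
qed simp

text \<open>Enumerated by the counter, the values of \<open>H\<close> form a sequence with uniformly bounded tail sums,
  which is in particular quasi-monotone.\<close>

lemma r_linear_along_run:
  fixes H :: "nat \<times> nat \<Rightarrow> real"
  assumes nn: "\<And>x. x \<in> run_index st \<Longrightarrow> 0 \<le> H x"
    and K: "K > 0" "\<And>x y. x \<in> run_index st \<Longrightarrow> y \<in> run_index st \<Longrightarrow>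
       (\<Sum>z | z \<in> run_index st \<and> before x z \<and> before z y. H z) \<le> K * H x"
  shows "\<exists>q C. 0 < q \<and> q < 1 \<and> C > 0 \<and> (\<forall>x\<in>run_index st. \<forall>y\<in>run_index st.
    counter st x \<le> counter st y \<longrightarrow> H y \<le> C * q ^ (counter st y - counter st x) * H x)"
proof -
  define Q where "Q = run_index st"
  \<comment> \<open>The counter starts at 1, the sequence at 0. The sum has at most one term, and it gives 0
    at positions that the counter does not attain.\<close>
  define h where "h n = (\<Sum>z | z \<in> Q \<and> counter st z = Suc n. H z)" for n
  have hx: "h n = H x" if "x \<in> Q" "counter st x = Suc n" for x n
  proof -
    have "{z. z \<in> Q \<and> counter st z = Suc n} = {x}"
      using that counter_inj[of st] by (auto simp: inj_on_def Q_def)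
    thus ?thesis by (simp add: h_def)
  qed
  have h0: "h n = 0" if "\<And>x. x \<in> Q \<Longrightarrow> counter st x \<noteq> Suc n" for n
    unfolding h_def using that by (intro sum.neutral) auto
  have hnn: "0 \<le> h n" for n unfolding h_def by (intro sum_nonneg) (auto simp: Q_def nn)
  have sums: "(\<Sum>j=n..n+N. h j) \<le> K * h n" for n N
  proof -
    define Z where "Z = {z \<in> Q. counter st z \<in> {Suc n..Suc (n + N)}}"
    have inj: "inj_on (counter st) Z"
      using counter_inj by (rule inj_on_subset) (auto simp: Z_def Q_def)
    have "finite (counter st ` Z)" by (rule finite_subset[of _ "{Suc n..Suc (n + N)}"]) (auto simp: Z_def)
    hence fin: "finite Z" using inj by (rule finite_imageD)
    have "(\<Sum>j=n..n+N. h j) = (\<Sum>j\<in>{n..n+N}. \<Sum>z | z \<in> Z \<and> counter st z - 1 = j. H z)"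
      unfolding h_def
    proof (intro sum.cong refl)
      fix j assume "j \<in> {n..n+N}"
      thus "{z. z \<in> Q \<and> counter st z = Suc j} = {z. z \<in> Z \<and> counter st z - 1 = j}"
        by (auto simp: Z_def)
    qed
    also have "\<dots> = (\<Sum>z\<in>Z. H z)"
      by (intro sum.group fin) (auto simp: Z_def)
    finally have eq: "(\<Sum>j=n..n+N. h j) = (\<Sum>z\<in>Z. H z)" .
    show ?thesis
    proof (cases "Z = {}")
      case True
      thus ?thesis using eq hnn K(1) by simp
    next
      case False
      define M where "M = Max (counter st ` Z)"
      have "M \<in> counter st ` Z" unfolding M_def using False fin by (intro Max_in) auto
      then obtain y where y: "y \<in> Z" "counter st y = M" by auto
      have yQ: "y \<in> Q" using y by (simp add: Z_def)
      have "Suc n \<in> {1..counter st y}" using y(1) by (auto simp: Z_def)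
      then obtain x where x: "x \<in> Q" "counter st x = Suc n"
        using counter_image[of y st] yQ unfolding Q_def by (metis (no_types, lifting) imageE mem_Collect_eq)
      have sub: "Z \<subseteq> {z. z \<in> Q \<and> before x z \<and> before z y}"
      proof
        fix z assume z: "z \<in> Z"
        have "counter st z \<le> counter st y" unfolding y(2) M_def using z fin by (intro Max_ge) auto
        moreover have "counter st x \<le> counter st z" using z x(2) by (simp add: Z_def)
        moreover have "z \<in> Q" using z by (simp add: Z_def)
        ultimately show "z \<in> {z. z \<in> Q \<and> before x z \<and> before z y}"
          using x(1) yQ by (auto simp: Q_def counter_le_iff)
      qed
      have "(\<Sum>z\<in>Z. H z) \<le> (\<Sum>z | z \<in> Q \<and> before x z \<and> before z y. H z)"
      proof (rule sum_mono2[OF _ sub])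
        show "finite {z. z \<in> Q \<and> before x z \<and> before z y}"
          unfolding Q_def
          by (rule finite_subset[OF _ finite_run_index_before[OF yQ[unfolded Q_def]]]) auto
      qed (auto simp: Q_def nn)
      also have "\<dots> \<le> K * H x" using K(2) x(1) yQ unfolding Q_def by blast
      finally show ?thesis using eq hx[OF x] by simp
    qed
  qed
  have mono: "h m \<le> K * h n" if "n \<le> m" for n m
  proof -
    have "h m \<le> (\<Sum>j=n..n+(m-n). h j)" using that hnn by (intro member_le_sum) auto
    with sums[of n "m - n"] show ?thesis by simp
  qed
  have "real (N + 1) powr (1 - 1) = 1" for N by (simp del: of_nat_add)
  hence "(\<Sum>j=n..n+N. h j) \<le> K * real (N + 1) powr (1 - 1) * h n" for n N
    using sums by simp
  from r_linear_by_sublinear_sums[OF hnn K(1) mono K(1) this zero_less_one]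
  have "r_linear h" .
  then obtain q C where qC: "0 < q" "q < 1" "C > 0" "\<And>n m. n \<le> m \<Longrightarrow> h m \<le> C * q ^ (m - n) * h n"
    unfolding r_linear_def by blast
  have "H y \<le> C * q ^ (counter st y - counter st x) * H x"
    if "x \<in> Q" "y \<in> Q" "counter st x \<le> counter st y" for x y
  proof -
    have "counter st z \<in> {1..counter st z}" if "z \<in> Q" for z
      using counter_image[of z st] that before_refl[of z] unfolding Q_def by blast
    hence "counter st x \<ge> 1" "counter st y \<ge> 1" using that by auto
    then obtain n m where nm: "counter st x = Suc n" "counter st y = Suc m"
      by (metis One_nat_def Suc_le_D)
    show ?thesis using qC(4)[of n m] hx[OF that(1) nm(1)] hx[OF that(2) nm(2)] nm that(3) by simp
  qed
  thus ?thesis using qC(1-3) unfolding Q_def by blast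
qed

section \<open>Recursive estimates along an adaptive run\<close>

text \<open>The numbers that control a run: \<open>e l k\<close> and \<open>\<eta> l k\<close> are the energy error and the estimator of
  iterate \<open>k\<close> on level \<open>l\<close>, \<open>m l\<close> is the estimator of the exact discrete solution, and \<open>b l\<close> is the energy
  norm of the increment of the exact discrete solutions from level \<open>l\<close> to \<open>l + 1\<close>. The loop never stops
  before its first step. The inequalities express, in this order, contraction of the solver, failure
  of the stopping test with \<open>L = 1/\<lambda>\<close>, stability, the transition to the next mesh, stability with
  respect to the exact discrete solution, quasi-monotonicity together with reliability, and
  quasi-orthogonality together with reliability.\<close>

locale adaptive_run =
  fixes st :: "nat \<Rightarrow> nat \<Rightarrow> bool"
    and e \<eta> :: "nat \<Rightarrow> nat \<Rightarrow> real"
    and m b :: "nat \<Rightarrow> real"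
    and q q\<theta> L Cs B D \<delta> :: real
  assumes not_stopped_0: "\<not> st l 0"
    and e_nonneg: "0 \<le> e l k" and \<eta>_nonneg: "0 \<le> \<eta> l k" and m_nonneg: "0 \<le> m l" and b_nonneg: "0 \<le> b l"
    and bounds: "0 < q" "q < 1" "0 < q\<theta>" "q\<theta> < 1" "0 < L" "0 < Cs" "0 < B" "0 < D" "0 < \<delta>" "\<delta> \<le> 1"
    and contraction: "(l, Suc k) \<in> run_index st \<Longrightarrow> e l (Suc k) \<le> q * e l k"
    and continued: "(l, Suc k) \<in> run_index st \<Longrightarrow> \<not> st l (Suc k) \<Longrightarrow>
      \<eta> l (Suc k) \<le> L * (e l (Suc k) + e l k)"
    and stable: "(l, k) \<in> run_index st \<Longrightarrow> (l, k') \<in> run_index st \<Longrightarrow>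
      \<eta> l k' \<le> \<eta> l k + Cs * (e l k' + e l k)"
    and next_error: "reached st (Suc l) \<Longrightarrow> e (Suc l) 0 \<le> e l (final_index st l) + b l"
    and next_estimator: "reached st (Suc l) \<Longrightarrow> \<eta> (Suc l) 0 \<le> q\<theta> * \<eta> l (final_index st l)"
    and exact_estimator: "(l, k) \<in> run_index st \<Longrightarrow> m l \<le> \<eta> l k + Cs * e l k"
    and increment: "reached st n \<Longrightarrow> n \<le> l \<Longrightarrow> b l \<le> B * m n"
    and increment_sums: "reached st n \<Longrightarrow>
      (\<Sum>j=n..n+N. (b j)\<^sup>2) \<le> D * real (N + 1) powr (1 - \<delta>) * (m n)\<^sup>2"
begin

definition quasi :: "nat \<Rightarrow> nat \<Rightarrow> real" where
  "quasi l k = e l k + \<eta> l k"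

lemma quasi_nonneg: "0 \<le> quasi l k"
  by (simp add: quasi_def e_nonneg \<eta>_nonneg)

lemma e_geometric:
  assumes "(l, k) \<in> run_index st" "k' \<le> k"
  shows "e l k \<le> q ^ (k - k') * e l k'"
  using assms(2,1)
proof (induction k rule: dec_induct)
  case (step k)
  have "e l (Suc k) \<le> q * e l k" using step.prems by (rule contraction)
  also have "\<dots> \<le> q * (q ^ (k - k') * e l k')"
    using step.IH[OF run_index_mono[OF step.prems]] bounds by (intro mult_left_mono) auto
  finally show ?case using step(1) by (simp add: Suc_diff_le)
qed simp

text \<open>The factor \<open>(1 + 2 L) / q\<close> is the cost of bounding the estimator by the algebraic error of the
  previous iterate while the loop continues, the factor \<open>(1 + 2 Cs) / q\<close> that of the stopping step.\<close>

definition "C_level = (1 + 2 * Cs) * (1 + 2 * L) / q\<^sup>2"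

lemma C_level_pos: "C_level > 0"
  unfolding C_level_def using bounds by (intro divide_pos_pos mult_pos_pos) auto

text \<open>While the loop continues, the quasi-error is dominated by the contracting algebraic error of the
  previous iterate. The stopping iterate is compared with its predecessor by stability instead.\<close>

lemma quasi_level:
  assumes k: "(l, k) \<in> run_index st" and le: "k' \<le> k"
  shows "quasi l k \<le> C_level * q ^ (k - k') * quasi l k'"
proof -
  define C1 where "C1 = (1 + 2 * L) / q"
  have C1: "C1 \<ge> 1" "C1 > 0" using bounds by (auto simp: C1_def field_simps)
  have e_le: "e l j \<le> e l i" if "(l, j) \<in> run_index st" "i \<le> j" for i j
    using e_geometric[OF that] power_le_one[of q "j - i"] bounds
      mult_right_mono[of "q ^ (j - i)" 1 "e l i"] e_nonneg[of l i] by fastforce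
  have run: "quasi l j \<le> C1 * q ^ (j - k') * quasi l k'"
    if j: "(l, j) \<in> run_index st" "\<not> st l j \<or> j = k'" "k' \<le> j" for j
  proof (cases "j = k'")
    case True
    thus ?thesis using C1 mult_right_mono[OF C1(1) quasi_nonneg[of l k']] by simp
  next
    case False
    then obtain i where i: "j = Suc i" "k' \<le> i" using j(3) by (cases j) auto
    have "\<eta> l j \<le> L * (e l j + e l i)" using continued[of l i] j False i by auto
    also have "\<dots> \<le> L * (e l i + e l i)"
      using e_le[of j i] j(1) i bounds by (intro mult_left_mono add_right_mono) auto
    finally have "quasi l j \<le> (1 + 2 * L) * e l i"
      using e_le[of j i] j(1) i by (simp add: quasi_def algebra_simps)
    also have "\<dots> \<le> (1 + 2 * L) * (q ^ (i - k') * e l k')"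
      using e_geometric[of l i k'] run_index_mono[OF j(1), of i] i bounds by (intro mult_left_mono) auto
    also have "\<dots> \<le> (1 + 2 * L) * (q ^ (i - k') * quasi l k')"
      using bounds \<eta>_nonneg by (intro mult_left_mono) (auto simp: quasi_def)
    also have "\<dots> = C1 * q ^ (j - k') * quasi l k'"
      using bounds i by (simp add: C1_def Suc_diff_le)
    finally show ?thesis .
  qed
  have C_ge: "C1 \<le> C_level" "(1 + 2 * Cs) * C1 = C_level * q"
  proof -
    show eq: "(1 + 2 * Cs) * C1 = C_level * q"
      using bounds by (simp add: C_level_def C1_def power2_eq_square)
    have "C1 \<le> (1 + 2 * Cs) * C1" using C1 bounds by simp
    also have "\<dots> \<le> C_level * 1" unfolding eq using bounds C_level_pos by (intro mult_left_mono) auto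
    finally show "C1 \<le> C_level" by simp
  qed
  show ?thesis
  proof (cases "\<not> st l k \<or> k = k'")
    case True
    have "C1 * (q ^ (k - k') * quasi l k') \<le> C_level * (q ^ (k - k') * quasi l k')"
      using C_ge(1) bounds quasi_nonneg by (intro mult_right_mono mult_nonneg_nonneg) auto
    with run[OF k True le] show ?thesis by (simp add: mult.assoc)
  next
    case False
    then obtain j where j: "k = Suc j" "k' \<le> j" using le by (cases k) auto
    have jQ: "(l, j) \<in> run_index st" "\<not> st l j"
      using k j by (auto simp: run_index_def)
    have "\<eta> l k \<le> \<eta> l j + Cs * (e l k + e l j)" by (rule stable[OF jQ(1) k])
    also have "\<dots> \<le> \<eta> l j + Cs * (e l j + e l j)"
      using e_le[OF k, of j] j bounds by (intro add_left_mono mult_left_mono add_right_mono) auto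
    finally have "quasi l k \<le> \<eta> l j + (1 + 2 * Cs) * e l j"
      using e_le[OF k, of j] j by (simp add: quasi_def algebra_simps)
    also have "\<dots> \<le> (1 + 2 * Cs) * quasi l j"
      using bounds \<eta>_nonneg[of l j] by (simp add: quasi_def distrib_left distrib_right)
    also have "\<dots> \<le> (1 + 2 * Cs) * (C1 * q ^ (j - k') * quasi l k')"
      using run[of j] jQ j bounds by (intro mult_left_mono) auto
    also have "\<dots> = (1 + 2 * Cs) * C1 * (q ^ (j - k') * quasi l k')" by (simp add: mult_ac)
    also have "\<dots> = C_level * q ^ (k - k') * quasi l k'"
      unfolding C_ge(2) using j by (simp add: Suc_diff_le mult_ac)
    finally show ?thesis .
  qed
qed

text \<open>The change of the exact discrete solution need not be small compared with the current quasi-error,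
  but it is bounded by a multiple of it.\<close>

lemma quasi_next:
  assumes "reached st (Suc l)"
  shows "quasi (Suc l) 0 \<le> (1 + B * (1 + Cs)) * quasi l (final_index st l)"
proof -
  let ?f = "final_index st l"
  have r: "reached st l" using assms by (rule reached_mono) simp
  have "b l \<le> B * m l" by (rule increment[OF r]) simp
  also have "\<dots> \<le> B * (\<eta> l ?f + Cs * e l ?f)"
    using exact_estimator[OF final_index_props(2)[OF assms]] bounds by (intro mult_left_mono) auto
  also have "\<dots> \<le> B * ((1 + Cs) * quasi l ?f)"
    using bounds e_nonneg[of l ?f] \<eta>_nonneg[of l ?f]
    by (intro mult_left_mono) (auto simp: quasi_def algebra_simps)
  finally have b: "b l \<le> B * (1 + Cs) * quasi l ?f" by (simp add: mult.assoc)
  have "q\<theta> * \<eta> l ?f \<le> \<eta> l ?f" using bounds \<eta>_nonneg[of l ?f] by (intro mult_left_le_one_le) auto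
  hence "quasi (Suc l) 0 \<le> quasi l ?f + b l"
    using next_error[OF assms] next_estimator[OF assms] by (simp add: quasi_def)
  with b show ?thesis by (simp add: distrib_right)
qed

text \<open>The weight of the estimator is small enough that the algebraic error that stability feeds into
  the weighted estimator, at most \<open>2 Cs \<gamma> = (1 - q) / 2\<close> times the error at the start of the loop, keeps the
  total factor \<open>q + (1 - q) / 2\<close> below one. Setting the value to zero on levels that the run does not
  complete extends a run with finitely many levels
  to an infinite sequence without affecting the recursion.\<close>

lemma level_errors_r_linear:
  "r_linear (\<lambda>l. if reached st (Suc l)
     then e l (final_index st l) + (1 - q) / (4 * Cs) * \<eta> l (final_index st l) else 0)"
proof -
  define \<gamma> where "\<gamma> = (1 - q) / (4 * Cs)"
  have \<gamma>: "\<gamma> > 0" "Cs * \<gamma> = (1 - q) / 4" using bounds by (auto simp: \<gamma>_def)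
  let ?f = "final_index st"
  define a where "a l = (if reached st (Suc l) then e l (?f l) + \<gamma> * \<eta> l (?f l) else 0)" for l
  define b' where "b' l = (if reached st (Suc l) then b l else 0)" for l
  define Cm where "Cm = Cs + 1 / \<gamma>"
  have Cm: "Cm > 0" using bounds \<gamma>(1) by (simp add: Cm_def add_pos_pos)
  have m_le: "m l \<le> Cm * a l" if r: "reached st (Suc l)" for l
  proof -
    have "Cm * a l = Cs * e l (?f l) + \<eta> l (?f l) + (Cs * \<gamma> * \<eta> l (?f l) + e l (?f l) / \<gamma>)"
      using r \<gamma>(1) by (simp add: a_def Cm_def distrib_left distrib_right)
    moreover have "0 \<le> Cs * \<gamma> * \<eta> l (?f l) + e l (?f l) / \<gamma>"
      using bounds \<gamma>(1) e_nonneg \<eta>_nonneg by (intro add_nonneg_nonneg mult_nonneg_nonneg divide_nonneg_nonneg) auto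
    ultimately show ?thesis using exact_estimator[OF final_index_props(2)[OF r]] by linarith
  qed
  have a_nonneg: "0 \<le> a l" for l
    using e_nonneg \<eta>_nonneg \<gamma>(1) by (simp add: a_def)
  define q1 where "q1 = (1 + q) / 2"
  have q1: "0 < q1" "q1 < 1" using bounds by (auto simp: q1_def)
  define \<rho> where "\<rho> = max q1 q\<theta>"
  have \<rho>: "0 < \<rho>" "\<rho> < 1" "q1 \<le> \<rho>" "q\<theta> \<le> \<rho>" using q1 bounds by (auto simp: \<rho>_def)
  have step: "a (Suc l) \<le> \<rho> * a l + b' l" for l
  proof (cases "reached st (Suc (Suc l))")
    case False
    thus ?thesis using a_nonneg[of l] \<rho>(1) b_nonneg[of l] by (simp add: a_def[of "Suc l"] b'_def)
  next
    case True
    hence r: "reached st (Suc l)" by (rule reached_mono) simp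
    let ?k = "?f (Suc l)"
    note kQ = final_index_props(2)[OF True]
    have "?k \<noteq> 0" using final_index_props(1)[OF True] not_stopped_0 by metis
    hence "q ^ ?k \<le> q ^ 1" using bounds by (intro power_decreasing) auto
    hence e1: "e (Suc l) ?k \<le> q * e (Suc l) 0"
      using e_geometric[OF kQ, of 0] mult_right_mono[of "q ^ ?k" q "e (Suc l) 0"] e_nonneg[of "Suc l" 0] by simp
    have e2: "e (Suc l) ?k + e (Suc l) 0 \<le> 2 * e (Suc l) 0"
      using e1 mult_right_mono[of q 1 "e (Suc l) 0"] bounds e_nonneg[of "Suc l" 0] by simp
    have "\<eta> (Suc l) ?k \<le> \<eta> (Suc l) 0 + Cs * (e (Suc l) ?k + e (Suc l) 0)"
      by (rule stable[OF run_index_mono[OF kQ] kQ]) simp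
    also have "\<dots> \<le> q\<theta> * \<eta> l (?f l) + Cs * (2 * e (Suc l) 0)"
      using next_estimator[OF r] e2 bounds by (intro add_mono mult_left_mono) auto
    finally have "\<gamma> * \<eta> (Suc l) ?k \<le> \<gamma> * (q\<theta> * \<eta> l (?f l) + Cs * (2 * e (Suc l) 0))"
      using \<gamma>(1) by (intro mult_left_mono) auto
    also have "\<dots> = q\<theta> * (\<gamma> * \<eta> l (?f l)) + 2 * (Cs * \<gamma>) * e (Suc l) 0" by (simp add: algebra_simps)
    also have "2 * (Cs * \<gamma>) = (1 - q) / 2" by (simp add: \<gamma>(2))
    finally have "a (Suc l) \<le> q1 * e (Suc l) 0 + q\<theta> * (\<gamma> * \<eta> l (?f l))"
      using e1 True by (simp add: a_def q1_def field_simps)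
    also have "\<dots> \<le> q1 * (e l (?f l) + b l) + q\<theta> * (\<gamma> * \<eta> l (?f l))"
      using next_error[OF r] q1 by (intro add_right_mono mult_left_mono) auto
    also have "\<dots> = q1 * e l (?f l) + q1 * b l + q\<theta> * (\<gamma> * \<eta> l (?f l))" by (simp add: distrib_left)
    also have "\<dots> \<le> \<rho> * e l (?f l) + 1 * b l + \<rho> * (\<gamma> * \<eta> l (?f l))"
      using \<rho> q1 e_nonneg b_nonneg \<eta>_nonneg \<gamma>(1)
      by (intro add_mono mult_right_mono mult_nonneg_nonneg) auto
    also have "\<dots> = \<rho> * a l + b' l" using r by (simp add: a_def b'_def distrib_left)
    finally show ?thesis .
  qed
  have "r_linear a"
  proof (rule perturbed_contraction_r_linear[where a = a and b = b' and q = \<rho> and B = "B * Cm"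
        and D = "D * Cm\<^sup>2" and \<delta> = \<delta>])
    show "b' l \<le> B * Cm * a n" if "n \<le> l" for n l
    proof (cases "reached st (Suc l)")
      case True
      hence r: "reached st (Suc n)" by (rule reached_mono) (use that in simp)
      hence "b' l \<le> B * m n" using True that by (auto simp: b'_def intro!: increment intro: reached_mono)
      also have "\<dots> \<le> B * (Cm * a n)" using m_le[OF r] bounds by (intro mult_left_mono) auto
      finally show ?thesis by (simp add: mult.assoc)
    next
      case False
      thus ?thesis using bounds Cm a_nonneg by (simp add: b'_def)
    qed
    show "(\<Sum>j=n..n+N. (b' j)\<^sup>2) \<le> D * Cm\<^sup>2 * real (N + 1) powr (1 - \<delta>) * (a n)\<^sup>2" for n N
    proof (cases "reached st (Suc n)")
      case True
      have r: "reached st n" using True by (rule reached_mono) simp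
      have "(\<Sum>j=n..n+N. (b' j)\<^sup>2) \<le> (\<Sum>j=n..n+N. (b j)\<^sup>2)"
        by (intro sum_mono) (simp add: b'_def)
      also have "\<dots> \<le> D * real (N + 1) powr (1 - \<delta>) * (m n)\<^sup>2" by (rule increment_sums[OF r])
      also have "\<dots> \<le> D * real (N + 1) powr (1 - \<delta>) * (Cm * a n)\<^sup>2"
        using m_le[OF True] m_nonneg bounds by (intro mult_left_mono power_mono) auto
      finally show ?thesis by (simp add: power_mult_distrib mult_ac)
    next
      case False
      hence "b' j = 0" if "j \<ge> n" for j
        using that reached_mono[of st "Suc j" "Suc n"] by (auto simp: b'_def)
      thus ?thesis using bounds by simp
    qed
  qed (use a_nonneg step \<rho> bounds Cm b_nonneg in \<open>auto simp: b'_def\<close>)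
  thus ?thesis unfolding a_def \<gamma>_def .
qed

lemma level_sums:
  "\<exists>K>0. \<forall>n l. reached st (Suc l) \<longrightarrow>
    (\<Sum>j=n..l. quasi j (final_index st j)) \<le> K * quasi n (final_index st n)"
proof -
  define \<gamma> where "\<gamma> = (1 - q) / (4 * Cs)"
  have \<gamma>: "\<gamma> > 0" using bounds by (simp add: \<gamma>_def)
  let ?f = "final_index st"
  define a where "a l = (if reached st (Suc l) then e l (?f l) + \<gamma> * \<eta> l (?f l) else 0)" for l
  have rl: "r_linear a" using level_errors_r_linear unfolding a_def \<gamma>_def .
  have a_nonneg: "0 \<le> a l" for l using e_nonneg \<eta>_nonneg \<gamma> by (simp add: a_def)
  obtain K where K: "K > 0" "\<And>n l. (\<Sum>j=n..l. a j) \<le> K * a n"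
    using r_linear_sum_le[OF rl a_nonneg] by blast
  have 1: "quasi j (?f j) \<le> (1 + 1 / \<gamma>) * a j" if "reached st (Suc j)" for j
  proof -
    have "(1 + 1 / \<gamma>) * a j = quasi j (?f j) + (e j (?f j) / \<gamma> + \<gamma> * \<eta> j (?f j))"
      using that \<gamma> by (simp add: a_def quasi_def distrib_left distrib_right)
    thus ?thesis using e_nonneg[of j "?f j"] \<eta>_nonneg[of j "?f j"] \<gamma> by simp
  qed
  have 2: "a j \<le> (1 + \<gamma>) * quasi j (?f j)" for j
    using e_nonneg[of j "?f j"] \<eta>_nonneg[of j "?f j"] \<gamma>
    by (simp add: a_def quasi_def distrib_left distrib_right)
  have "(\<Sum>j=n..l. quasi j (?f j)) \<le> (1 + 1 / \<gamma>) * K * (1 + \<gamma>) * quasi n (?f n)"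
    if r: "reached st (Suc l)" for n l
  proof -
    have "(\<Sum>j=n..l. quasi j (?f j)) \<le> (\<Sum>j=n..l. (1 + 1 / \<gamma>) * a j)"
      using r by (intro sum_mono 1) (auto intro: reached_mono)
    also have "\<dots> = (1 + 1 / \<gamma>) * (\<Sum>j=n..l. a j)" by (simp add: sum_distrib_left)
    also have "\<dots> \<le> (1 + 1 / \<gamma>) * (K * ((1 + \<gamma>) * quasi n (?f n)))"
      using order_trans[OF K(2)[of n l] mult_left_mono[OF 2[of n], of K]] K(1) \<gamma>
      by (intro mult_left_mono) auto
    finally show ?thesis by (simp add: mult.assoc)
  qed
  moreover have "(1 + 1 / \<gamma>) * K * (1 + \<gamma>) > 0" using K(1) \<gamma> by (simp add: add_pos_pos)
  ultimately show ?thesis by blast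
qed

lemma quasi_level_sum:
  assumes "finite J" "\<And>j. j \<in> J \<Longrightarrow> (l, j) \<in> run_index st \<and> k \<le> j"
  shows "(\<Sum>j\<in>J. quasi l j) \<le> C_level / (1 - q) * quasi l k"
proof -
  have "(\<Sum>j\<in>J. quasi l j) \<le> (\<Sum>j\<in>J. C_level * quasi l k * q ^ (j - k))"
    using assms quasi_level by (intro sum_mono) (auto simp: mult_ac)
  also have "\<dots> = C_level * quasi l k * (\<Sum>j\<in>J. q ^ (j - k))" by (simp add: sum_distrib_left)
  also have "(\<Sum>j\<in>J. q ^ (j - k)) = (\<Sum>i\<in>(\<lambda>j. j - k) ` J. q ^ i)"
    using assms(2) by (subst sum.reindex) (auto intro!: inj_onI simp: eq_diff_iff)
  also have "\<dots> \<le> (\<Sum>i<Suc (Max ((\<lambda>j. j - k) ` J)). q ^ i)"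
    using assms(1) bounds by (intro sum_mono2) (auto simp: less_Suc_eq_le)
  also have "\<dots> \<le> 1 / (1 - q)" using bounds by (intro geometric_partial_sum_le) auto
  finally show ?thesis using C_level_pos quasi_nonneg[of l k] by (simp add: mult_left_mono)
qed

text \<open>On each level the geometric decay bounds the sum by the value at the first index. Except for the
  level of \<open>x\<close>, this first value is bounded by the final value one level before, and the final values are
  summable.\<close>

lemma segment_sums:
  "\<exists>K>0. \<forall>x\<in>run_index st. \<forall>y\<in>run_index st.
    (\<Sum>z | z \<in> run_index st \<and> before x z \<and> before z y. case_prod quasi z) \<le> K * case_prod quasi x"
proof -
  let ?f = "final_index st"
  obtain K where K: "K > 0" "\<And>n l. reached st (Suc l) \<Longrightarrow> (\<Sum>j=n..l. quasi j (?f j)) \<le> K * quasi n (?f n)"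
    using level_sums by blast
  define G where "G = C_level / (1 - q)"
  have G: "G > 0" using C_level_pos bounds by (simp add: G_def)
  define E where "E = 1 + B * (1 + Cs)"
  have E: "E > 0" using bounds by (simp add: E_def add_pos_pos)
  define A where "A = G + G * E * K * C_level"
  have A: "A > 0" "G \<le> A" using G E K(1) C_level_pos by (auto simp: A_def add_pos_pos)
  have "(\<Sum>z | z \<in> run_index st \<and> before x z \<and> before z y. case_prod quasi z) \<le> A * case_prod quasi x"
    if x: "x \<in> run_index st" and y: "y \<in> run_index st" for x y
  proof -
    obtain l' k' where xl: "x = (l', k')" by (cases x)
    obtain l k where yl: "y = (l, k)" by (cases y)
    define S where "S = {z. z \<in> run_index st \<and> before x z \<and> before z y}"
    have finS: "finite S"
      using finite_run_index_before[OF y] unfolding S_def by (rule rev_finite_subset) auto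
    define J where "J i = {j. (i, j) \<in> S}" for i
    have finJ: "finite (J i)" for i
    proof -
      have "J i \<subseteq> snd ` S" unfolding J_def by force
      thus ?thesis using finS by (meson finite_imageI finite_subset)
    qed
    have "S = Sigma {l'..l} J"
      unfolding J_def by (auto simp: S_def xl yl before_def)
    hence "(\<Sum>z\<in>S. case_prod quasi z) = (\<Sum>i=l'..l. \<Sum>j\<in>J i. quasi i j)"
      using finJ by (simp add: sum.Sigma)
    also have "\<dots> \<le> A * quasi l' k'"
    proof (cases "l' < l")
      case False
      have "(\<Sum>i=l'..l. \<Sum>j\<in>J i. quasi i j) \<le> (\<Sum>i\<in>{l'}. \<Sum>j\<in>J i. quasi i j)"
        using False by (intro sum_mono2 sum_nonneg quasi_nonneg) auto
      also have "\<dots> = (\<Sum>j\<in>J l'. quasi l' j)" by simp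
      also have "\<dots> \<le> G * quasi l' k'"
        unfolding G_def by (rule quasi_level_sum[OF finJ]) (auto simp: J_def S_def xl before_def)
      also have "\<dots> \<le> A * quasi l' k'" using A(2) quasi_nonneg by (intro mult_right_mono) auto
      finally show ?thesis .
    next
      case True
      then obtain i0 where i0: "l = Suc i0" "l' \<le> i0" by (cases l) auto
      have rl: "reached st (Suc i0)" using y yl i0 by (simp add: run_index_reached)
      have rl': "reached st (Suc l')" using rl by (rule reached_mono) (use i0 in simp)
      have first: "(\<Sum>j\<in>J l'. quasi l' j) \<le> G * quasi l' k'"
        unfolding G_def by (rule quasi_level_sum[OF finJ]) (auto simp: J_def S_def xl before_def)
      have later: "(\<Sum>j\<in>J (Suc i). quasi (Suc i) j) \<le> G * E * quasi i (?f i)" if "i \<in> {l'..i0}" for i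
      proof -
        have r: "reached st (Suc i)" using rl by (rule reached_mono) (use that in simp)
        have "(\<Sum>j\<in>J (Suc i). quasi (Suc i) j) \<le> G * quasi (Suc i) 0"
          unfolding G_def by (rule quasi_level_sum[OF finJ]) (auto simp: J_def S_def)
        also have "\<dots> \<le> G * (E * quasi i (?f i))"
          unfolding E_def using quasi_next[OF r] G by (intro mult_left_mono) auto
        finally show ?thesis by (simp add: mult.assoc)
      qed
      have "(\<Sum>i=l'..l. \<Sum>j\<in>J i. quasi i j)
          = (\<Sum>j\<in>J l'. quasi l' j) + (\<Sum>i=Suc l'..Suc i0. \<Sum>j\<in>J i. quasi i j)"
        using i0 by (simp add: sum.atLeast_Suc_atMost)
      also have "(\<Sum>i=Suc l'..Suc i0. \<Sum>j\<in>J i. quasi i j) = (\<Sum>i=l'..i0. \<Sum>j\<in>J (Suc i). quasi (Suc i) j)"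
        by (rule sum.shift_bounds_cl_Suc_ivl)
      also have "\<dots> \<le> (\<Sum>i=l'..i0. G * E * quasi i (?f i))" by (intro sum_mono later)
      also have "\<dots> = G * E * (\<Sum>i=l'..i0. quasi i (?f i))" by (simp add: sum_distrib_left)
      also have "\<dots> \<le> G * E * (K * quasi l' (?f l'))"
        using K(2)[OF rl, of l'] G E by (intro mult_left_mono) auto
      also have "quasi l' (?f l') \<le> C_level * q ^ (?f l' - k') * quasi l' k'"
        by (rule quasi_level[OF final_index_props(2)[OF rl'] run_index_le_final[OF _ rl']])
          (use x xl in simp)
      also have "\<dots> \<le> C_level * 1 * quasi l' k'"
        using bounds C_level_pos quasi_nonneg
        by (intro mult_right_mono mult_left_mono power_le_one) auto
      finally have "(\<Sum>i=l'..l. \<Sum>j\<in>J i. quasi i j) \<le> (\<Sum>j\<in>J l'. quasi l' j) + G * E * (K * (C_level * 1 * quasi l' k'))"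
        using G E K(1) by (simp add: mult_left_mono)
      with first show ?thesis by (simp add: A_def algebra_simps)
    qed
    finally show ?thesis unfolding S_def xl by simp
  qed
  thus ?thesis using A(1) by blast
qed

theorem full_r_linear_convergence:
  "\<exists>r C. 0 < r \<and> r < 1 \<and> C > 0 \<and> (\<forall>x\<in>run_index st. \<forall>y\<in>run_index st.
    counter st x \<le> counter st y \<longrightarrow>
      case_prod quasi y \<le> C * r ^ (counter st y - counter st x) * case_prod quasi x)"
proof -
  obtain K where K: "K > 0" "\<And>x y. x \<in> run_index st \<Longrightarrow> y \<in> run_index st \<Longrightarrow>
    (\<Sum>z | z \<in> run_index st \<and> before x z \<and> before z y. case_prod quasi z) \<le> K * case_prod quasi x"
    using segment_sums by blast
  show ?thesis
    by (rule r_linear_along_run[OF _ K]) (auto simp: quasi_nonneg)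
qed

end

section \<open>Convergence of the adaptive algorithm\<close>

text \<open>The last level up to \<open>l\<close> on which the algorithm computes. Meshes are only meaningful on reached
  levels; composing with this function yields an infinite nested sequence of spaces that becomes
  constant if the run stays on one mesh.\<close>

primrec last_reached :: "(nat \<Rightarrow> nat \<Rightarrow> bool) \<Rightarrow> nat \<Rightarrow> nat" where
  "last_reached st 0 = 0"
| "last_reached st (Suc l) = (if reached st (Suc l) then Suc l else last_reached st l)"

lemma reached_last_reached: "reached st (last_reached st l)"
  by (induction l) (auto simp: reached_def)

lemma last_reached_eq: "reached st l \<Longrightarrow> last_reached st l = l"
  by (cases l) auto

lemma last_reached_Suc_cases:
  "last_reached st (Suc l) = last_reached st l
   \<or> (reached st (Suc l) \<and> last_reached st (Suc l) = Suc l \<and> last_reached st l = l)"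
  using last_reached_eq[of st l] reached_mono[of st "Suc l" l] by auto

lemma last_reached_ge: "reached st n \<Longrightarrow> n \<le> l \<Longrightarrow> n \<le> last_reached st l"
proof (induction l)
  case (Suc l)
  show ?case
  proof (cases "n = Suc l")
    case True thus ?thesis using last_reached_eq Suc.prems by metis
  next
    case False thus ?thesis using Suc by auto
  qed
qed simp

text \<open>The marked elements are all refined, so the refined elements carry at least the fraction \<open>\<theta>\<close> of
  the squared estimator, and this part is reduced by the factor \<open>\<rho>\<^sup>2\<close>.\<close>

lemma marked_estimator_reduction:
  assumes fin: "finite \<T>H" "finite \<T>h"
    and common: "eta P \<T>h (\<T>h \<inter> \<T>H) v = eta P \<T>H (\<T>h \<inter> \<T>H) v"
    and refined: "eta P \<T>h (\<T>h - \<T>H) v \<le> \<rho> * eta P \<T>H (\<T>H - \<T>h) v"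
    and \<rho>: "0 \<le> \<rho>" "\<rho> \<le> 1"
    and marked: "\<M> \<in> marking_sets P \<theta> \<T>H v" "\<M> \<inter> \<T>h = {}"
  shows "eta P \<T>h \<T>h v \<le> sqrt (1 - (1 - \<rho>\<^sup>2) * \<theta>) * eta P \<T>H \<T>H v"
proof -
  let ?R = "(eta P \<T>H (\<T>H - \<T>h) v)\<^sup>2" and ?H = "(eta P \<T>H \<T>H v)\<^sup>2"
  have splith: "(eta P \<T>h \<T>h v)\<^sup>2 = (eta P \<T>h (\<T>h \<inter> \<T>H) v)\<^sup>2 + (eta P \<T>h (\<T>h - \<T>H) v)\<^sup>2"
    using eta_square_split[OF fin(2), of "\<T>h \<inter> \<T>H" P \<T>h v] by (simp add: Diff_Int)
  have splitH: "?H = (eta P \<T>H (\<T>h \<inter> \<T>H) v)\<^sup>2 + ?R"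
    using eta_square_split[OF fin(1), of "\<T>h \<inter> \<T>H" P \<T>H v] by (simp add: Diff_Int)
  have "(eta P \<T>h (\<T>h - \<T>H) v)\<^sup>2 \<le> \<rho>\<^sup>2 * ?R"
    using power_mono[OF refined eta_nonneg, of 2] by (simp add: power_mult_distrib)
  with splith splitH common have le: "(eta P \<T>h \<T>h v)\<^sup>2 \<le> ?H - (1 - \<rho>\<^sup>2) * ?R"
    by (simp add: algebra_simps)
  have "\<M> \<subseteq> \<T>H - \<T>h" using marked by (auto simp: marking_sets_def)
  hence "eta P \<T>H \<M> v \<le> eta P \<T>H (\<T>H - \<T>h) v" using fin by (intro eta_mono) auto
  hence "(eta P \<T>H \<M> v)\<^sup>2 \<le> ?R" by (intro power_mono eta_nonneg)
  hence "\<theta> * ?H \<le> ?R" using marked(1) by (simp add: marking_sets_def)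
  hence "(1 - \<rho>\<^sup>2) * (\<theta> * ?H) \<le> (1 - \<rho>\<^sup>2) * ?R"
    using \<rho> by (intro mult_left_mono) (auto simp: power_le_one)
  with le have "(eta P \<T>h \<T>h v)\<^sup>2 \<le> (1 - (1 - \<rho>\<^sup>2) * \<theta>) * ?H" by (simp add: algebra_simps)
  from real_sqrt_le_mono[OF this] show ?thesis by (simp add: real_sqrt_mult eta_nonneg)
qed

lemma step_count_eq_counter: "step_count P lam \<T> u l k = counter (stops P lam \<T> u) (l, k)"
  unfolding step_count_def counter_def
  by (rule arg_cong[of _ _ card]) (auto simp: index_set_def run_index_def reached_def before_def)

lemma index_set_eq_run_index: "index_set P lam \<T> u = run_index (stops P lam \<T> u)"
  by (auto simp: index_set_def run_index_def reached_def)

theorem theorem10: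
  fixes P :: "('d::finite) problem"
    and p :: nat
    and \<T>0 :: "'d tsimplex set"
    and ustar :: "real^'d \<Rightarrow> real"
    and uG :: "'d tsimplex set \<Rightarrow> real^'d \<Rightarrow> real"
    and \<Psi> :: "'d tsimplex set \<Rightarrow> (real^'d \<Rightarrow> real) \<Rightarrow> (real^'d \<Rightarrow> real)"
    and Cstab Crel Cmon Corth \<delta> qalg \<theta> Cmark lam :: real
    and u00 :: "real^'d \<Rightarrow> real"
    and \<T> \<M> :: "nat \<Rightarrow> 'd tsimplex set"
    and u :: "nat \<Rightarrow> nat \<Rightarrow> real^'d \<Rightarrow> real"
  assumes problem: "model_problem P"
    and degree: "p \<ge> 1"
    and initial_mesh: "conforming_mesh (pdom P) \<T>0"
    and regularity: "estimator_well_defined P p \<T>0"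
    and weak_solution: "solves_on P (pH10 P) ustar"
    and galerkin: "\<forall>\<T>H\<in>refinements (pdom P) \<T>0. solves_on P (fe_space P p \<T>H) (uG \<T>H)"
    and constants: "Cstab > 0" "Crel > 0" "Cmon > 0" "Corth > 0" "0 < \<delta>" "\<delta> \<le> 1"
    and stability: "\<forall>\<T>H\<in>refinements (pdom P) \<T>0. \<forall>\<T>h\<in>refinements (pdom P) \<T>H.
      \<forall>vH\<in>fe_space P p \<T>H. \<forall>vh\<in>fe_space P p \<T>h.
        \<bar>eta P \<T>h (\<T>h \<inter> \<T>H) vh - eta P \<T>H (\<T>h \<inter> \<T>H) vH\<bar> \<le> Cstab * enorm P (\<lambda>x. vh x - vH x)"
    and reduction: "\<forall>\<T>H\<in>refinements (pdom P) \<T>0. \<forall>\<T>h\<in>refinements (pdom P) \<T>H.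
      \<forall>vH\<in>fe_space P p \<T>H.
        eta P \<T>h (\<T>h - \<T>H) vH \<le> 2 powr (- 1 / (2 * CARD('d))) * eta P \<T>H (\<T>H - \<T>h) vH"
    and reliability: "\<forall>\<T>H\<in>refinements (pdom P) \<T>0.
      enorm P (\<lambda>x. ustar x - uG \<T>H x) \<le> Crel * eta P \<T>H \<T>H (uG \<T>H)"
    and quasi_monotonicity: "\<forall>\<T>H\<in>refinements (pdom P) \<T>0. \<forall>\<T>h\<in>refinements (pdom P) \<T>H.
      eta P \<T>h \<T>h (uG \<T>h) \<le> Cmon * eta P \<T>H \<T>H (uG \<T>H)"
    and quasi_orthogonality: "\<forall>V U.
      (\<forall>l::nat. findim_subspace P (V l) \<and> V l \<subseteq> V (Suc l) \<and> solves_on P (V l) (U l)) \<longrightarrow>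
      (\<forall>l N. (\<Sum>j=l..l+N. (enorm P (\<lambda>x. U (Suc j) x - U j x))\<^sup>2)
         \<le> Corth * real (N + 1) powr (1 - \<delta>) * (enorm P (\<lambda>x. ustar x - U l x))\<^sup>2)"
    and solver_rate: "0 < qalg" "qalg < 1"
    and solver_maps: "\<forall>\<T>H\<in>refinements (pdom P) \<T>0. \<forall>v\<in>fe_space P p \<T>H. \<Psi> \<T>H v \<in> fe_space P p \<T>H"
    and solver_contracts: "\<forall>\<T>H\<in>refinements (pdom P) \<T>0. \<forall>v\<in>fe_space P p \<T>H.
      enorm P (\<lambda>x. uG \<T>H x - \<Psi> \<T>H v x) \<le> qalg * enorm P (\<lambda>x. uG \<T>H x - v x)"
    and parameters: "0 < \<theta>" "\<theta> \<le> 1" "Cmark \<ge> 1" "lam > 0" "u00 \<in> fe_space P p \<T>0"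
    and run: "afem_run P \<Psi> \<theta> Cmark lam \<T>0 u00 \<T> \<M> u"
  shows "\<exists>qlin Clin :: real. 0 < qlin \<and> qlin < 1 \<and> Clin > 0 \<and>
    (\<forall>(l', k') \<in> index_set P lam \<T> u. \<forall>(l, k) \<in> index_set P lam \<T> u.
       step_count P lam \<T> u l' k' \<le> step_count P lam \<T> u l k \<longrightarrow>
       quasi_error P uG \<T> u l k
         \<le> Clin * qlin ^ (step_count P lam \<T> u l k - step_count P lam \<T> u l' k')
             * quasi_error P uG \<T> u l' k')"
proof -
  define st where "st = stops P lam \<T> u"
  note Q = index_set_eq_run_index[of P lam \<T> u, folded st_def]
  have fin_eq: "kfin P lam \<T> u l = final_index st l" for l
    by (simp add: kfin_def final_index_def st_def)

  have mesh_step: "\<T> (Suc l) \<in> refinements (pdom P) (\<T> l)"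
    and marked: "\<M> l \<in> marking_sets P \<theta> (\<T> l) (u l (final_index st l))" "\<M> l \<inter> \<T> (Suc l) = {}"
    and init: "u (Suc l) 0 = u l (final_index st l)"
    if "reached st (Suc l)" for l
    using run that unfolding afem_run_def Q fin_eq Let_def is_refine_def run_index_0 by blast+
  have T0: "\<T> 0 = \<T>0" "u 0 0 = u00"
    and solver: "(l, Suc k) \<in> run_index st \<Longrightarrow> u l (Suc k) = \<Psi> (\<T> l) (u l k)" for l k
    using run unfolding afem_run_def Q by blast+
  have mesh_chain: "\<T> l \<in> refinements (pdom P) (\<T> n)"
    if "n \<le> l" "reached st l" "conforming_mesh (pdom P) (\<T> n)" for n l
    using that
  proof (induction l rule: dec_induct)
    case base
    thus ?case by (intro refinements_refl)
  next
    case (step l)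
    have "\<T> l \<in> refinements (pdom P) (\<T> n)"
      using step.IH[OF reached_mono[OF step.prems(1)]] step.prems(2) by simp
    thus ?case using mesh_step[OF step.prems(1)] by (rule refinements_trans)
  qed
  have mesh: "\<T> l \<in> refinements (pdom P) \<T>0" if "reached st l" for l
    using mesh_chain[of 0 l] that initial_mesh T0 by simp
  have conf: "conforming_mesh (pdom P) (\<T> l)" if "reached st l" for l
    using mesh[OF that] by (simp add: refinements_def)
  have nested: "fe_space P p (\<T> l) \<subseteq> fe_space P p (\<T> (Suc l))" if "reached st (Suc l)" for l
    using mesh_step[OF that] conf[of l] reached_mono[OF that, of l]
    by (intro fe_space_nested) (auto simp: refinements_def)

  have iterate: "u l k \<in> fe_space P p (\<T> l)" if "(l, k) \<in> run_index st" for l k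
    using that
  proof (induction l arbitrary: k)
    case 0
    thus ?case
    proof (induction k)
      case (Suc k)
      thus ?case using solver[OF Suc.prems] solver_maps mesh[of 0] run_index_mono[OF Suc.prems, of k]
        by (auto simp: reached_def)
    qed (use T0 parameters in simp)
  next
    case (Suc l)
    show ?case using Suc.prems
    proof (induction k)
      case 0
      hence r: "reached st (Suc l)" by (simp add: run_index_0)
      show ?case using Suc.IH[OF final_index_props(2)[OF r]] nested[OF r] init[OF r] by auto
    next
      case (Suc k)
      thus ?case using solver[OF Suc.prems] solver_maps mesh[OF run_index_reached[OF Suc.prems]]
          run_index_mono[OF Suc.prems, of k] by auto
    qed
  qed
  have G: "uG (\<T> l) \<in> fe_space P p (\<T> l)" if "reached st l" for l
    using galerkin mesh[OF that] by (auto simp: solves_on_def)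
  have ustar: "ustar \<in> pH10 P" using weak_solution by (simp add: solves_on_def)
  have GH: "uG (\<T> l) \<in> pH10 P" if "reached st l" for l using G[OF that] fe_space_subset by blast
  have uH: "u l k \<in> pH10 P" if "(l, k) \<in> run_index st" for l k using iterate[OF that] fe_space_subset by blast
  note tri = enorm_diff_triangle[OF problem] and comm = enorm_diff_commute[OF problem]

  define e where "e l k = enorm P (\<lambda>x. uG (\<T> l) x - u l k x)" for l k
  define \<eta> where "\<eta> l k = eta P (\<T> l) (\<T> l) (u l k)" for l k
  define m where "m l = eta P (\<T> l) (\<T> l) (uG (\<T> l))" for l

  define c where "c = last_reached st"
  define V where "V l = fe_space P p (\<T> (c l))" for l
  define U where "U l = uG (\<T> (c l))" for l
  define b where "b l = enorm P (\<lambda>x. U (Suc l) x - U l x)" for l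
  have c: "reached st (c l)" for l unfolding c_def by (rule reached_last_reached)
  have c_eq: "c l = l" if "reached st l" for l unfolding c_def by (rule last_reached_eq[OF that])
  have UH: "U l \<in> pH10 P" for l unfolding U_def by (rule GH[OF c])
  \<comment> \<open>Reliability and quasi-monotonicity bound all later Galerkin errors by one estimator value.\<close>
  have galerkin_error: "enorm P (\<lambda>x. ustar x - U l x) \<le> Crel * (Cmon * m n)"
    if "reached st n" "n \<le> l" for l n
  proof -
    have "n \<le> c l" unfolding c_def by (rule last_reached_ge[OF that])
    hence ref: "\<T> (c l) \<in> refinements (pdom P) (\<T> n)" using mesh_chain c conf[OF that(1)] by blast
    have "enorm P (\<lambda>x. ustar x - U l x) \<le> Crel * eta P (\<T> (c l)) (\<T> (c l)) (uG (\<T> (c l)))"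
      using reliability mesh[OF c] by (simp add: U_def)
    also have "\<dots> \<le> Crel * (Cmon * m n)"
      unfolding m_def using quasi_monotonicity ref mesh[OF that(1)] constants by (intro mult_left_mono) auto
    finally show ?thesis .
  qed
  have spaces: "findim_subspace P (V l) \<and> V l \<subseteq> V (Suc l) \<and> solves_on P (V l) (U l)" for l
  proof (intro conjI)
    show "findim_subspace P (V l)"
      unfolding V_def by (rule fe_space_findim[OF problem conf[OF c] G[OF c]])
    show "V l \<subseteq> V (Suc l)"
      using last_reached_Suc_cases[of st l] nested[of l] unfolding V_def c_def by auto
    show "solves_on P (V l) (U l)"
      unfolding V_def U_def using galerkin mesh[OF c] by blast
  qed
  hence orth: "(\<Sum>j=l..l+N. (b j)\<^sup>2) \<le> Corth * real (N + 1) powr (1 - \<delta>) * (enorm P (\<lambda>x. ustar x - U l x))\<^sup>2" for l N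
    using quasi_orthogonality unfolding b_def by blast

  have stab: "eta P (\<T> l) (\<T> l) v \<le> eta P (\<T> l) (\<T> l) w + Cstab * enorm P (\<lambda>x. v x - w x)"
    if "reached st l" "v \<in> fe_space P p (\<T> l)" "w \<in> fe_space P p (\<T> l)" for l v w
    using stability[rule_format, OF mesh[OF that(1)] refinements_refl[OF conf[OF that(1)]] that(3,2)]
    by simp

  define \<rho> :: real where "\<rho> = 2 powr (- 1 / (2 * CARD('d)))"
  have \<rho>: "0 < \<rho>" "\<rho> < 1"
  proof -
    have "(2::real) powr (- 1 / (2 * CARD('d))) < 2 powr 0" by (intro powr_less_mono) auto
    thus "\<rho> < 1" by (simp add: \<rho>_def)
  qed (simp add: \<rho>_def)
  define q\<theta> where "q\<theta> = sqrt (1 - (1 - \<rho>\<^sup>2) * \<theta>)"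
  have \<rho>2: "0 < \<rho>\<^sup>2" "\<rho>\<^sup>2 < 1" using \<rho> by (auto simp: power_less_one_iff)
  have q\<theta>: "0 < q\<theta>" "q\<theta> < 1"
  proof -
    have "(1 - \<rho>\<^sup>2) * \<theta> \<le> (1 - \<rho>\<^sup>2) * 1" using parameters \<rho>2 by (intro mult_left_mono) auto
    also have "\<dots> < 1" using \<rho>2 by simp
    finally have "0 < 1 - (1 - \<rho>\<^sup>2) * \<theta>" by simp
    thus "0 < q\<theta>" unfolding q\<theta>_def by (simp only: real_sqrt_gt_0_iff)
    show "q\<theta> < 1" using parameters \<rho>2 unfolding q\<theta>_def by simp
  qed

  interpret adaptive_run st e \<eta> m b qalg q\<theta> "1 / lam" Cstab "2 * Crel * Cmon" "Corth * (Crel * Cmon)\<^sup>2" \<delta>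
  proof
    show "\<not> st l 0" for l by (simp add: st_def stops_def)
    show "0 \<le> e l k" "0 \<le> \<eta> l k" "0 \<le> m l" "0 \<le> b l" for l k
      by (simp_all add: e_def \<eta>_def m_def b_def enorm_nonneg[OF problem] eta_nonneg)
    show "e l (Suc k) \<le> qalg * e l k" if "(l, Suc k) \<in> run_index st" for l k
      unfolding e_def solver[OF that]
      using solver_contracts mesh[OF run_index_reached[OF that]] iterate[OF run_index_mono[OF that, of k]]
      by simp
    show "\<eta> l (Suc k) \<le> 1 / lam * (e l (Suc k) + e l k)"
      if kQ: "(l, Suc k) \<in> run_index st" and ns: "\<not> st l (Suc k)" for l k
    proof -
      note H = uH[OF kQ] GH[OF run_index_reached[OF kQ]] uH[OF run_index_mono[OF kQ, of k]]
      have "lam * \<eta> l (Suc k) < enorm P (\<lambda>x. u l (Suc k) x - u l k x)"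
        using ns by (simp add: st_def stops_def \<eta>_def)
      also have "\<dots> \<le> e l (Suc k) + e l k"
        using tri[OF H(1,2,3)] comm[OF H(1,2)] by (simp add: e_def)
      finally show ?thesis using parameters by (simp add: field_simps)
    qed
    show "\<eta> l k' \<le> \<eta> l k + Cstab * (e l k' + e l k)"
      if k: "(l, k) \<in> run_index st" and k': "(l, k') \<in> run_index st" for l k k'
    proof -
      have "enorm P (\<lambda>x. u l k' x - u l k x) \<le> e l k' + e l k"
        using tri[OF uH[OF k'] GH uH[OF k]] comm[OF uH[OF k'] GH] run_index_reached[OF k]
        by (simp add: e_def)
      hence "Cstab * enorm P (\<lambda>x. u l k' x - u l k x) \<le> Cstab * (e l k' + e l k)"
        using constants by (intro mult_left_mono) auto
      with stab[OF run_index_reached[OF k] iterate[OF k'] iterate[OF k]] show ?thesis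
        by (simp add: \<eta>_def)
    qed
    show "e (Suc l) 0 \<le> e l (final_index st l) + b l" if r: "reached st (Suc l)" for l
    proof -
      have r': "reached st l" using r by (rule reached_mono) simp
      show ?thesis
        using tri[OF GH[OF r] GH[OF r'] uH[OF final_index_props(2)[OF r]]]
        by (simp add: e_def b_def U_def c_eq[OF r] c_eq[OF r'] init[OF r])
    qed
    show "\<eta> (Suc l) 0 \<le> q\<theta> * \<eta> l (final_index st l)" if r: "reached st (Suc l)" for l
    proof -
      let ?v = "u l (final_index st l)"
      have r': "reached st l" using r by (rule reached_mono) simp
      have v: "?v \<in> fe_space P p (\<T> l)" by (rule iterate[OF final_index_props(2)[OF r]])
      have v': "?v \<in> fe_space P p (\<T> (Suc l))" using v nested[OF r] by blast
      have "enorm P (\<lambda>x. ?v x - ?v x) = 0"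
        by (rule enorm_diff_self[OF problem]) (use v fe_space_subset in blast)
      hence common: "eta P (\<T> (Suc l)) (\<T> (Suc l) \<inter> \<T> l) ?v = eta P (\<T> l) (\<T> (Suc l) \<inter> \<T> l) ?v"
        using stability[rule_format, OF mesh[OF r'] mesh_step[OF r] v v'] by simp
      have refined: "eta P (\<T> (Suc l)) (\<T> (Suc l) - \<T> l) ?v \<le> \<rho> * eta P (\<T> l) (\<T> l - \<T> (Suc l)) ?v"
        unfolding \<rho>_def using reduction mesh[OF r'] mesh_step[OF r] v by blast
      have "\<eta> (Suc l) 0 = eta P (\<T> (Suc l)) (\<T> (Suc l)) ?v" by (simp add: \<eta>_def init[OF r])
      also have "\<dots> \<le> q\<theta> * \<eta> l (final_index st l)"
        unfolding q\<theta>_def \<eta>_def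
        by (rule marked_estimator_reduction[OF conforming_mesh_finite[OF conf[OF r']]
              conforming_mesh_finite[OF conf[OF r]] common refined _ _ marked[OF r]])
           (use \<rho> in auto)
      finally show ?thesis .
    qed
    show "m l \<le> \<eta> l k + Cstab * e l k" if k: "(l, k) \<in> run_index st" for l k
      using stab[OF run_index_reached[OF k] G[OF run_index_reached[OF k]] iterate[OF k]]
      by (simp add: m_def \<eta>_def e_def)
    show "b l \<le> 2 * Crel * Cmon * m n" if n: "reached st n" "n \<le> l" for n l
    proof -
      have "b l \<le> enorm P (\<lambda>x. ustar x - U (Suc l) x) + enorm P (\<lambda>x. ustar x - U l x)"
        using tri[OF UH ustar UH, of "Suc l" l] comm[OF UH ustar, of "Suc l"] by (simp add: b_def)
      with galerkin_error[OF n] galerkin_error[OF n(1), of "Suc l"] n(2) show ?thesis by simp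
    qed
    show "(\<Sum>j=n..n+N. (b j)\<^sup>2) \<le> Corth * (Crel * Cmon)\<^sup>2 * real (N + 1) powr (1 - \<delta>) * (m n)\<^sup>2"
      if n: "reached st n" for n N
    proof -
      have "(enorm P (\<lambda>x. ustar x - U n x))\<^sup>2 \<le> (Crel * (Cmon * m n))\<^sup>2"
        using galerkin_error[OF n] by (intro power_mono enorm_nonneg[OF problem]) auto
      hence "Corth * real (N + 1) powr (1 - \<delta>) * (enorm P (\<lambda>x. ustar x - U n x))\<^sup>2
          \<le> Corth * real (N + 1) powr (1 - \<delta>) * (Crel * (Cmon * m n))\<^sup>2"
        using constants by (intro mult_left_mono) auto
      with orth[of n N] show ?thesis by (simp add: power_mult_distrib mult_ac)
    qed
  qed (use constants solver_rate parameters q\<theta> in auto)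

  obtain r C where rC: "0 < r" "r < 1" "C > 0" "\<And>x y. x \<in> run_index st \<Longrightarrow> y \<in> run_index st \<Longrightarrow>
    counter st x \<le> counter st y \<Longrightarrow>
      case_prod quasi y \<le> C * r ^ (counter st y - counter st x) * case_prod quasi x"
    using full_r_linear_convergence by blast
  have "quasi_error P uG \<T> u l k = quasi l k" for l k
    by (simp add: quasi_error_def quasi_def e_def \<eta>_def)
  hence "quasi_error P uG \<T> u l k \<le> C * r ^ (step_count P lam \<T> u l k - step_count P lam \<T> u l' k')
             * quasi_error P uG \<T> u l' k'"
    if "(l', k') \<in> index_set P lam \<T> u" "(l, k) \<in> index_set P lam \<T> u"
      "step_count P lam \<T> u l' k' \<le> step_count P lam \<T> u l k" for l k l' k'
    using rC(4)[of "(l', k')" "(l, k)"] that unfolding Q step_count_eq_counter st_def[symmetric] by simp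
  thus ?thesis using rC(1-3) by blast
qed

end
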